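(* Let $(M,g)$ be a simply-connected minimal Lorentzian surface in $\mathbb{S}^{1,2}$, represented by a spinor field $\varphi\in\Gamma(\Sigma)$ with $$D\varphi=e_1\cdot\varphi,\qquad H(\varphi,\varphi)=1.$$ Then the spinor field $\tilde\varphi:=\varphi^++e_0\cdot\varphi^+\in\Gamma(\Sigma)$ satisfies $$D\tilde\varphi=e_1\cdot\tilde\varphi,\qquad H(\tilde\varphi,\tilde\varphi)=1,\qquad e_0\cdot\tilde\varphi=\tilde\varphi,$$ and thus induces an isometric immersion of $(M,g)$ into $\mathbb{R}^{2,1}$ with constant mean curvature $1$.
   Context: Algebra. $\mathcal{A}=\{u+\sigma v:u,v\in\mathbb{R}\}$ with $\sigma^2=1$ (Lorentz numbers), $\mathcal{A}_{\mathbb{C}}=\{u+\sigma v:u,v\in\mathbb{C}\}$, $\widehat{u+\sigma v}=u-\sigma v$. $\mathbb{H}^{\mathcal{A}_{\mathbb C}}$ is the algebra of quaternions $\zeta_0 1+\zeta_1I+\zeta_2J+\zeta_3K$ with $\zeta_k\in\mathcal{A}_{\mathbb{C}}$ ($I^2=J^2=K^2=-1$, $IJ=-JI=K$); $\overline\zeta$ is quaternionic conjugation, $\widehat\zeta$ is $\widehat{\cdot}$ applied to each coefficient, $H(\zeta,\zeta')=\sum_k\zeta_k\zeta_k'$. Set $\mathbb{H}_0=\{p_01+ip_1I+p_2J+ip_3K:p_k\in\mathcal{A}\}$ and $\mathbb{H}_1=\{iq_01+q_1I+iq_2J+q_3K:q_k\in\mathcal{A}\}$. $\mathbb{R}^{2,2}$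 ($\mathbb{R}^4$ with metric $-dx_0^2+dx_1^2-dx_2^2+dx_3^2$) is identified with $\{\sigma ix_01+x_1I+ix_2J+x_3K:x_k\in\mathbb{R}\}\subset\mathbb{H}_1$, the metric being $H$. $\mathbb{S}^{1,2}=\{x\in\mathbb{R}^{2,2}:\langle x,x\rangle=1\}$; $\mathbb{R}^{2,1}=(\sigma i1)^\perp\subset\mathbb{R}^{2,2}$. Bundles. $(M,g)$ is a Lorentzian surface (metric of signature $(1,1)$) and $E=\mathbb{R}e_0\oplus\mathbb{R}e_1$ is a rank $2$ bundle on $M$ with a Lorentzian fibre metric and compatible connection, $e_0,e_1$ being orthogonal parallel sections with $\langle e_0,e_0\rangle=-1$, $\langle e_1,e_1\rangle=1$; $M$ and $E$ are oriented in space and time with spin structures $\tilde Q_M,\tilde Q_E$; $\tilde Q=\tilde Q_E\times_M\tilde Q_M$. $\Sigma=\Sigma E\otimes\Sigma M=\tilde Q\times\mathbb{H}_0/\rho$, where the structure group acts through $\{\pm(\cosh a+i\sinh a\,I):a\in\mathcal{A}\}\subset\mathbb{H}_0$ by left multiplication; $\nabla$ is the tensor product of the spin connections. In a spinorial frame above an adapted orthonormal frame $(e_0,e_1,e_2,e_3)$ ($e_2,e_3$ tangent, $|e_2|^2=-1$, $|e_3|^2=1$), a spinor $\varphi$ has coordinates $[\varphi]\in\mathbb{H}_0$, the vectors $e_0,e_1,e_2,e_3$ have coordinates $\sigma i1,I,iJ,K$, and Clifford multiplication by $X\in E\oplus TM$ is $[X\cdot\varphi]=\sigma i[X]\widehat{[\varphi]}$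 (so $X\cdot X\cdot\varphi=-\langle X,X\rangle\varphi$). $H(\varphi,\varphi'):=H([\varphi],[\varphi'])$. $\varphi=\varphi^++\varphi^-$ is the decomposition with $\sigma[\varphi^\pm]=\pm[\varphi^\pm]$. $D\varphi=-e_2\cdot\nabla_{e_2}\varphi+e_3\cdot\nabla_{e_3}\varphi$. The pairing $\langle\langle\varphi,\varphi'\rangle\rangle=\sigma i\,\overline{[\varphi']}[\varphi]\in\mathbb{H}_1$. Known facts. If $M$ is simply connected, $\vec H\in\Gamma(E)$, $D\varphi=\vec H\cdot\varphi$ and $H(\varphi,\varphi)=1$, then $\xi(X)=\langle\langle X\cdot\varphi,\varphi\rangle\rangle$ ($X\in TM$) is a closed $\mathbb{R}^{2,2}$-valued $1$-form and $F=\int\xi$ is an isometric immersion in $\mathbb{R}^{2,2}$ (unique up to translation, said to be induced by $\varphi$) with normal bundle $E$ (through $X\in E\mapsto\langle\langle X\cdot\varphi,\varphi\rangle\rangle$) and mean curvature vector $\vec H=\frac12\mathrm{tr}_gB$. An immersion in $\mathbb{S}^{1,2}$ of mean curvature function $H$ is represented by such a $\varphi$ with $\vec H=-He_0+e_1$ and $F=\langle\langle -e_1\cdot\varphi,\varphi\rangle\rangle$; minimal means $H=0$. Immersions into $\mathbb{R}^{2,1}$ are understood up to translation; there the mean curvature is the function $H$ with $\vec H=He_1$, $e_1$ the unit spacelike normal. *)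

theory Defs
  imports "HOL-Analysis.Analysis"
begin

section \<open>Lorentz numbers\<close>

text \<open>\<open>Lorentz u v\<close> stands for \<open>u + \<sigma> v\<close> with \<open>\<sigma>\<^sup>2 = 1\<close>. The Lorentz numbers \<open>\<A>\<close> are
  \<open>real lorentz\<close> and their complexification \<open>\<A>\<^sub>\<complex>\<close> is \<open>complex lorentz\<close>.\<close>

datatype 'a lorentz = Lorentz (lre: 'a) (lsig: 'a)

lemma lorentz_eq_iff: "x = y \<longleftrightarrow> lre x = lre y \<and> lsig x = lsig y"
  by (cases x; cases y) simp

instantiation lorentz :: (ab_group_add) ab_group_add
begin
definition zero_lorentz where "0 = Lorentz 0 0"
definition plus_lorentz where "x + y = Lorentz (lre x + lre y) (lsig x + lsig y)"
definition minus_lorentz where "x - y = Lorentz (lre x - lre y) (lsig x - lsig y)"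
definition uminus_lorentz where "- x = Lorentz (- lre x) (- lsig x)"
instance
  by standard (simp_all add: lorentz_eq_iff zero_lorentz_def plus_lorentz_def
      minus_lorentz_def uminus_lorentz_def algebra_simps)
end

lemma lorentz_add_sel [simp]:
  "lre 0 = 0" "lsig 0 = 0"
  "lre (x + y) = lre x + lre y" "lsig (x + y) = lsig x + lsig y"
  "lre (x - y) = lre x - lre y" "lsig (x - y) = lsig x - lsig y"
  "lre (- x) = - lre x" "lsig (- x) = - lsig x"
  by (simp_all add: zero_lorentz_def plus_lorentz_def minus_lorentz_def uminus_lorentz_def)

instantiation lorentz :: (ring_1) ring_1
begin
definition one_lorentz where "1 = Lorentz 1 0"
definition times_lorentz where
  "x * y = Lorentz (lre x * lre y + lsig x * lsig y) (lre x * lsig y + lsig x * lre y)"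
instance
  by standard (simp_all add: lorentz_eq_iff one_lorentz_def times_lorentz_def algebra_simps)
end

lemma lorentz_mult_sel [simp]:
  "lre 1 = 1" "lsig 1 = 0"
  "lre (x * y) = lre x * lre y + lsig x * lsig y"
  "lsig (x * y) = lre x * lsig y + lsig x * lre y"
  by (simp_all add: one_lorentz_def times_lorentz_def)

instance lorentz :: (comm_ring_1) comm_ring_1
  by standard (simp_all add: lorentz_eq_iff algebra_simps)

text \<open>The norms on \<open>'a lorentz\<close> and, below, on \<open>'a quat\<close> only provide the usual topology of these
  finite-dimensional spaces; the sum norms are chosen because they are submultiplicative.\<close>

instantiation lorentz :: (real_normed_vector) real_normed_vector
begin
definition scaleR_lorentz :: "real \<Rightarrow> 'a lorentz \<Rightarrow> 'a lorentz" where
  "r *\<^sub>R x = Lorentz (r *\<^sub>R lre x) (r *\<^sub>R lsig x)"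
definition norm_lorentz :: "'a lorentz \<Rightarrow> real" where
  "norm x = norm (lre x) + norm (lsig x)"
definition dist_lorentz :: "'a lorentz \<Rightarrow> 'a lorentz \<Rightarrow> real" where
  "dist_lorentz x y = norm (x - y)"
definition sgn_lorentz :: "'a lorentz \<Rightarrow> 'a lorentz" where
  "sgn_lorentz x = scaleR (inverse (norm x)) x"
definition uniformity_lorentz :: "('a lorentz \<times> 'a lorentz) filter" where
  [code del]: "uniformity_lorentz = (INF e\<in>{0<..}. principal {(x, y). dist x y < e})"
definition open_lorentz :: "'a lorentz set \<Rightarrow> bool" where
  [code del]: "open_lorentz U \<longleftrightarrow> (\<forall>x\<in>U. eventually (\<lambda>(x', y). x' = x \<longrightarrow> y \<in> U) uniformity)"
instance
proof
  fix x y :: "'a lorentz" and r s :: real and U :: "'a lorentz set"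
  show "dist x y = norm (x - y)" "sgn x = scaleR (inverse (norm x)) x"
    by (simp_all add: dist_lorentz_def sgn_lorentz_def)
  show "(uniformity :: ('a lorentz \<times> 'a lorentz) filter)
      = (INF e\<in>{0<..}. principal {(x, y). dist x y < e})"
    by (rule uniformity_lorentz_def)
  show "open U \<longleftrightarrow> (\<forall>x\<in>U. eventually (\<lambda>(x', y). x' = x \<longrightarrow> y \<in> U) uniformity)"
    by (rule open_lorentz_def)
  show "r *\<^sub>R (x + y) = r *\<^sub>R x + r *\<^sub>R y" "(r + s) *\<^sub>R x = r *\<^sub>R x + s *\<^sub>R x"
    "r *\<^sub>R s *\<^sub>R x = (r * s) *\<^sub>R x" "1 *\<^sub>R x = x"
    by (simp_all add: scaleR_lorentz_def lorentz_eq_iff algebra_simps)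
  show "norm x = 0 \<longleftrightarrow> x = 0"
    by (simp add: norm_lorentz_def lorentz_eq_iff add_nonneg_eq_0_iff)
  show "norm (x + y) \<le> norm x + norm y"
    using norm_triangle_ineq[of "lre x" "lre y"] norm_triangle_ineq[of "lsig x" "lsig y"]
    by (simp add: norm_lorentz_def)
  show "norm (r *\<^sub>R x) = \<bar>r\<bar> * norm x"
    by (simp add: norm_lorentz_def scaleR_lorentz_def algebra_simps)
qed
end

lemma lorentz_scaleR_sel [simp]:
  "lre (r *\<^sub>R x) = r *\<^sub>R lre x" "lsig (r *\<^sub>R x) = r *\<^sub>R lsig x"
  by (simp_all add: scaleR_lorentz_def)

instance lorentz :: (real_normed_algebra_1) real_normed_algebra_1
proof
  fix x y :: "'a lorentz" and r :: real
  show "r *\<^sub>R x * y = r *\<^sub>R (x * y)" "x * r *\<^sub>R y = r *\<^sub>R (x * y)"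
    by (simp_all add: lorentz_eq_iff algebra_simps)
  show "norm (1 :: 'a lorentz) = 1"
    by (simp add: norm_lorentz_def)
  have "norm (x * y) \<le> (norm (lre x) * norm (lre y) + norm (lsig x) * norm (lsig y))
      + (norm (lre x) * norm (lsig y) + norm (lsig x) * norm (lre y))"
    unfolding norm_lorentz_def lorentz_mult_sel
    by (intro add_mono order_trans[OF norm_triangle_ineq] norm_mult_ineq)
  then show "norm (x * y) \<le> norm x * norm y"
    by (simp add: norm_lorentz_def algebra_simps)
qed

definition sigma :: "'a::ring_1 lorentz" where "sigma = Lorentz 0 1"

definition imag :: "complex lorentz" where "imag = Lorentz \<i> 0"

definition lhat :: "'a::ring_1 lorentz \<Rightarrow> 'a lorentz" where
  "lhat x = Lorentz (lre x) (- lsig x)"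

definition lcomplex :: "real lorentz \<Rightarrow> complex lorentz" where
  "lcomplex x = Lorentz (complex_of_real (lre x)) (complex_of_real (lsig x))"


section \<open>Quaternions with coefficients in a ring\<close>

datatype 'a quat = Quat (qc0: 'a) (qc1: 'a) (qc2: 'a) (qc3: 'a)

lemma quat_eq_iff:
  "x = y \<longleftrightarrow> qc0 x = qc0 y \<and> qc1 x = qc1 y \<and> qc2 x = qc2 y \<and> qc3 x = qc3 y"
  by (cases x; cases y) simp

instantiation quat :: (ab_group_add) ab_group_add
begin
definition zero_quat where "0 = Quat 0 0 0 0"
definition plus_quat where
  "x + y = Quat (qc0 x + qc0 y) (qc1 x + qc1 y) (qc2 x + qc2 y) (qc3 x + qc3 y)"
definition minus_quat where
  "x - y = Quat (qc0 x - qc0 y) (qc1 x - qc1 y) (qc2 x - qc2 y) (qc3 x - qc3 y)"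
definition uminus_quat where "- x = Quat (- qc0 x) (- qc1 x) (- qc2 x) (- qc3 x)"
instance
  by standard (simp_all add: quat_eq_iff zero_quat_def plus_quat_def
      minus_quat_def uminus_quat_def algebra_simps)
end

lemma quat_add_sel [simp]:
  "qc0 0 = 0" "qc1 0 = 0" "qc2 0 = 0" "qc3 0 = 0"
  "qc0 (x + y) = qc0 x + qc0 y" "qc1 (x + y) = qc1 x + qc1 y"
  "qc2 (x + y) = qc2 x + qc2 y" "qc3 (x + y) = qc3 x + qc3 y"
  "qc0 (x - y) = qc0 x - qc0 y" "qc1 (x - y) = qc1 x - qc1 y"
  "qc2 (x - y) = qc2 x - qc2 y" "qc3 (x - y) = qc3 x - qc3 y"
  "qc0 (- x) = - qc0 x" "qc1 (- x) = - qc1 x" "qc2 (- x) = - qc2 x" "qc3 (- x) = - qc3 x"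
  by (simp_all add: zero_quat_def plus_quat_def minus_quat_def uminus_quat_def)

instantiation quat :: (ring_1) ring_1
begin
definition one_quat where "1 = Quat 1 0 0 0"
definition times_quat where
  "x * y = Quat
     (qc0 x * qc0 y - qc1 x * qc1 y - qc2 x * qc2 y - qc3 x * qc3 y)
     (qc0 x * qc1 y + qc1 x * qc0 y + qc2 x * qc3 y - qc3 x * qc2 y)
     (qc0 x * qc2 y - qc1 x * qc3 y + qc2 x * qc0 y + qc3 x * qc1 y)
     (qc0 x * qc3 y + qc1 x * qc2 y - qc2 x * qc1 y + qc3 x * qc0 y)"
instance
  by standard (simp_all add: quat_eq_iff one_quat_def times_quat_def algebra_simps)
end

lemma quat_mult_sel [simp]:
  "qc0 1 = 1" "qc1 1 = 0" "qc2 1 = 0" "qc3 1 = 0"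
  "qc0 (x * y) = qc0 x * qc0 y - qc1 x * qc1 y - qc2 x * qc2 y - qc3 x * qc3 y"
  "qc1 (x * y) = qc0 x * qc1 y + qc1 x * qc0 y + qc2 x * qc3 y - qc3 x * qc2 y"
  "qc2 (x * y) = qc0 x * qc2 y - qc1 x * qc3 y + qc2 x * qc0 y + qc3 x * qc1 y"
  "qc3 (x * y) = qc0 x * qc3 y + qc1 x * qc2 y - qc2 x * qc1 y + qc3 x * qc0 y"
  by (simp_all add: one_quat_def times_quat_def)

instantiation quat :: (real_normed_vector) real_normed_vector
begin
definition scaleR_quat :: "real \<Rightarrow> 'a quat \<Rightarrow> 'a quat" where
  "r *\<^sub>R x = Quat (r *\<^sub>R qc0 x) (r *\<^sub>R qc1 x) (r *\<^sub>R qc2 x) (r *\<^sub>R qc3 x)"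
definition norm_quat :: "'a quat \<Rightarrow> real" where
  "norm x = norm (qc0 x) + norm (qc1 x) + norm (qc2 x) + norm (qc3 x)"
definition dist_quat :: "'a quat \<Rightarrow> 'a quat \<Rightarrow> real" where
  "dist_quat x y = norm (x - y)"
definition sgn_quat :: "'a quat \<Rightarrow> 'a quat" where
  "sgn_quat x = scaleR (inverse (norm x)) x"
definition uniformity_quat :: "('a quat \<times> 'a quat) filter" where
  [code del]: "uniformity_quat = (INF e\<in>{0<..}. principal {(x, y). dist x y < e})"
definition open_quat :: "'a quat set \<Rightarrow> bool" where
  [code del]: "open_quat U \<longleftrightarrow> (\<forall>x\<in>U. eventually (\<lambda>(x', y). x' = x \<longrightarrow> y \<in> U) uniformity)"
instance
proof
  fix x y :: "'a quat" and r s :: real and U :: "'a quat set"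
  show "dist x y = norm (x - y)" "sgn x = scaleR (inverse (norm x)) x"
    by (simp_all add: dist_quat_def sgn_quat_def)
  show "(uniformity :: ('a quat \<times> 'a quat) filter)
      = (INF e\<in>{0<..}. principal {(x, y). dist x y < e})"
    by (rule uniformity_quat_def)
  show "open U \<longleftrightarrow> (\<forall>x\<in>U. eventually (\<lambda>(x', y). x' = x \<longrightarrow> y \<in> U) uniformity)"
    by (rule open_quat_def)
  show "r *\<^sub>R (x + y) = r *\<^sub>R x + r *\<^sub>R y" "(r + s) *\<^sub>R x = r *\<^sub>R x + s *\<^sub>R x"
    "r *\<^sub>R s *\<^sub>R x = (r * s) *\<^sub>R x" "1 *\<^sub>R x = x"
    by (simp_all add: scaleR_quat_def quat_eq_iff algebra_simps)
  show "norm x = 0 \<longleftrightarrow> x = 0"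
    by (simp add: norm_quat_def quat_eq_iff add_nonneg_eq_0_iff)
  show "norm (x + y) \<le> norm x + norm y"
    using norm_triangle_ineq[of "qc0 x" "qc0 y"] norm_triangle_ineq[of "qc1 x" "qc1 y"]
      norm_triangle_ineq[of "qc2 x" "qc2 y"] norm_triangle_ineq[of "qc3 x" "qc3 y"]
    by (simp add: norm_quat_def)
  show "norm (r *\<^sub>R x) = \<bar>r\<bar> * norm x"
    by (simp add: norm_quat_def scaleR_quat_def algebra_simps)
qed
end

lemma quat_scaleR_sel [simp]:
  "qc0 (r *\<^sub>R x) = r *\<^sub>R qc0 x" "qc1 (r *\<^sub>R x) = r *\<^sub>R qc1 x"
  "qc2 (r *\<^sub>R x) = r *\<^sub>R qc2 x" "qc3 (r *\<^sub>R x) = r *\<^sub>R qc3 x"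
  by (simp_all add: scaleR_quat_def)

instance quat :: (real_normed_algebra_1) real_normed_algebra_1
proof
  fix x y :: "'a quat" and r :: real
  show "r *\<^sub>R x * y = r *\<^sub>R (x * y)" "x * r *\<^sub>R y = r *\<^sub>R (x * y)"
    by (simp_all add: quat_eq_iff algebra_simps)
  show "norm (1 :: 'a quat) = 1"
    by (simp add: norm_quat_def)
  have 1: "norm (a - b - c - d) \<le> norm a + norm b + norm c + norm d"
    "norm (a + b + c - d) \<le> norm a + norm b + norm c + norm d"
    "norm (a - b + c + d) \<le> norm a + norm b + norm c + norm d"
    "norm (a + b - c + d) \<le> norm a + norm b + norm c + norm d" for a b c d :: 'a
    by (intro order_trans[OF norm_triangle_ineq] order_trans[OF norm_triangle_ineq4]
        add_mono order_refl)+
  have 2: "norm (a * b) \<le> norm a * norm b" for a b :: 'a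
    by (rule norm_mult_ineq)
  have "norm (x * y) \<le>
      (norm (qc0 x) * norm (qc0 y) + norm (qc1 x) * norm (qc1 y)
        + norm (qc2 x) * norm (qc2 y) + norm (qc3 x) * norm (qc3 y))
    + (norm (qc0 x) * norm (qc1 y) + norm (qc1 x) * norm (qc0 y)
        + norm (qc2 x) * norm (qc3 y) + norm (qc3 x) * norm (qc2 y))
    + (norm (qc0 x) * norm (qc2 y) + norm (qc1 x) * norm (qc3 y)
        + norm (qc2 x) * norm (qc0 y) + norm (qc3 x) * norm (qc1 y))
    + (norm (qc0 x) * norm (qc3 y) + norm (qc1 x) * norm (qc2 y)
        + norm (qc2 x) * norm (qc1 y) + norm (qc3 x) * norm (qc0 y))"
    unfolding norm_quat_def quat_mult_sel
    by (intro add_mono order_trans[OF 1(1)] order_trans[OF 1(2)] order_trans[OF 1(3)]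
        order_trans[OF 1(4)] 2)
  then show "norm (x * y) \<le> norm x * norm y"
    by (simp add: norm_quat_def algebra_simps)
qed

type_synonym hac = "complex lorentz quat"

text \<open>Scalars are embedded by \<open>qscal\<close>; they are central.\<close>

definition qscal :: "'a::ring_1 \<Rightarrow> 'a quat" where "qscal a = Quat a 0 0 0"

definition qI :: hac where "qI = Quat 0 1 0 0"
definition qJ :: hac where "qJ = Quat 0 0 1 0"
definition qK :: hac where "qK = Quat 0 0 0 1"

lemma quaternion_relations:
  "qI * qI = -1" "qJ * qJ = -1" "qK * qK = -1" "qI * qJ = qK" "qJ * qI = - qK"
  by (simp_all add: quat_eq_iff qI_def qJ_def qK_def)

definition qconj :: "'a::ring_1 quat \<Rightarrow> 'a quat" where
  "qconj z = Quat (qc0 z) (- qc1 z) (- qc2 z) (- qc3 z)"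

definition qhat :: "hac \<Rightarrow> hac" where
  "qhat z = Quat (lhat (qc0 z)) (lhat (qc1 z)) (lhat (qc2 z)) (lhat (qc3 z))"

definition Hform :: "hac \<Rightarrow> hac \<Rightarrow> complex lorentz" where
  "Hform z w = qc0 z * qc0 w + qc1 z * qc1 w + qc2 z * qc2 w + qc3 z * qc3 w"

definition H0 :: "hac set" where
  "H0 = {Quat (lcomplex p0) (imag * lcomplex p1) (lcomplex p2) (imag * lcomplex p3) | p0 p1 p2 p3. True}"

definition H1 :: "hac set" where
  "H1 = {Quat (imag * lcomplex q0) (lcomplex q1) (imag * lcomplex q2) (lcomplex q3) | q0 q1 q2 q3. True}"

definition vec22 :: "real \<Rightarrow> real \<Rightarrow> real \<Rightarrow> real \<Rightarrow> hac" where
  "vec22 x0 x1 x2 x3 = Quat (sigma * imag * of_real x0) (of_real x1) (imag * of_real x2) (of_real x3)"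

definition R22 :: "hac set" where
  "R22 = {vec22 x0 x1 x2 x3 | x0 x1 x2 x3. True}"

definition qe0 :: hac where "qe0 = vec22 1 0 0 0"
definition qe1 :: hac where "qe1 = vec22 0 1 0 0"
definition qe2 :: hac where "qe2 = vec22 0 0 1 0"
definition qe3 :: hac where "qe3 = vec22 0 0 0 1"

definition S12 :: "hac set" where
  "S12 = {x \<in> R22. Hform x x = 1}"

definition R21 :: "hac set" where
  "R21 = {x \<in> R22. Hform x qe0 = 0}"

text \<open>Clifford multiplication and the \<open>\<H>\<^sub>1\<close>-valued pairing, in coordinates.\<close>

definition clif :: "hac \<Rightarrow> hac \<Rightarrow> hac" where
  "clif x z = qscal (sigma * imag) * x * qhat z"

definition pairing :: "hac \<Rightarrow> hac \<Rightarrow> hac" where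
  "pairing z w = qscal (sigma * imag) * qconj w * z"

lemma lorentz_of_real_sel [simp]: "lre (of_real r) = of_real r" "lsig (of_real r) = 0"
  by (simp_all add: of_real_def)

lemma R22_subset_H1: "R22 \<subseteq> H1"
proof -
  have "vec22 x0 x1 x2 x3 = Quat (imag * lcomplex (Lorentz 0 x0)) (lcomplex (Lorentz x1 0))
      (imag * lcomplex (Lorentz x2 0)) (lcomplex (Lorentz x3 0))" for x0 x1 x2 x3
    by (simp add: vec22_def lcomplex_def lorentz_eq_iff sigma_def imag_def)
  then show ?thesis unfolding R22_def H1_def by blast
qed

lemma Hform_vec22:
  "Hform (vec22 x0 x1 x2 x3) (vec22 y0 y1 y2 y3) = of_real (- x0 * y0 + x1 * y1 - x2 * y2 + x3 * y3)"
  by (simp add: Hform_def vec22_def lorentz_eq_iff sigma_def imag_def algebra_simps)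

lemma clif_clif:
  assumes "x \<in> R22"
  shows "clif x (clif x z) = - qscal (Hform x x) * z"
  using assms
  by (auto simp: R22_def clif_def vec22_def Hform_def quat_eq_iff qscal_def qhat_def
      lhat_def lorentz_eq_iff sigma_def imag_def algebra_simps)

lemma clif_e2_e3: "clif qe2 (clif qe3 z) = qscal imag * qI * z"
  by (auto simp: qe2_def qe3_def qI_def clif_def vec22_def quat_eq_iff qscal_def qhat_def
      lhat_def lorentz_eq_iff sigma_def imag_def algebra_simps)

text \<open>The component \<open>\<phi>\<^sup>+\<close> in the decomposition \<open>\<phi> = \<phi>\<^sup>+ + \<phi>\<^sup>-\<close> with \<open>\<sigma> \<phi>\<^sup>\<plusminus> = \<plusminus> \<phi>\<^sup>\<plusminus>\<close>;
  see \<open>plus_part_unique\<close>.\<close>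

definition plus_part :: "hac \<Rightarrow> hac" where
  "plus_part z = (1 / 2) *\<^sub>R (z + qscal sigma * z)"

lemma plus_part_unique:
  "(qscal sigma * a = a \<and> qscal sigma * (z - a) = - (z - a)) \<longleftrightarrow> a = plus_part z"
proof
  assume *: "qscal sigma * a = a \<and> qscal sigma * (z - a) = - (z - a)"
  then have "qscal sigma * z = a - (z - a)"
    by (metis add.commute diff_add_cancel diff_conv_add_uminus distrib_left)
  then have "z + qscal sigma * z = 2 *\<^sub>R a"
    by (simp add: scaleR_2)
  then show "a = plus_part z" by (simp add: plus_part_def)
next
  have ss: "qscal sigma * (qscal sigma * z) = z"
    by (simp add: quat_eq_iff lorentz_eq_iff qscal_def sigma_def)
  have 1: "qscal sigma * plus_part z = plus_part z"
    by (simp add: plus_part_def distrib_left ss add.commute)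
  have "z = (1 / 2) *\<^sub>R z + (1 / 2) *\<^sub>R z"
    by (simp flip: scaleR_left_distrib)
  then have 2: "z - plus_part z = (1 / 2) *\<^sub>R (z - qscal sigma * z)"
    unfolding plus_part_def by (simp add: algebra_simps)
  have "qscal sigma * (z - plus_part z) = - (z - plus_part z)"
    unfolding 2 by (simp add: right_diff_distrib ss flip: scaleR_minus_right)
  with 1 show "a = plus_part z \<Longrightarrow> qscal sigma * a = a \<and> qscal sigma * (z - a) = - (z - a)"
    by simp
qed


section \<open>Smooth surfaces\<close>

text \<open>\<open>C\<^sup>k\<close> and \<open>C\<^sup>\<infinity>\<close> maps on an open subset of a finite-dimensional space.\<close>

primrec Ck_on :: "nat \<Rightarrow> 'a::real_normed_vector set \<Rightarrow> ('a \<Rightarrow> 'b::real_normed_vector) \<Rightarrow> bool" where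
  "Ck_on 0 S f \<longleftrightarrow> continuous_on S f"
| "Ck_on (Suc k) S f \<longleftrightarrow> (\<forall>x\<in>S. f differentiable (at x)) \<and>
     (\<forall>v. Ck_on k S (\<lambda>x. frechet_derivative f (at x) v))"

definition smooth_on :: "'a::real_normed_vector set \<Rightarrow> ('a \<Rightarrow> 'b::real_normed_vector) \<Rightarrow> bool" where
  "smooth_on S f \<longleftrightarrow> (\<forall>k. Ck_on k S f)"

text \<open>A chart is a domain together with a coordinate map. Tensor fields are given by their
  coordinate expressions in all charts of the atlas, subject to the usual transformation laws.\<close>

type_synonym 'm chart = "'m set \<times> ('m \<Rightarrow> real^2)"

definition chart_inv :: "'m chart \<Rightarrow> real^2 \<Rightarrow> 'm" where
  "chart_inv c = inv_into (fst c) (snd c)"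

definition smooth_atlas :: "'m::topological_space chart set \<Rightarrow> bool" where
  "smooth_atlas A \<longleftrightarrow>
     (\<Union>c\<in>A. fst c) = UNIV \<and>
     (\<forall>c\<in>A. open (fst c) \<and> open (snd c ` fst c) \<and>
        homeomorphism (fst c) (snd c ` fst c) (snd c) (chart_inv c)) \<and>
     (\<forall>c\<in>A. \<forall>d\<in>A. smooth_on (snd c ` (fst c \<inter> fst d)) (snd d \<circ> chart_inv c))"

definition smooth_fun :: "'m chart set \<Rightarrow> 'm set \<Rightarrow> ('m \<Rightarrow> 'b::real_normed_vector) \<Rightarrow> bool" where
  "smooth_fun A W f \<longleftrightarrow> (\<forall>c\<in>A. smooth_on (snd c ` (fst c \<inter> W)) (f \<circ> chart_inv c))"

text \<open>\<open>cdiff c f p v\<close> is the derivative of \<open>f\<close> at \<open>p\<close> along the tangent vector whose coordinates in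
  the chart \<open>c\<close> are \<open>v\<close>.\<close>

definition cdiff :: "'m chart \<Rightarrow> ('m \<Rightarrow> 'b::real_normed_vector) \<Rightarrow> 'm \<Rightarrow> real^2 \<Rightarrow> 'b" where
  "cdiff c f p v = frechet_derivative (f \<circ> chart_inv c) (at (snd c p)) v"

definition vector_field :: "'m chart set \<Rightarrow> 'm set \<Rightarrow> ('m chart \<Rightarrow> 'm \<Rightarrow> real^2) \<Rightarrow> bool" where
  "vector_field A W X \<longleftrightarrow>
     (\<forall>c\<in>A. smooth_on (snd c ` (fst c \<inter> W)) (X c \<circ> chart_inv c)) \<and>
     (\<forall>c\<in>A. \<forall>d\<in>A. \<forall>p\<in>fst c \<inter> fst d \<inter> W. X d p = cdiff c (snd d) p (X c p))"

definition lorentzian_metric ::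
  "'m chart set \<Rightarrow> ('m chart \<Rightarrow> 'm \<Rightarrow> real^2 \<Rightarrow> real^2 \<Rightarrow> real) \<Rightarrow> bool" where
  "lorentzian_metric A g \<longleftrightarrow>
     (\<forall>c\<in>A. \<forall>p\<in>fst c. bilinear (g c p) \<and> (\<forall>v w. g c p v w = g c p w v) \<and>
        (\<exists>v w. g c p v v = -1 \<and> g c p w w = 1 \<and> g c p v w = 0)) \<and>
     (\<forall>c\<in>A. \<forall>v w. smooth_on (snd c ` fst c) ((\<lambda>p. g c p v w) \<circ> chart_inv c)) \<and>
     (\<forall>c\<in>A. \<forall>d\<in>A. \<forall>p\<in>fst c \<inter> fst d. \<forall>v w.
        g c p v w = g d p (cdiff c (snd d) p v) (cdiff c (snd d) p w))"


section \<open>Lorentzian surfaces with spin structures\<close>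

text \<open>The spin structure \<open>Q\<^sub>E \<times>\<^sub>M Q\<^sub>M\<close> is presented by a cocycle: a family, indexed by \<open>'i\<close>, of local
  spinorial frames on open sets \<open>fdom M i\<close> covering the surface, lying above the adapted frames
  \<open>(e\<^sub>0, e\<^sub>1, frame2 M i, frame3 M i)\<close>, where \<open>e\<^sub>0, e\<^sub>1\<close> are the given parallel sections of \<open>E\<close>.
  \<open>transition M j i\<close> is the change of spinorial frame: spinors satisfy \<open>[\<phi>]\<^sub>j = transition M j i [\<phi>]\<^sub>i\<close>.

  The bundle \<open>E\<close> is trivialised by \<open>e\<^sub>0, e\<^sub>1\<close>, whose coordinates are \<open>qe0\<close> and \<open>qe1\<close> in all these
  frames.\<close>

record ('m, 'i) spin_surface =
  atlas :: "'m chart set"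
  metric :: "'m chart \<Rightarrow> 'm \<Rightarrow> real^2 \<Rightarrow> real^2 \<Rightarrow> real"
  fdom :: "'i \<Rightarrow> 'm set"
  frame2 :: "'i \<Rightarrow> 'm chart \<Rightarrow> 'm \<Rightarrow> real^2"
  frame3 :: "'i \<Rightarrow> 'm chart \<Rightarrow> 'm \<Rightarrow> real^2"
  transition :: "'i \<Rightarrow> 'i \<Rightarrow> 'm \<Rightarrow> hac"

text \<open>The coordinates \<open>[X]\<close> in the frame \<open>i\<close> of the tangent vector at \<open>p\<close> with coordinates \<open>v\<close> in
  the chart \<open>c\<close>.\<close>

definition tcoord :: "('m, 'i) spin_surface \<Rightarrow> 'i \<Rightarrow> 'm chart \<Rightarrow> 'm \<Rightarrow> real^2 \<Rightarrow> hac" where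
  "tcoord M i c p v =
     - metric M c p v (frame2 M i c p) *\<^sub>R qe2 + metric M c p v (frame3 M i c p) *\<^sub>R qe3"

text \<open>The structure group \<open>{\<plusminus>(cosh a + i sinh a I) | a \<in> \<A>}\<close> acts on vectors by
  \<open>x \<mapsto> s x (qhat s)\<^sup>-\<^sup>1\<close>, with \<open>s\<^sup>-\<^sup>1 = qconj s\<close>. The elements above the transformations fixing \<open>e\<^sub>0\<close> and
  \<open>e\<^sub>1\<close> are those with \<open>a\<close> real.\<close>

definition spin_group :: "hac set" where
  "spin_group = (let G = {Quat (of_real (cosh a)) (imag * of_real (sinh a)) 0 0 | a :: real. True}
     in G \<union> uminus ` G)"

text \<open>That the tangent frames change by the identity component of \<open>SO(1,1)\<close>, the image of
  \<open>spin_group\<close>, is the orientation in space and time.\<close>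

definition lorentzian_spin_surface :: "('m::topological_space, 'i) spin_surface \<Rightarrow> bool" where
  "lorentzian_spin_surface M \<longleftrightarrow>
     smooth_atlas (atlas M) \<and>
     lorentzian_metric (atlas M) (metric M) \<and>
     (\<Union>i. fdom M i) = UNIV \<and>
     (\<forall>i. open (fdom M i) \<and>
        vector_field (atlas M) (fdom M i) (frame2 M i) \<and>
        vector_field (atlas M) (fdom M i) (frame3 M i) \<and>
        (\<forall>c\<in>atlas M. \<forall>p\<in>fst c \<inter> fdom M i.
           metric M c p (frame2 M i c p) (frame2 M i c p) = -1 \<and>
           metric M c p (frame3 M i c p) (frame3 M i c p) = 1 \<and>
           metric M c p (frame2 M i c p) (frame3 M i c p) = 0)) \<and>
     (\<forall>i j. smooth_fun (atlas M) (fdom M i \<inter> fdom M j) (transition M j i) \<and>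
        (\<forall>p\<in>fdom M i \<inter> fdom M j. transition M j i p \<in> spin_group) \<and>
        (\<forall>c\<in>atlas M. \<forall>p\<in>fst c \<inter> fdom M i \<inter> fdom M j. \<forall>v.
           tcoord M j c p v = transition M j i p * tcoord M i c p v * qconj (qhat (transition M j i p)))) \<and>
     (\<forall>i j k. \<forall>p\<in>fdom M i \<inter> fdom M j \<inter> fdom M k. transition M k i p = transition M k j p * transition M j i p)"

text \<open>A section of \<open>\<Sigma> = \<Sigma>E \<otimes> \<Sigma>M\<close>: \<open>\<phi> i p\<close> are the coordinates \<open>[\<phi>] \<in> \<H>\<^sub>0\<close> at \<open>p\<close> in the
  spinorial frame \<open>i\<close>.\<close>

type_synonym ('m, 'i) spinor = "'i \<Rightarrow> 'm \<Rightarrow> hac"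

definition spinor_field :: "('m, 'i) spin_surface \<Rightarrow> ('m, 'i) spinor \<Rightarrow> bool" where
  "spinor_field M \<phi> \<longleftrightarrow>
     (\<forall>i. smooth_fun (atlas M) (fdom M i) (\<phi> i) \<and> (\<forall>p\<in>fdom M i. \<phi> i p \<in> H0)) \<and>
     (\<forall>i j. \<forall>p\<in>fdom M i \<inter> fdom M j. \<phi> j p = transition M j i p * \<phi> i p)"

text \<open>Levi-Civita connection in a chart. The Christoffel symbols are given by the first kind formula
  \<open>2 \<langle>\<Gamma>(v,w),u\<rangle> = (\<partial>\<^sub>v g)(w,u) + (\<partial>\<^sub>w g)(v,u) - (\<partial>\<^sub>u g)(v,w)\<close> for constant coordinate vectors.\<close>

definition christoffel ::
  "('m, 'i) spin_surface \<Rightarrow> 'm chart \<Rightarrow> 'm \<Rightarrow> real^2 \<Rightarrow> real^2 \<Rightarrow> real^2" where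
  "christoffel M c p v w = (THE z. \<forall>u. 2 * metric M c p z u =
     cdiff c (\<lambda>q. metric M c q w u) p v + cdiff c (\<lambda>q. metric M c q v u) p w
       - cdiff c (\<lambda>q. metric M c q v w) p u)"

definition levi_civita ::
  "('m, 'i) spin_surface \<Rightarrow> 'm chart \<Rightarrow> ('m chart \<Rightarrow> 'm \<Rightarrow> real^2) \<Rightarrow> 'm \<Rightarrow> real^2 \<Rightarrow> real^2" where
  "levi_civita M c Y p v = cdiff c (Y c) p v + christoffel M c p v (Y c p)"

text \<open>The spin connection
  \<open>[\<nabla>\<^sub>X \<phi>] = X[\<phi>] + 1/2 \<Sum>\<^sub>j\<^sub><\<^sub>k \<epsilon>\<^sub>j \<epsilon>\<^sub>k \<langle>\<nabla>\<^sub>X e\<^sub>j, e\<^sub>k\<rangle> [e\<^sub>j \<cdot> e\<^sub>k \<cdot> \<phi>]\<close>, \<open>\<epsilon>\<^sub>j = \<langle>e\<^sub>j, e\<^sub>j\<rangle>\<close>. As \<open>e\<^sub>0, e\<^sub>1\<close> are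
  parallel only the term \<open>j = 2\<close>, \<open>k = 3\<close> remains, and \<open>\<epsilon>\<^sub>2 \<epsilon>\<^sub>3 = -1\<close>.\<close>

definition spin_deriv ::
  "('m, 'i) spin_surface \<Rightarrow> 'm chart \<Rightarrow> ('m, 'i) spinor \<Rightarrow> 'i \<Rightarrow> 'm \<Rightarrow> real^2 \<Rightarrow> hac" where
  "spin_deriv M c \<phi> i p v = cdiff c (\<phi> i) p v
     - (1 / 2 * metric M c p (levi_civita M c (frame2 M i) p v) (frame3 M i c p))
       *\<^sub>R clif qe2 (clif qe3 (\<phi> i p))"

definition dirac ::
  "('m, 'i) spin_surface \<Rightarrow> 'm chart \<Rightarrow> ('m, 'i) spinor \<Rightarrow> 'i \<Rightarrow> 'm \<Rightarrow> hac" where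
  "dirac M c \<phi> i p =
     - clif qe2 (spin_deriv M c \<phi> i p (frame2 M i c p))
     + clif qe3 (spin_deriv M c \<phi> i p (frame3 M i c p))"

definition spinor_eq :: "('m, 'i) spin_surface \<Rightarrow> ('m, 'i) spinor \<Rightarrow> ('m, 'i) spinor \<Rightarrow> bool" where
  "spinor_eq M \<phi> \<psi> \<longleftrightarrow> (\<forall>i. \<forall>p\<in>fdom M i. \<phi> i p = \<psi> i p)"

definition dirac_eq :: "('m, 'i) spin_surface \<Rightarrow> ('m, 'i) spinor \<Rightarrow> ('m, 'i) spinor \<Rightarrow> bool" where
  "dirac_eq M \<phi> \<psi> \<longleftrightarrow> (\<forall>c\<in>atlas M. \<forall>i. \<forall>p\<in>fst c \<inter> fdom M i. dirac M c \<phi> i p = \<psi> i p)"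

text \<open>\<open>H(\<phi>, \<phi>) = 1\<close>.\<close>

definition unit_spinor :: "('m, 'i) spin_surface \<Rightarrow> ('m, 'i) spinor \<Rightarrow> bool" where
  "unit_spinor M \<phi> \<longleftrightarrow> (\<forall>i. \<forall>p\<in>fdom M i. Hform (\<phi> i p) (\<phi> i p) = 1)"


section \<open>Immersions\<close>

definition isometric_immersion :: "('m, 'i) spin_surface \<Rightarrow> ('m \<Rightarrow> hac) \<Rightarrow> bool" where
  "isometric_immersion M F \<longleftrightarrow>
     smooth_fun (atlas M) UNIV F \<and> (\<forall>p. F p \<in> R22) \<and>
     (\<forall>c\<in>atlas M. \<forall>p\<in>fst c. inj (cdiff c F p) \<and>
        (\<forall>v w. Hform (cdiff c F p v) (cdiff c F p w) = of_real (metric M c p v w)))"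

text \<open>\<open>F\<close> is a primitive of \<open>\<xi>(X) = \<langle>\<langle>X \<cdot> \<phi>, \<phi>\<rangle>\<rangle>\<close>.\<close>

definition induced_by :: "('m, 'i) spin_surface \<Rightarrow> ('m, 'i) spinor \<Rightarrow> ('m \<Rightarrow> hac) \<Rightarrow> bool" where
  "induced_by M \<phi> F \<longleftrightarrow>
     smooth_fun (atlas M) UNIV F \<and> (\<forall>p. F p \<in> R22) \<and>
     (\<forall>c\<in>atlas M. \<forall>i. \<forall>p\<in>fst c \<inter> fdom M i. \<forall>v.
        cdiff c F p v = pairing (clif (tcoord M i c p v) (\<phi> i p)) (\<phi> i p))"

definition normal_part :: "'m chart \<Rightarrow> ('m \<Rightarrow> hac) \<Rightarrow> 'm \<Rightarrow> hac \<Rightarrow> hac" where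
  "normal_part c F p z =
     (THE n. (\<forall>v. Hform n (cdiff c F p v) = 0) \<and> (\<exists>v. z = n + cdiff c F p v))"

definition second_form :: "'m chart \<Rightarrow> ('m \<Rightarrow> hac) \<Rightarrow> 'm \<Rightarrow> real^2 \<Rightarrow> real^2 \<Rightarrow> hac" where
  "second_form c F p v w = normal_part c F p (cdiff c (\<lambda>q. cdiff c F q w) p v)"

text \<open>\<open>1/2 tr\<^sub>g B\<close>, computed in the chart \<open>c\<close> and the orthonormal frame \<open>i\<close>.\<close>

definition mean_curvature_vector ::
  "('m, 'i) spin_surface \<Rightarrow> 'm chart \<Rightarrow> 'i \<Rightarrow> ('m \<Rightarrow> hac) \<Rightarrow> 'm \<Rightarrow> hac" where
  "mean_curvature_vector M c i F p = (1 / 2) *\<^sub>R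
     (- second_form c F p (frame2 M i c p) (frame2 M i c p)
      + second_form c F p (frame3 M i c p) (frame3 M i c p))"

text \<open>The mean curvature vector in \<open>S\<^sup>1\<^sup>,\<^sup>2\<close> is the component tangent to \<open>S\<^sup>1\<^sup>,\<^sup>2\<close>, that is orthogonal to
  the unit normal \<open>F\<close> of \<open>S\<^sup>1\<^sup>,\<^sup>2\<close>, of the mean curvature vector in \<open>R\<^sup>2\<^sup>,\<^sup>2\<close>.\<close>

definition minimal_immersion_S12 :: "('m, 'i) spin_surface \<Rightarrow> ('m \<Rightarrow> hac) \<Rightarrow> bool" where
  "minimal_immersion_S12 M F \<longleftrightarrow>
     isometric_immersion M F \<and> (\<forall>p. F p \<in> S12) \<and>
     (\<forall>c\<in>atlas M. \<forall>i. \<forall>p\<in>fst c \<inter> fdom M i.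
        mean_curvature_vector M c i F p
          - qscal (Hform (mean_curvature_vector M c i F p) (F p)) * F p = 0)"

definition represented_in_S12 :: "('m, 'i) spin_surface \<Rightarrow> ('m, 'i) spinor \<Rightarrow> ('m \<Rightarrow> hac) \<Rightarrow> bool" where
  "represented_in_S12 M \<phi> F \<longleftrightarrow> induced_by M \<phi> F \<and>
     (\<forall>i. \<forall>p\<in>fdom M i. F p = pairing (clif (- qe1) (\<phi> i p)) (\<phi> i p))"

definition unit_normal_R21 :: "('m, 'i) spin_surface \<Rightarrow> ('m \<Rightarrow> hac) \<Rightarrow> ('m \<Rightarrow> hac) \<Rightarrow> bool" where
  "unit_normal_R21 M F N \<longleftrightarrow>
     smooth_fun (atlas M) UNIV N \<and>
     (\<forall>p. N p \<in> R21 \<and> Hform (N p) (N p) = 1) \<and>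
     (\<forall>c\<in>atlas M. \<forall>p\<in>fst c. \<forall>v. Hform (N p) (cdiff c F p v) = 0)"

text \<open>An isometric immersion into \<open>R\<^sup>2\<^sup>,\<^sup>1\<close> with constant mean curvature \<open>h\<close> with respect to the unit
  spacelike normal \<open>N\<close>.\<close>

definition cmc_immersion_R21 ::
  "('m, 'i) spin_surface \<Rightarrow> ('m \<Rightarrow> hac) \<Rightarrow> ('m \<Rightarrow> hac) \<Rightarrow> real \<Rightarrow> bool" where
  "cmc_immersion_R21 M F N h \<longleftrightarrow>
     isometric_immersion M F \<and> (\<forall>p. F p \<in> R21) \<and> unit_normal_R21 M F N \<and>
     (\<forall>c\<in>atlas M. \<forall>i. \<forall>p\<in>fst c \<inter> fdom M i. mean_curvature_vector M c i F p = h *\<^sub>R N p)"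

end

theory Submission
  imports Defs
begin

text \<open>The map \<open>\<phi> \<mapsto> \<phi>\<^sup>+ + e\<^sub>0 \<cdot> \<phi>\<^sup>+\<close> commutes with the spin connection and, as \<open>e\<^sub>0\<close> anticommutes with
  \<open>e\<^sub>1, e\<^sub>2, e\<^sub>3\<close>, preserves the Dirac equation. In coordinates its values \<open>z\<close> satisfy \<open>qhat z = - z\<close>,
  which is \<open>e\<^sub>0 \<cdot> z = z\<close>, so that
  \<open>\<xi>(X) = qconj z [X] z\<close> is the rotation of \<open>[X]\<close> by a unit split quaternion and has no \<open>e\<^sub>0\<close> component.
  The covariant derivative of \<open>\<xi>\<close> involves only \<open>\<nabla>z\<close>; multiplying the Dirac equation by \<open>e\<^sub>1\<close> shows that it
  is symmetric, i.e. \<open>d\<xi> = 0\<close>, and the Dirac equation itself says that its trace is \<open>2 qconj z e\<^sub>1 z\<close>,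
  i.e. that the mean curvature is \<open>1\<close>. A closed form on a simply connected surface is integrated
  by continuing local primitives along paths and homotopies.\<close>

section \<open>\<open>C\<^sup>k\<close> maps\<close>

text \<open>A number \<open>u + \<sigma> v\<close> is determined by its values \<open>u + v\<close>
  at \<sigma> = 1 and \<open>u - v\<close> at \<sigma> = -1, and \<open>\<phi>\<^sup>+\<close>
  retains the first value alone. Because of the hat, Clifford multiplication by
  \<open>e\<^sub>1\<close>, \<open>e\<^sub>2\<close>, \<open>e\<^sub>3\<close> exchanges the two
  values, so the Dirac equation splits into two independent halves, and only the half that involves
  \<open>\<phi>\<^sup>+\<close> has to be inherited. The equation
  \<open>H(\<phi>, \<phi>) = 1\<close> likewise holds for each value separately. Adding
  \<open>e\<^sub>0 \<cdot> \<phi>\<^sup>+\<close>, which is minus the hat of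
  \<open>\<phi>\<^sup>+\<close>, fills the value at \<sigma> = -1 with the negative of the value at
  \<sigma> = 1; the result is \<sigma> times a quaternion free of \<sigma>. On the analytic side the
  surface is a topological space with an atlas, and its paths and homotopies are merely continuous.
  A form cannot be integrated along them by a line integral; increments of local primitives take its
  place.\<close>

lemma differentiable_transform_open:
  assumes "f differentiable (at x)" "open S" "x \<in> S" "\<And>y. y \<in> S \<Longrightarrow> f y = g y"
  shows "g differentiable (at x)"
  using assms has_derivative_transform_within_open unfolding differentiable_def by blast

lemma Ck_on_cong:
  assumes "open S" "\<And>x. x \<in> S \<Longrightarrow> f x = g x" "Ck_on k S f"
  shows "Ck_on k S g"
  using assms(2,3)
proof (induction k arbitrary: f g)
  case 0
  then show ?case by (simp cong: continuous_on_cong)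
next
  case (Suc k)
  have "frechet_derivative f (at x) v = frechet_derivative g (at x) v" if "x \<in> S" for x v
    using frechet_derivative_transform_within_open[of f x S g] Suc.prems assms(1) that by simp
  then have "Ck_on k S (\<lambda>x. frechet_derivative g (at x) v)" for v
    using Suc.IH[of "\<lambda>x. frechet_derivative f (at x) v"] Suc.prems(2) by simp
  moreover have "g differentiable (at x)" if "x \<in> S" for x
    using differentiable_transform_open[of f x S g] Suc.prems assms(1) that by simp
  ultimately show ?case by simp
qed

lemma Ck_on_subset: "Ck_on k S f \<Longrightarrow> T \<subseteq> S \<Longrightarrow> Ck_on k T f"
  by (induction k arbitrary: f) (auto intro: continuous_on_subset)

text \<open>Spinors are smooth frame by frame; this assembles the frame domains into a whole chart
  domain.\<close>

lemma Ck_on_local: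
  assumes "\<And>x. x \<in> S \<Longrightarrow> \<exists>T. open T \<and> x \<in> T \<and> Ck_on k T f"
  shows "Ck_on k S f"
  using assms
proof (induction k arbitrary: f)
  case 0
  have "continuous (at x) f" if "x \<in> S" for x
    using 0[OF that] continuous_on_eq_continuous_at by auto
  then show ?case by (simp add: continuous_at_imp_continuous_on)
next
  case (Suc k)
  have "f differentiable (at x)" if "x \<in> S" for x
    using Suc.prems[OF that] by auto
  moreover have "Ck_on k S (\<lambda>x. frechet_derivative f (at x) v)" for v
  proof (rule Suc.IH)
    fix x assume "x \<in> S"
    from Suc.prems[OF this] show "\<exists>T. open T \<and> x \<in> T \<and> Ck_on k T (\<lambda>x. frechet_derivative f (at x) v)"
      by auto
  qed
  ultimately show ?case by simp
qed

lemma Ck_on_Suc_imp: "Ck_on (Suc k) S f \<Longrightarrow> Ck_on k S f"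
proof (induction k arbitrary: f)
  case 0
  then show ?case
    by (simp add: continuous_at_imp_continuous_on differentiable_imp_continuous_within)
next
  case (Suc k)
  have "Ck_on k S (\<lambda>x. frechet_derivative f (at x) v)" for v
    by (rule Suc.IH) (use Suc.prems in simp)
  then show ?case using Suc.prems by simp
qed

lemma Ck_on_const: "Ck_on k S (\<lambda>x. c)"
  by (induction k arbitrary: c) simp_all

lemma Ck_on_bounded_linear:
  assumes "bounded_linear L" "open S" "Ck_on k S f"
  shows "Ck_on k S (\<lambda>x. L (f x))"
  using assms(3)
proof (induction k arbitrary: f)
  case 0
  then show ?case unfolding Ck_on.simps by (rule bounded_linear.continuous_on[OF assms(1)])
next
  case (Suc k)
  have D: "((\<lambda>x. L (f x)) has_derivative (\<lambda>v. L (frechet_derivative f (at x) v))) (at x)"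
    if "x \<in> S" for x
    using Suc.prems that
    by (intro bounded_linear.has_derivative[OF assms(1)]) (auto simp: frechet_derivative_works)
  have "Ck_on k S (\<lambda>x. frechet_derivative (\<lambda>x. L (f x)) (at x) v)" for v
    by (rule Ck_on_cong[OF assms(2) _ Suc.IH[of "\<lambda>x. frechet_derivative f (at x) v"]])
      (use Suc.prems in \<open>auto simp: frechet_derivative_at[OF D, symmetric]\<close>)
  then show ?case using D by (auto simp: differentiable_def)
qed

lemma Ck_on_add:
  assumes "open S" "Ck_on k S f" "Ck_on k S g"
  shows "Ck_on k S (\<lambda>x. f x + g x)"
  using assms(2,3)
proof (induction k arbitrary: f g)
  case 0
  then show ?case by (simp add: continuous_on_add)
next
  case (Suc k)
  have D: "((\<lambda>x. f x + g x) has_derivative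
      (\<lambda>v. frechet_derivative f (at x) v + frechet_derivative g (at x) v)) (at x)"
    if "x \<in> S" for x
    using Suc.prems that by (intro has_derivative_add) (auto simp: frechet_derivative_works)
  have "Ck_on k S (\<lambda>x. frechet_derivative (\<lambda>x. f x + g x) (at x) v)" for v
    by (rule Ck_on_cong[OF assms(1) _ Suc.IH[of "\<lambda>x. frechet_derivative f (at x) v"
            "\<lambda>x. frechet_derivative g (at x) v"]])
      (use Suc.prems in \<open>auto simp: frechet_derivative_at[OF D, symmetric]\<close>)
  then show ?case using D by (auto simp: differentiable_def)
qed

lemma Ck_on_bilinear:
  assumes "bounded_bilinear B" "open S" "Ck_on k S f" "Ck_on k S g"
  shows "Ck_on k S (\<lambda>x. B (f x) (g x))"
  using assms(3,4)
proof (induction k arbitrary: f g)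
  case 0
  then show ?case unfolding Ck_on.simps by (rule bounded_bilinear.continuous_on[OF assms(1)])
next
  case (Suc k)
  have D: "((\<lambda>x. B (f x) (g x)) has_derivative
      (\<lambda>v. B (f x) (frechet_derivative g (at x) v) + B (frechet_derivative f (at x) v) (g x))) (at x)"
    if "x \<in> S" for x
    using Suc.prems that by (intro bounded_bilinear.FDERIV[OF assms(1)]) (auto simp: frechet_derivative_works)
  \<comment> \<open>The product rule also contains \<open>f\<close> and \<open>g\<close>
    undifferentiated, hence the drop from \<open>Suc k\<close> to \<open>k\<close> for them.\<close>
  have "Ck_on k S (\<lambda>x. B (f x) (frechet_derivative g (at x) v) + B (frechet_derivative f (at x) v) (g x))" for v
    using Suc.prems Ck_on_Suc_imp[OF Suc.prems(1)] Ck_on_Suc_imp[OF Suc.prems(2)]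
    by (intro Ck_on_add assms(2) Suc.IH) auto
  then have "Ck_on k S (\<lambda>x. frechet_derivative (\<lambda>x. B (f x) (g x)) (at x) v)" for v
    by (rule Ck_on_cong[OF assms(2), rotated]) (auto simp: frechet_derivative_at[OF D, symmetric])
  then show ?case using D by (auto simp: differentiable_def)
qed

lemma smooth_on_cong: "open S \<Longrightarrow> (\<And>x. x \<in> S \<Longrightarrow> f x = g x) \<Longrightarrow> smooth_on S f \<Longrightarrow> smooth_on S g"
  unfolding smooth_on_def using Ck_on_cong by blast

lemma smooth_on_subset: "smooth_on S f \<Longrightarrow> T \<subseteq> S \<Longrightarrow> smooth_on T f"
  unfolding smooth_on_def using Ck_on_subset by blast

lemma smooth_on_local:
  "(\<And>x. x \<in> S \<Longrightarrow> \<exists>T. open T \<and> x \<in> T \<and> smooth_on T f) \<Longrightarrow> smooth_on S f"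
  unfolding smooth_on_def by (intro allI Ck_on_local) blast

lemma smooth_on_empty: "smooth_on {} f"
  by (rule smooth_on_local) simp

lemma smooth_on_const: "smooth_on S (\<lambda>x. c)"
  unfolding smooth_on_def using Ck_on_const by blast

lemma smooth_on_bounded_linear:
  "bounded_linear L \<Longrightarrow> open S \<Longrightarrow> smooth_on S f \<Longrightarrow> smooth_on S (\<lambda>x. L (f x))"
  unfolding smooth_on_def using Ck_on_bounded_linear by blast

lemma smooth_on_add:
  "open S \<Longrightarrow> smooth_on S f \<Longrightarrow> smooth_on S g \<Longrightarrow> smooth_on S (\<lambda>x. f x + g x)"
  unfolding smooth_on_def using Ck_on_add by blast

lemma smooth_on_bilinear:
  "bounded_bilinear B \<Longrightarrow> open S \<Longrightarrow> smooth_on S f \<Longrightarrow> smooth_on S g \<Longrightarrow> smooth_on S (\<lambda>x. B (f x) (g x))"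
  unfolding smooth_on_def using Ck_on_bilinear by blast

lemma smooth_on_sum:
  "open S \<Longrightarrow> (\<And>i. i \<in> I \<Longrightarrow> smooth_on S (f i)) \<Longrightarrow> smooth_on S (\<lambda>x. \<Sum>i\<in>I. f i x)"
  by (induction I rule: infinite_finite_induct) (auto intro: smooth_on_const smooth_on_add)

lemma smooth_on_has_derivative:
  "smooth_on S f \<Longrightarrow> x \<in> S \<Longrightarrow> (f has_derivative frechet_derivative f (at x)) (at x)"
  unfolding smooth_on_def frechet_derivative_works[symmetric] by (drule spec[of _ "Suc 0"]) simp

lemma smooth_on_frechet_derivative:
  "smooth_on S f \<Longrightarrow> smooth_on S (\<lambda>x. frechet_derivative f (at x) v)"
  unfolding smooth_on_def
proof
  fix k assume "\<forall>k. Ck_on k S f"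
  then have "Ck_on (Suc k) S f" ..
  then show "Ck_on k S (\<lambda>x. frechet_derivative f (at x) v)" by simp
qed

lemma smooth_on_continuous_on: "smooth_on S f \<Longrightarrow> continuous_on S f"
  unfolding smooth_on_def by (drule spec[of _ 0]) simp

text \<open>Integration gains one order, so a map built as a primitive inherits smoothness from its
  differential.\<close>

lemma smooth_on_primitive:
  assumes "open S" "\<And>x. x \<in> S \<Longrightarrow> (f has_derivative f' x) (at x)" "\<And>v. smooth_on S (\<lambda>x. f' x v)"
  shows "smooth_on S f"
proof -
  have "smooth_on S (\<lambda>x. frechet_derivative f (at x) v)" for v
    by (rule smooth_on_cong[OF assms(1) _ assms(3)[of v]])
      (simp add: frechet_derivative_at[OF assms(2), symmetric])
  then have "Ck_on (Suc k) S f" for k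
    using assms(2) by (auto simp: smooth_on_def differentiable_def)
  then show ?thesis
    unfolding smooth_on_def using Ck_on_Suc_imp by blast
qed

section \<open>The Poincare lemma on convex sets\<close>

text \<open>The primitive at \<open>x\<close> integrates the form along the segment from a base
  point \<open>x0\<close> to \<open>x\<close>. The form has coefficients \<open>A b\<close>, and
  \<open>A' b c\<close> is the derivative of \<open>A b\<close> in direction \<open>c\<close>. By
  closedness the \<open>x\<close>-derivative of the integrand is a total derivative in
  \<open>t\<close>, so its integral collapses to the form at \<open>x\<close>.\<close>

lemma poincare_convex:
  fixes A :: "'a::euclidean_space \<Rightarrow> 'a \<Rightarrow> real"
  assumes "open U" "convex U"
    and der: "\<And>b y. b \<in> Basis \<Longrightarrow> y \<in> U \<Longrightarrow>
      (A b has_derivative (\<lambda>v. \<Sum>c\<in>Basis. A' b c y * (v \<bullet> c))) (at y)"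
    and cont: "\<And>b c. b \<in> Basis \<Longrightarrow> c \<in> Basis \<Longrightarrow> continuous_on U (A' b c)"
    and closed: "\<And>b c y. b \<in> Basis \<Longrightarrow> c \<in> Basis \<Longrightarrow> y \<in> U \<Longrightarrow> A' b c y = A' c b y"
  shows "\<exists>f. \<forall>y\<in>U. (f has_derivative (\<lambda>v. \<Sum>b\<in>Basis. A b y * (v \<bullet> b))) (at y)"
proof (cases "U = {}")
  case False
  then obtain x0 where x0: "x0 \<in> U" by blast
  define s where "s = (\<lambda>(x, t). x0 + t *\<^sub>R (x - x0))"
  have s: "s (x, t) \<in> U" if "x \<in> U" "t \<in> {0..1}" for x t
    using convexD_alt[OF assms(2) x0, of x t] that by (simp add: s_def algebra_simps)
  have sim: "s ` (U \<times> {0..1}) \<subseteq> U" using s by auto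
  have conts: "continuous_on T s" for T
    unfolding s_def split_beta by (intro continuous_intros)
  have contA: "continuous_on U (A b)" if "b \<in> Basis" for b
    using der[OF that] by (metis continuous_at_imp_continuous_on has_derivative_continuous)
  \<comment> \<open>\<open>a b (x, t)\<close> is the \<open>t\<close>-derivative of
    \<open>t * A b (s (x, t))\<close>; its integral over \<open>{0..1}\<close> is therefore
    \<open>A b x\<close>.\<close>
  define a where "a = (\<lambda>b (x, t). A b (s (x, t)) + t * (\<Sum>c\<in>Basis. A' b c (s (x, t)) * ((x - x0) \<bullet> c)))"
  define f where "f = (\<lambda>x t. \<Sum>b\<in>Basis. A b (s (x, t)) * ((x - x0) \<bullet> b))"
  \<comment> \<open>Bundled as a \<open>blinfun\<close> because \<open>leibniz_rule\<close> asks for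
    a derivative that depends continuously on \<open>(x, t)\<close> as an operator.\<close>
  define fx where "fx = (\<lambda>x t. \<Sum>b\<in>Basis. a b (x, t) *\<^sub>R blinfun_inner_left b)"
  have fx: "((\<lambda>x. f x t) has_derivative blinfun_apply (fx x t)) (at x within U)"
    if x: "x \<in> U" and t: "t \<in> cbox 0 1" for x t
  proof -
    have ds: "((\<lambda>x. s (x, t)) has_derivative (\<lambda>v. t *\<^sub>R v)) (at x within U)"
      unfolding s_def by (auto intro!: derivative_eq_intros)
    have dA: "((\<lambda>x. A b (s (x, t))) has_derivative (\<lambda>v. \<Sum>c\<in>Basis. A' b c (s (x, t)) * (t *\<^sub>R v \<bullet> c))) (at x within U)"
      if "b \<in> Basis" for b
      by (rule has_derivative_compose[OF ds der[OF that]]) (use s x t in auto)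
    have "((\<lambda>x. f x t) has_derivative (\<lambda>v. \<Sum>b\<in>Basis. A b (s (x, t)) * (v \<bullet> b) +
        (\<Sum>c\<in>Basis. A' b c (s (x, t)) * (t *\<^sub>R v \<bullet> c)) * ((x - x0) \<bullet> b))) (at x within U)"
      unfolding f_def by (intro has_derivative_sum has_derivative_mult dA) (auto intro!: derivative_eq_intros)
    moreover have "(\<Sum>b\<in>Basis. A b (s (x, t)) * (v \<bullet> b) +
        (\<Sum>c\<in>Basis. A' b c (s (x, t)) * (t *\<^sub>R v \<bullet> c)) * ((x - x0) \<bullet> b)) = fx x t v" for v
    proof -
      \<comment> \<open>After the sums are swapped, closedness exchanges the two indices of
        \<open>A'\<close>: the derivative index gets contracted with \<open>x - x0\<close> and the
        coefficient index with \<open>v\<close>.\<close>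
      have "(\<Sum>b\<in>Basis. (\<Sum>c\<in>Basis. A' b c (s (x, t)) * (t *\<^sub>R v \<bullet> c)) * ((x - x0) \<bullet> b))
          = (\<Sum>c\<in>Basis. \<Sum>b\<in>Basis. A' b c (s (x, t)) * (t *\<^sub>R v \<bullet> c) * ((x - x0) \<bullet> b))"
        unfolding sum_distrib_right by (rule sum.swap)
      also have "\<dots> = (\<Sum>c\<in>Basis. \<Sum>b\<in>Basis. A' c b (s (x, t)) * (t *\<^sub>R v \<bullet> c) * ((x - x0) \<bullet> b))"
        using closed s x t by (intro sum.cong) auto
      also have "\<dots> = (\<Sum>b\<in>Basis. t * (\<Sum>c\<in>Basis. A' b c (s (x, t)) * ((x - x0) \<bullet> c)) * (v \<bullet> b))"
        unfolding sum_distrib_left sum_distrib_right by (intro sum.cong) (simp_all del: inner_diff_left add: ac_simps)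
      finally show ?thesis
        by (simp add: fx_def a_def blinfun.sum_left blinfun.scaleR_left sum.distrib distrib_right)
    qed
    ultimately show ?thesis by simp
  qed
  have conta: "continuous_on (U \<times> {0..1}) (a b)" if "b \<in> Basis" for b
    unfolding a_def split_beta prod.collapse
    by (intro continuous_intros continuous_on_compose2[OF contA[OF that] conts sim]
        continuous_on_compose2[OF cont[OF that] conts sim])
  have "continuous_on (U \<times> cbox 0 1) (\<lambda>(x, t). fx x t)"
    unfolding fx_def split_beta prod.collapse using conta by (auto intro!: continuous_intros)
  moreover have "f x integrable_on cbox 0 1" if "x \<in> U" for x
  proof (rule integrable_continuous)
    show "continuous_on (cbox 0 1) (f x)"
      unfolding f_def
      by (intro continuous_intros continuous_on_compose2[OF contA continuous_on_compose2[OF conts[of UNIV], of _ "\<lambda>t. (x, t)"]])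
        (use s that in auto)
  qed
  ultimately have L: "((\<lambda>x. integral (cbox 0 1) (f x)) has_derivative integral (cbox 0 1) (fx x)) (at x within U)"
    if "x \<in> U" for x
    using leibniz_rule[of U 0 1 f fx x] fx that assms(2) by blast
  have "integral (cbox 0 1) (fx x) v = (\<Sum>b\<in>Basis. A b x * (v \<bullet> b))" if x: "x \<in> U" for x v
  proof -
    have "((\<lambda>t. a b (x, t)) has_integral 1 * A b (s (x, 1)) - 0 * A b (s (x, 0))) {0..1}" if b: "b \<in> Basis" for b
    proof (rule fundamental_theorem_of_calculus)
      fix t :: real assume t: "t \<in> {0..1}"
      have ds: "((\<lambda>t. s (x, t)) has_derivative (\<lambda>h. h *\<^sub>R (x - x0))) (at t within {0..1})"
        unfolding s_def by (auto intro!: derivative_eq_intros)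
      have "((\<lambda>t. A b (s (x, t))) has_derivative (\<lambda>h. \<Sum>c\<in>Basis. A' b c (s (x, t)) * (h *\<^sub>R (x - x0) \<bullet> c))) (at t within {0..1})"
        by (rule has_derivative_compose[OF ds der[OF b]]) (use s x t in auto)
      from has_derivative_mult[OF has_derivative_ident this]
      show "((\<lambda>t. t * A b (s (x, t))) has_vector_derivative a b (x, t)) (at t within {0..1})"
        unfolding has_vector_derivative_def
        by (rule has_derivative_eq_rhs) (simp add: a_def fun_eq_iff algebra_simps sum_distrib_left)
    qed simp
    then have I: "((\<lambda>t. a b (x, t)) has_integral A b x) {0..1}" if "b \<in> Basis" for b
      using that by (fastforce simp: s_def)
    have "(fx x has_integral (\<Sum>b\<in>Basis. A b x *\<^sub>R blinfun_inner_left b)) (cbox 0 1)"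
      unfolding fx_def by (intro has_integral_sum has_integral_scaleR_left) (use I in auto)
    then show ?thesis
      by (simp add: integral_unique blinfun.sum_left blinfun.scaleR_left)
  qed
  then have D: "blinfun_apply (integral (cbox 0 1) (fx x)) = (\<lambda>v. \<Sum>b\<in>Basis. A b x * (v \<bullet> b))" if "x \<in> U" for x
    using that by blast
  have "((\<lambda>x. integral (cbox 0 1) (f x)) has_derivative (\<lambda>v. \<Sum>b\<in>Basis. A b x * (v \<bullet> b))) (at x)" if "x \<in> U" for x
    using L[OF that] unfolding D[OF that] at_within_open[OF that assms(1)] .
  then show ?thesis by blast
qed auto

section \<open>Monodromy\<close>

text \<open>\<open>simply_connected\<close> makes any two loops freely homotopic. For two constant
  loops the homotopy, followed at the base point, is a path between them, so path-connectedness is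
  included.\<close>

lemma simply_connected_path_exists:
  assumes "simply_connected (UNIV :: 'm::topological_space set)"
  shows "\<exists>g. path g \<and> pathstart g = (p::'m) \<and> pathfinish g = q"
proof -
  have "homotopic_loops UNIV (\<lambda>t. p) (\<lambda>t. q)"
    using assms unfolding simply_connected_def by (auto simp: path_def pathstart_def pathfinish_def)
  then obtain h where h: "continuous_on ({0..1::real} \<times> {0..1::real}) h" "h (0, 0) = p" "h (1, 0) = q"
    unfolding homotopic_loops by force
  have "path (\<lambda>s. h (s, 0))"
    unfolding path_def by (rule continuous_on_compose2[OF h(1)]) (auto intro!: continuous_intros)
  then show ?thesis using h(2,3) by (intro exI[of _ "\<lambda>s. h (s, 0)"]) (auto simp: pathstart_def pathfinish_def)
qed

text \<open>\<open>D p f\<close> is meant to say that \<open>f\<close> is a primitive of a given closed form near \<open>p\<close>.\<close>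

locale local_primitives =
  fixes D :: "'m::topological_space \<Rightarrow> ('m \<Rightarrow> real) \<Rightarrow> bool"
  assumes primitive_exists: "\<exists>f. D p f"
    and primitive_near: "D p f \<Longrightarrow> \<forall>\<^sub>F q in nhds p. D q f"
    and primitive_diff: "D p f \<Longrightarrow> D p g \<Longrightarrow> \<forall>\<^sub>F q in nhds p. f q - g q = f p - g p"
begin

text \<open>A form cannot be pulled back along a merely continuous \<open>h\<close>, but primitives
  of the pullback still make sense: near each point, \<open>u\<close> differs by a constant from a
  local primitive composed with \<open>h\<close>. Over \<open>{0..1}\<close> the increment
  \<open>u 1 - u 0\<close> plays the role of the integral along the path \<open>h\<close>.\<close>

definition lift :: "'b::topological_space set \<Rightarrow> ('b \<Rightarrow> 'm) \<Rightarrow> ('b \<Rightarrow> real) \<Rightarrow> bool" where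
  "lift S h u \<longleftrightarrow> (\<forall>x\<in>S. \<forall>f. D (h x) f \<longrightarrow>
     (\<forall>\<^sub>F y in nhds x. y \<in> S \<longrightarrow> u y - f (h y) = u x - f (h x)))"

lemma liftD:
  "lift S h u \<Longrightarrow> x \<in> S \<Longrightarrow> D (h x) f \<Longrightarrow> \<forall>\<^sub>F y in nhds x. y \<in> S \<longrightarrow> u y - f (h y) = u x - f (h x)"
  unfolding lift_def by blast

text \<open>The difference of two lifts is locally constant, since both follow the same local
  primitive.\<close>

lemma lift_unique:
  assumes "connected S" "lift S h u" "lift S h w" "x \<in> S" "y \<in> S"
  shows "u x - w x = u y - w y"
proof (rule connected_local_const[OF assms(1,4,5), where f = "\<lambda>x. u x - w x"], rule ballI)
  fix a assume a: "a \<in> S"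
  obtain f where f: "D (h a) f" using primitive_exists by blast
  have "\<forall>\<^sub>F b in nhds a. b \<in> S \<longrightarrow> u a - w a = u b - w b"
    using liftD[OF assms(2) a f] liftD[OF assms(3) a f]
    by eventually_elim linarith
  then show "\<forall>\<^sub>F b in at a within S. u a - w a = u b - w b"
    by (simp add: eventually_at_filter eventually_mono)
qed

lemma lift_cong:
  assumes "lift S h u" "\<And>x. x \<in> S \<Longrightarrow> h x = h' x"
  shows "lift S h' u"
  unfolding lift_def
proof safe
  fix x f assume x: "x \<in> S" and f: "D (h' x) f"
  show "\<forall>\<^sub>F y in nhds x. y \<in> S \<longrightarrow> u y - f (h' y) = u x - f (h' x)"
    using liftD[OF assms(1) x, of f] f assms(2) x by (auto elim: eventually_mono)
qed

lemma lift_const: "(\<And>x. x \<in> S \<Longrightarrow> h x = p) \<Longrightarrow> lift S h (\<lambda>x. c)"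
  unfolding lift_def by (auto intro!: always_eventually)

lemma lift_add_const: "lift S h u \<Longrightarrow> lift S h (\<lambda>x. u x + c)"
  unfolding lift_def by (simp add: add.commute[of _ c] flip: add_diff_eq)

lemma lift_reparam:
  assumes "lift S h u" "continuous_on T k" "k ` T \<subseteq> S"
  shows "lift T (\<lambda>x. h (k x)) (\<lambda>x. u (k x))"
  unfolding lift_def
proof safe
  fix x f assume x: "x \<in> T" and f: "D (h (k x)) f"
  have "filterlim k (nhds (k x)) (at x within T)"
    using assms(2) x by (auto simp: continuous_on)
  with liftD[OF assms(1) _ f] x assms(3)
  have "\<forall>\<^sub>F y in at x within T. k y \<in> S \<longrightarrow> u (k y) - f (h (k y)) = u (k x) - f (h (k x))"
    by (auto simp: filterlim_iff)
  then show "\<forall>\<^sub>F y in nhds x. y \<in> T \<longrightarrow> u (k y) - f (h (k y)) = u (k x) - f (h (k x))"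
    unfolding eventually_at_filter by (rule eventually_mono) (use assms(3) in auto)
qed

lemma lift_subset: "lift S h u \<Longrightarrow> T \<subseteq> S \<Longrightarrow> lift T h u"
  using lift_reparam[of S h u T "\<lambda>x. x"] by (simp add: continuous_on_id)

lemma lift_primitive:
  assumes "continuous_on S h" "\<And>x. x \<in> S \<Longrightarrow> D (h x) f"
  shows "lift S h (\<lambda>x. f (h x))"
  unfolding lift_def
proof safe
  fix x g assume x: "x \<in> S" and g: "D (h x) g"
  have "filterlim h (nhds (h x)) (at x within S)"
    using assms(1) x by (auto simp: continuous_on)
  with primitive_diff[OF assms(2)[OF x] g]
  have "\<forall>\<^sub>F y in at x within S. f (h y) - g (h y) = f (h x) - g (h x)"
    by (auto simp: filterlim_iff)
  then show "\<forall>\<^sub>F y in nhds x. y \<in> S \<longrightarrow> f (h y) - g (h y) = f (h x) - g (h x)"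
    unfolding eventually_at_filter by (rule eventually_mono) auto
qed

lemma lift_local:
  assumes "continuous_on S h" "x \<in> S"
  shows "\<exists>U u. open U \<and> x \<in> U \<and> lift (U \<inter> S) h u"
proof -
  obtain f where f: "D (h x) f" using primitive_exists by blast
  have "filterlim h (nhds (h x)) (at x within S)"
    using assms by (auto simp: continuous_on)
  with primitive_near[OF f] have "\<forall>\<^sub>F y in at x within S. D (h y) f"
    by (auto simp: filterlim_iff)
  then have "\<forall>\<^sub>F y in nhds x. y \<in> S \<longrightarrow> D (h y) f"
    unfolding eventually_at_filter by (rule eventually_mono) (use f in auto)
  then obtain U where "open U" "x \<in> U" "\<And>y. y \<in> U \<inter> S \<Longrightarrow> D (h y) f"
    unfolding eventually_nhds by blast
  moreover from this have "lift (U \<inter> S) h (\<lambda>x. f (h x))"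
    using assms(1) by (intro lift_primitive) (auto intro: continuous_on_subset)
  ultimately show ?thesis by blast
qed

text \<open>On the connected overlap the lifts differ by a constant, by which the second one is
  shifted. Closedness gives each point outside a piece a neighbourhood missing that piece, so the
  two local conditions can be combined.\<close>

lemma lift_glue:
  assumes "closed A" "closed B" "connected (A \<inter> B)" "lift A h u" "lift B h w"
  shows "\<exists>v. lift (A \<union> B) h v"
proof -
  \<comment> \<open>If the pieces are disjoint, any constant serves.\<close>
  obtain k where k: "u x = w x + k" if "x \<in> A \<inter> B" for x
  proof (cases "A \<inter> B = {}")
    case False
    then obtain c where c: "c \<in> A \<inter> B" by blast
    have "u x = w x + (u c - w c)" if "x \<in> A \<inter> B" for x
      using lift_unique[OF assms(3) lift_subset[OF assms(4)] lift_subset[OF assms(5)] that c]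
      by (simp add: algebra_simps)
    then show ?thesis by (rule that)
  qed auto
  define w' where "w' = (\<lambda>x. w x + k)"
  have w': "lift B h w'" unfolding w'_def by (rule lift_add_const) fact
  define v where "v = (\<lambda>x. if x \<in> A then u x else w' x)"
  have vB: "v x = w' x" if "x \<in> B" for x
    using that k by (auto simp: v_def w'_def)
  have "lift (A \<union> B) h v"
    unfolding lift_def
  proof (intro ballI allI impI)
    fix x f assume x: "x \<in> A \<union> B" and f: "D (h x) f"
    have 1: "\<forall>\<^sub>F y in nhds x. y \<in> A \<longrightarrow> v y - f (h y) = v x - f (h x)"
    proof (cases "x \<in> A")
      case True
      show ?thesis
        using liftD[OF assms(4) True f] by eventually_elim (use True in \<open>auto simp: v_def\<close>)
    next
      case False
      have "\<forall>\<^sub>F y in nhds x. y \<in> - A"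
        using False assms(1) by (intro eventually_nhds_in_open) auto
      then show ?thesis by eventually_elim auto
    qed
    have 2: "\<forall>\<^sub>F y in nhds x. y \<in> B \<longrightarrow> v y - f (h y) = v x - f (h x)"
    proof (cases "x \<in> B")
      case True
      show ?thesis
        using liftD[OF w' True f] by eventually_elim (use True in \<open>auto simp: vB\<close>)
    next
      case False
      have "\<forall>\<^sub>F y in nhds x. y \<in> - B"
        using False assms(2) by (intro eventually_nhds_in_open) auto
      then show ?thesis by eventually_elim auto
    qed
    from 1 2 show "\<forall>\<^sub>F y in nhds x. y \<in> A \<union> B \<longrightarrow> v y - f (h y) = v x - f (h x)"
      by eventually_elim blast
  qed
  then show ?thesis by blast
qed

text \<open>Bisection in both directions, gluing adjacent pieces along a common edge, reduces the
  claim to the local lifts around single points.\<close>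

lemma lift_rectangle:
  fixes h :: "real \<times> real \<Rightarrow> 'm"
  assumes "continuous_on ({a..b} \<times> {c..d}) h" "a \<le> b" "c \<le> d"
  shows "\<exists>u. lift ({a..b} \<times> {c..d}) h u"
proof -
  \<comment> \<open>The intersections keep the pieces inside the domain of \<open>h\<close>, since
    the local case of \<open>Bolzano\<close> also ranges over small intervals that stick
    out.\<close>
  define R where "R = (\<lambda>s s' t t'. ({s..s'} \<inter> {a..b}) \<times> ({t..t'} \<inter> {c..d}))"
  have cl: "closed (R s s' t t')" for s s' t t'
    unfolding R_def by (intro closed_Times closed_Int closed_real_atLeastAtMost)
  have conn: "connected (R s s' t t')" for s s' t t'
    unfolding R_def by (intro convex_connected convex_Times convex_Int) (auto simp: convex_real_interval)
  have "\<exists>u. lift (R a b c d) h u"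
    using assms(2)
  proof (induction rule: Bolzano)
    case (trans s s' s'')
    then obtain u w where "lift (R s s' c d) h u" "lift (R s' s'' c d) h w" by blast
    moreover have "R s s' c d \<inter> R s' s'' c d = R s' s' c d"
      "R s s' c d \<union> R s' s'' c d = R s s'' c d"
      using trans(3,4) unfolding R_def by auto
    ultimately show ?case using lift_glue[OF cl cl] conn by metis
  next
    case (local x)
    \<comment> \<open>A second bisection, now in the other direction. The admissible width
      \<open>e\<close> is part of the bisected property; gluing two pieces keeps the smaller
      width.\<close>
    have "\<exists>e>0. \<forall>s s'. s \<le> x \<and> x \<le> s' \<and> s' - s < e \<longrightarrow> (\<exists>u. lift (R s s' c d) h u)"
      using assms(3)
    proof (induction rule: Bolzano)
      case (trans t t' t'')
      then obtain e1 e2 where e: "e1 > 0" "e2 > 0"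
        "\<And>s s'. s \<le> x \<Longrightarrow> x \<le> s' \<Longrightarrow> s' - s < e1 \<Longrightarrow> \<exists>u. lift (R s s' t t') h u"
        "\<And>s s'. s \<le> x \<Longrightarrow> x \<le> s' \<Longrightarrow> s' - s < e2 \<Longrightarrow> \<exists>u. lift (R s s' t' t'') h u"
        by blast
      have "\<exists>u. lift (R s s' t t'') h u" if s: "s \<le> x" "x \<le> s'" "s' - s < min e1 e2" for s s'
      proof -
        obtain u w where "lift (R s s' t t') h u" "lift (R s s' t' t'') h w"
          using e(3)[of s s'] e(4)[of s s'] s by auto
        moreover have "R s s' t t' \<inter> R s s' t' t'' = R s s' t' t'"
          "R s s' t t' \<union> R s s' t' t'' = R s s' t t''"
          using trans(3,4) unfolding R_def by auto
        ultimately show ?thesis using lift_glue[OF cl cl] conn by metis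
      qed
      then show ?case using e(1,2) by (intro exI[of _ "min e1 e2"]) auto
    next
      case (local y)
      have "(x, y) \<in> {a..b} \<times> {c..d}" using \<open>a \<le> x\<close> \<open>x \<le> b\<close> local by auto
      from lift_local[OF assms(1) this] obtain U u where
        U: "open U" "(x, y) \<in> U" "lift (U \<inter> {a..b} \<times> {c..d}) h u" by blast
      obtain A B where AB: "open A" "open B" "x \<in> A" "y \<in> B" "A \<times> B \<subseteq> U"
        using open_prod_elim[OF U(1,2)] by (metis mem_Sigma_iff)
      obtain e1 e2 where e: "e1 > 0" "ball x e1 \<subseteq> A" "e2 > 0" "ball y e2 \<subseteq> B"
        using AB open_contains_ball by metis
      have "lift (R s s' t t') h u"
        if "s \<le> x" "x \<le> s'" "s' - s < e1" "t \<le> y" "y \<le> t'" "t' - t < e2" for s s' t t'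
      proof (rule lift_subset[OF U(3)])
        have "{s..s'} \<subseteq> ball x e1" "{t..t'} \<subseteq> ball y e2"
          using that by (auto simp: dist_real_def)
        then show "R s s' t t' \<subseteq> U \<inter> {a..b} \<times> {c..d}"
          using e AB(5) unfolding R_def by blast
      qed
      then show ?case using e(1,3) by meson
    qed
    then show ?case .
  qed
  then show ?thesis by (simp add: R_def)
qed

lemma lift_path:
  assumes "path g"
  shows "\<exists>u. lift {0..1} g u"
proof -
  \<comment> \<open>A path is treated as a rectangle of width zero.\<close>
  have "continuous_on ({0..0::real} \<times> {0..1}) (\<lambda>z. g (snd z))"
    by (rule continuous_on_compose2[OF assms[unfolded path_def] continuous_on_snd[OF continuous_on_id]]) auto
  from lift_rectangle[OF this order_refl zero_le_one]
  obtain u where "lift ({0..0::real} \<times> {0..1}) (\<lambda>z. g (snd z)) u" by blast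
  then have "lift {0..1} (\<lambda>t. g (snd (0::real, t))) (\<lambda>t. u (0, t))"
    by (rule lift_reparam) (auto intro!: continuous_intros)
  then show ?thesis by auto
qed

lemma lift_reversepath: "lift {0..1} g u \<Longrightarrow> lift {0..1} (reversepath g) (\<lambda>t. u (1 - t))"
  unfolding reversepath_def by (erule lift_reparam) (auto intro!: continuous_intros)

text \<open>Additivity of the path integral: the two halves of a lift along the join,
  reparametrised, are lifts of the two paths and agree with the given ones up to constants.\<close>

lemma lift_joinpaths:
  assumes "pathfinish g1 = pathstart g2"
    and "lift {0..1} g1 u1" "lift {0..1} g2 u2" "lift {0..1} (g1 +++ g2) v"
  shows "v 1 - v 0 = (u1 1 - u1 0) + (u2 1 - u2 0)"
proof -
  have "lift {0..1} (\<lambda>t. (g1 +++ g2) (t / 2)) (\<lambda>t. v (t / 2))"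
    by (rule lift_reparam[OF assms(4)]) (auto intro!: continuous_intros)
  then have "lift {0..1} g1 (\<lambda>t. v (t / 2))"
    by (rule lift_cong) (auto simp: joinpaths_def)
  from lift_unique[OF _ this assms(2), of 0 1] have 1: "v 0 - u1 0 = v (1/2) - u1 1"
    by simp
  have "lift {0..1} (\<lambda>t. (g1 +++ g2) ((t + 1) / 2)) (\<lambda>t. v ((t + 1) / 2))"
    by (rule lift_reparam[OF assms(4)]) (auto intro!: continuous_intros)
  then have "lift {0..1} g2 (\<lambda>t. v ((t + 1) / 2))"
    by (rule lift_cong)
      (use assms(1) in \<open>auto simp: joinpaths_def pathfinish_def pathstart_def add_divide_distrib\<close>)
  from lift_unique[OF _ this assms(3), of 0 1] have 2: "v (1/2) - u2 0 = v 1 - u2 1"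
    by simp
  have "v 1 - v 0 = (v 1 - v (1/2)) + (v (1/2) - v 0)" by simp
  also have "v 1 - v (1/2) = u2 1 - u2 0" using 2 by linarith
  also have "v (1/2) - v 0 = u1 1 - u1 0" using 1 by linarith
  finally show ?thesis by (simp add: add.commute)
qed

text \<open>A lift over the square of a contracting homotopy is compared on the four sides. One side
  is \<open>g\<close>, the opposite one is constant, and the remaining two carry the same path,
  because every stage of a free homotopy of loops is a loop; their increments agree.\<close>

lemma lift_loop:
  assumes sc: "simply_connected (UNIV :: 'm set)"
    and "path g" "pathfinish g = pathstart g" "lift {0..1} g u"
  shows "u 1 = u 0"
proof -
  have "homotopic_loops UNIV g (\<lambda>t. pathstart g)"
    using sc assms(2,3) unfolding simply_connected_def
    by (auto simp: path_def pathstart_def pathfinish_def)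
  then obtain h where h: "continuous_on ({0..1::real} \<times> {0..1::real}) h"
    "\<And>t. t \<in> {0..1} \<Longrightarrow> h (0, t) = g t" "\<And>t. t \<in> {0..1} \<Longrightarrow> h (1, t) = pathstart g"
    "\<And>s. s \<in> {0..1} \<Longrightarrow> h (s, 1) = h (s, 0)"
    unfolding homotopic_loops by (auto simp: pathstart_def pathfinish_def)
  obtain v where v: "lift ({0..1} \<times> {0..1}) h v"
    using lift_rectangle[OF h(1)] by auto
  have t: "lift {0..1} (\<lambda>t. h (s, t)) (\<lambda>t. v (s, t))" if "s \<in> {0..1}" for s
    by (rule lift_reparam[OF v]) (use that in \<open>auto intro!: continuous_intros\<close>)
  have s: "lift {0..1} (\<lambda>s. h (s, t)) (\<lambda>s. v (s, t))" if "t \<in> {0..1}" for t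
    by (rule lift_reparam[OF v]) (use that in \<open>auto intro!: continuous_intros\<close>)
  have "lift {0..1} g (\<lambda>t. v (0, t))"
    by (rule lift_cong[OF t]) (auto simp: h(2))
  from lift_unique[OF _ this assms(4), of 0 1] have 1: "v (0, 0) - u 0 = v (0, 1) - u 1" by simp
  have "lift {0..1} (\<lambda>t. h (1, t)) (\<lambda>t. 0)"
    by (rule lift_const) (rule h(3))
  from lift_unique[OF _ t this, of 0 1] have 2: "v (1, 0) = v (1, 1)" by simp
  have "lift {0..1} (\<lambda>s. h (s, 0)) (\<lambda>s. v (s, 1))"
    by (rule lift_cong[OF s]) (auto simp: h(4))
  from lift_unique[OF _ this s[of 0], of 0 1] have "v (0, 1) - v (0, 0) = v (1, 1) - v (1, 0)" by simp
  with 1 2 show ?thesis by simp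
qed

lemma lift_path_independent:
  assumes sc: "simply_connected (UNIV :: 'm set)"
    and "path g1" "path g2" "pathstart g1 = pathstart g2" "pathfinish g1 = pathfinish g2"
    and "lift {0..1} g1 u1" "lift {0..1} g2 u2"
  shows "u1 1 - u1 0 = u2 1 - u2 0"
proof -
  let ?g = "g1 +++ reversepath g2"
  have g: "path ?g" "pathfinish ?g = pathstart ?g"
    using assms by auto
  obtain v where v: "lift {0..1} ?g v" using lift_path[OF g(1)] by blast
  have "v 1 - v 0 = (u1 1 - u1 0) + (u2 (1 - 1) - u2 (1 - 0))"
    by (rule lift_joinpaths[OF _ assms(6) lift_reversepath[OF assms(7)] v]) (simp add: assms)
  moreover have "v 1 = v 0" by (rule lift_loop[OF sc g v])
  ultimately show ?thesis by simp
qed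

text \<open>\<open>G p\<close> is the increment along some path from a base point to
  \<open>p\<close>. For \<open>q\<close> near \<open>p\<close> that path is prolonged inside a
  path-connected set, supplied by \<open>lpc\<close>, on which a single \<open>f\<close> stays a
  primitive; by path independence the prolongation adds \<open>f q - f p\<close>.\<close>

theorem global_primitive:
  assumes sc: "simply_connected (UNIV :: 'm set)"
    and lpc: "\<And>(p::'m) U. open U \<Longrightarrow> p \<in> U \<Longrightarrow> \<exists>V. open V \<and> p \<in> V \<and> V \<subseteq> U \<and> path_connected V"
  shows "\<exists>G. \<forall>p f. D p f \<longrightarrow> (\<forall>\<^sub>F q in nhds p. G q - f q = G p - f p)"
proof -
  fix p0 :: 'm
  have "\<exists>g. path g \<and> pathstart g = p0 \<and> pathfinish g = p" for p
    by (rule simply_connected_path_exists[OF sc])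
  then obtain g where g: "path (g p)" "pathstart (g p) = p0" "pathfinish (g p) = p" for p by metis
  have "\<forall>p. \<exists>u. lift {0..1} (g p) u" by (intro allI lift_path g(1))
  from choice[OF this] obtain u where u: "lift {0..1} (g p) (u p)" for p by blast
  define G where "G = (\<lambda>p. u p 1 - u p 0)"
  have "\<forall>\<^sub>F q in nhds p. G q - f q = G p - f p" if f: "D p f" for p f
  proof -
    obtain U where U: "open U" "p \<in> U" "\<And>q. q \<in> U \<Longrightarrow> D q f"
      using primitive_near[OF f] unfolding eventually_nhds by blast
    obtain V where V: "open V" "p \<in> V" "V \<subseteq> U" "path_connected V" using lpc[OF U(1,2)] by blast
    have "G q - f q = G p - f p" if q: "q \<in> V" for q
    proof -
      obtain s where s: "path s" "path_image s \<subseteq> V" "pathstart s = p" "pathfinish s = q"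
        using V(2,4) q unfolding path_connected_def by blast
      have ls: "lift {0..1} s (\<lambda>t. f (s t))"
      proof (rule lift_primitive)
        show "continuous_on {0..1} s" using s(1) by (simp add: path_def)
        show "D (s t) f" if "t \<in> {0..1}" for t
          using s(2) V(3) that by (intro U(3)) (auto simp: path_image_def image_subset_iff)
      qed
      have j: "path (g p +++ s)" using g s by simp
      obtain v where v: "lift {0..1} (g p +++ s) v" using lift_path[OF j] by blast
      have "v 1 - v 0 = (u p 1 - u p 0) + (f (s 1) - f (s 0))"
        by (rule lift_joinpaths[OF _ u ls v]) (simp add: g s)
      moreover have "v 1 - v 0 = u q 1 - u q 0"
        by (rule lift_path_independent[OF sc j g(1) _ _ v u]) (simp_all add: g s)
      moreover have "s 0 = p" "s 1 = q" using s by (auto simp: pathstart_def pathfinish_def)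
      ultimately show ?thesis by (simp add: G_def algebra_simps)
    qed
    then show ?thesis using V(1,2) unfolding eventually_nhds by blast
  qed
  then show ?thesis by blast
qed

end

section \<open>Charts\<close>

lemma chart_inv_snd:
  "smooth_atlas A \<Longrightarrow> c \<in> A \<Longrightarrow> p \<in> fst c \<Longrightarrow> chart_inv c (snd c p) = p"
  unfolding smooth_atlas_def by (metis homeomorphism_apply1)

lemma snd_chart_inv:
  "smooth_atlas A \<Longrightarrow> c \<in> A \<Longrightarrow> x \<in> snd c ` fst c \<Longrightarrow> snd c (chart_inv c x) = x"
  unfolding smooth_atlas_def by (metis homeomorphism_apply2)

lemma open_chart_image:
  assumes "smooth_atlas A" "c \<in> A" "open W"
  shows "open (snd c ` (fst c \<inter> W))"
proof -
  have h: "homeomorphism (fst c) (snd c ` fst c) (snd c) (chart_inv c)" "open (snd c ` fst c)"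
    using assms unfolding smooth_atlas_def by auto
  have "openin (top_of_set (snd c ` fst c)) (snd c ` (fst c \<inter> W))"
    by (rule homeomorphism_imp_open_map[OF h(1)]) (use assms(3) in \<open>auto simp: openin_open\<close>)
  then show ?thesis using h(2) openin_open_trans by blast
qed

lemma open_chart_domain: "smooth_atlas A \<Longrightarrow> c \<in> A \<Longrightarrow> open (fst c)"
  unfolding smooth_atlas_def by blast

lemma open_chart_range: "smooth_atlas A \<Longrightarrow> c \<in> A \<Longrightarrow> open (snd c ` fst c)"
  unfolding smooth_atlas_def by blast

lemma continuous_on_chart_inv:
  "smooth_atlas A \<Longrightarrow> c \<in> A \<Longrightarrow> continuous_on (snd c ` fst c) (chart_inv c)"
  unfolding smooth_atlas_def homeomorphism_def by blast

lemma chart_exists: "smooth_atlas A \<Longrightarrow> \<exists>c\<in>A. p \<in> fst c"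
  unfolding smooth_atlas_def by blast

text \<open>The dictionary between germs on the surface and germs in coordinates, by which local
  arguments change sides.\<close>

lemma eventually_nhds_chart:
  assumes "smooth_atlas A" "c \<in> A" "p \<in> fst c"
  shows "(\<forall>\<^sub>F q in nhds p. P q) \<longleftrightarrow> (\<forall>\<^sub>F x in nhds (snd c p). P (chart_inv c x))"
proof
  assume "\<forall>\<^sub>F q in nhds p. P q"
  then obtain W where W: "open W" "p \<in> W" "\<And>q. q \<in> W \<Longrightarrow> P q" unfolding eventually_nhds by blast
  have "P (chart_inv c x)" if "x \<in> snd c ` (fst c \<inter> W)" for x
    using that W(3) chart_inv_snd[OF assms(1,2)] by auto
  then show "\<forall>\<^sub>F x in nhds (snd c p). P (chart_inv c x)"
    using open_chart_image[OF assms(1,2) W(1)] W(2) assms(3) unfolding eventually_nhds by blast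
next
  assume "\<forall>\<^sub>F x in nhds (snd c p). P (chart_inv c x)"
  then obtain U where U: "open U" "snd c p \<in> U" "\<And>x. x \<in> U \<Longrightarrow> P (chart_inv c x)"
    unfolding eventually_nhds by blast
  have "continuous_on (fst c) (snd c)" using assms(1,2) unfolding smooth_atlas_def homeomorphism_def by blast
  then have "open (snd c -` U \<inter> fst c)"
    using continuous_open_preimage[OF _ open_chart_domain[OF assms(1,2)] U(1)] by (simp add: Int_commute)
  moreover have "P q" if "q \<in> snd c -` U \<inter> fst c" for q
    using U(3)[of "snd c q"] that chart_inv_snd[OF assms(1,2)] by auto
  ultimately show "\<forall>\<^sub>F q in nhds p. P q"
    using U(2) assms(3) unfolding eventually_nhds by blast
qed

lemma has_derivative_cong_nhds:
  assumes "\<forall>\<^sub>F y in nhds x. f y = g y" "(f has_derivative f') (at x)"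
  shows "(g has_derivative f') (at x)"
proof -
  obtain U where U: "open U" "x \<in> U" "\<And>y. y \<in> U \<Longrightarrow> f y = g y"
    using assms(1) unfolding eventually_nhds by blast
  show ?thesis by (rule has_derivative_transform_within_open[OF assms(2) U])
qed

lemma cdiff_eq:
  "(f \<circ> chart_inv c has_derivative f') (at (snd c p)) \<Longrightarrow> cdiff c f p v = f' v"
  unfolding cdiff_def by (simp flip: frechet_derivative_at)

lemma smooth_on_cdiff:
  assumes "smooth_on (snd c ` S) (f \<circ> chart_inv c)" "p \<in> S"
  shows "(f \<circ> chart_inv c has_derivative cdiff c f p) (at (snd c p))"
  using smooth_on_has_derivative[OF assms(1)] assms(2) unfolding cdiff_def by blast

text \<open>This is the chain rule for the change of coordinates. The two expressions being compared
  agree only over the overlap of the charts, hence the passage to neighbourhoods at the end.\<close>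

lemma has_derivative_chart_change:
  assumes A: "smooth_atlas A" and c: "c \<in> A" "p \<in> fst c" and d: "d \<in> A" "p \<in> fst d"
    and f: "(f \<circ> chart_inv d has_derivative f') (at (snd d p))"
  shows "(f \<circ> chart_inv c has_derivative (\<lambda>v. f' (cdiff c (snd d) p v))) (at (snd c p))"
proof -
  have "smooth_on (snd c ` (fst c \<inter> fst d)) (snd d \<circ> chart_inv c)"
    using A c d unfolding smooth_atlas_def by blast
  then have "(snd d \<circ> chart_inv c has_derivative cdiff c (snd d) p) (at (snd c p))"
    by (rule smooth_on_cdiff) (use c d in blast)
  moreover have "(snd d \<circ> chart_inv c) (snd c p) = snd d p"
    using chart_inv_snd[OF A c] by simp
  ultimately have "((f \<circ> chart_inv d) \<circ> (snd d \<circ> chart_inv c) has_derivative f' \<circ> cdiff c (snd d) p) (at (snd c p))"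
    using f by (metis diff_chain_at)
  moreover have "\<forall>\<^sub>F q in nhds p. q \<in> fst d"
    by (rule eventually_nhds_in_open[OF open_chart_domain[OF A d(1)] d(2)])
  then have "\<forall>\<^sub>F x in nhds (snd c p). ((f \<circ> chart_inv d) \<circ> (snd d \<circ> chart_inv c)) x = (f \<circ> chart_inv c) x"
    unfolding eventually_nhds_chart[OF A c] by eventually_elim (simp add: chart_inv_snd[OF A d(1)])
  ultimately show ?thesis using has_derivative_cong_nhds by (fastforce simp: o_def)
qed

lemma chart_ball_exists: "smooth_atlas A \<Longrightarrow> c \<in> A \<Longrightarrow> open W \<Longrightarrow> p \<in> fst c \<Longrightarrow> p \<in> W \<Longrightarrow>
   \<exists>r>0. ball (snd c p) r \<subseteq> snd c ` (fst c \<inter> W)"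
  using open_chart_image open_contains_ball by (metis IntI imageI)

lemma linear_eq_sum_Basis:
  fixes f :: "'a::euclidean_space \<Rightarrow> real"
  assumes "linear f"
  shows "f v = (\<Sum>b\<in>Basis. f b * (v \<bullet> b))"
proof -
  have "f v = f (\<Sum>b\<in>Basis. (v \<bullet> b) *\<^sub>R b)" by (simp add: euclidean_representation)
  then show ?thesis by (simp add: linear_sum[OF assms] linear_scale[OF assms] mult.commute)
qed

text \<open>Intended for the \<open>e\<^sub>0\<close> coordinate of the immersion, whose
  differential takes values in \<open>R21\<close>.\<close>

lemma zero_differential_imp_constant:
  fixes f :: "'m::topological_space \<Rightarrow> 'b::real_normed_vector"
  assumes A: "smooth_atlas A" and sc: "simply_connected (UNIV :: 'm set)"
    and f: "\<And>c p. c \<in> A \<Longrightarrow> p \<in> fst c \<Longrightarrow> (f \<circ> chart_inv c has_derivative (\<lambda>v. 0)) (at (snd c p))"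
  shows "f p = f q"
proof (rule connected_local_const[of UNIV, where f = f])
  have "path_connected (UNIV :: 'm set)"
    unfolding path_connected_def using simply_connected_path_exists[OF sc] by blast
  then show "connected (UNIV :: 'm set)" by (rule path_connected_imp_connected)
  show "\<forall>a\<in>UNIV. \<forall>\<^sub>F b in at a within UNIV. f a = f b"
  proof
    fix a :: 'm
    obtain c where c: "c \<in> A" "a \<in> fst c" using chart_exists[OF A] by blast
    obtain r where r: "r > 0" "ball (snd c a) r \<subseteq> snd c ` fst c"
      using chart_ball_exists[OF A c(1) open_UNIV c(2)] by auto
    have d: "(f \<circ> chart_inv c has_derivative (\<lambda>v. 0)) (at x within ball (snd c a) r)"
      if "x \<in> ball (snd c a) r" for x
      using f[OF c(1)] r(2) that by (blast intro: has_derivative_at_withinI)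
    have "f a = f (chart_inv c x)" if "x \<in> ball (snd c a) r" for x
      using has_derivative_zero_unique[OF convex_ball d _ that, of "snd c a"] r(1) chart_inv_snd[OF A c] by simp
    moreover have "\<forall>\<^sub>F x in nhds (snd c a). x \<in> ball (snd c a) r"
      by (rule eventually_nhds_in_open) (use r(1) in auto)
    ultimately have "\<forall>\<^sub>F b in nhds a. f a = f b"
      unfolding eventually_nhds_chart[OF A c] by (auto elim: eventually_mono)
    then show "\<forall>\<^sub>F b in at a within UNIV. f a = f b"
      by (simp add: eventually_at_filter eventually_mono)
  qed
qed auto

section \<open>Closed one-forms on simply connected surfaces\<close>

text \<open>On a coordinate ball \<open>poincare_convex\<close> gives a primitive in one chart;
  compatibility under changes of chart makes it a primitive in every chart, and
  \<open>global_primitive\<close> continues it over the surface.\<close>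

theorem closed_one_form_exact:
  fixes A :: "'m::topological_space chart set" and \<alpha> :: "'m chart \<Rightarrow> 'm \<Rightarrow> real^2 \<Rightarrow> real"
  assumes A: "smooth_atlas A" and sc: "simply_connected (UNIV :: 'm set)"
    and compat: "\<And>c d p v. c \<in> A \<Longrightarrow> d \<in> A \<Longrightarrow> p \<in> fst c \<Longrightarrow> p \<in> fst d \<Longrightarrow>
      \<alpha> d p (cdiff c (snd d) p v) = \<alpha> c p v"
    and lin: "\<And>c p. c \<in> A \<Longrightarrow> p \<in> fst c \<Longrightarrow> linear (\<alpha> c p)"
    and smooth: "\<And>c v. c \<in> A \<Longrightarrow> smooth_on (snd c ` fst c) ((\<lambda>p. \<alpha> c p v) \<circ> chart_inv c)"
    and closed: "\<And>c p v w. c \<in> A \<Longrightarrow> p \<in> fst c \<Longrightarrow>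
      cdiff c (\<lambda>q. \<alpha> c q v) p w = cdiff c (\<lambda>q. \<alpha> c q w) p v"
  shows "\<exists>G. \<forall>c\<in>A. \<forall>p\<in>fst c. (G \<circ> chart_inv c has_derivative \<alpha> c p) (at (snd c p))"
proof -
  define Prim where "Prim = (\<lambda>f q. \<forall>c\<in>A. q \<in> fst c \<longrightarrow> (f \<circ> chart_inv c has_derivative \<alpha> c q) (at (snd c q)))"
  have Prim_chart: "Prim f q"
    if d: "d \<in> A" "q \<in> fst d" and f: "(f \<circ> chart_inv d has_derivative \<alpha> d q) (at (snd d q))" for f q d
    unfolding Prim_def
  proof (intro ballI impI)
    fix c assume c: "c \<in> A" "q \<in> fst c"
    show "(f \<circ> chart_inv c has_derivative \<alpha> c q) (at (snd c q))"
      using has_derivative_chart_change[OF A c d f] by (simp add: compat[OF c(1) d(1) c(2) d(2)])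
  qed
  \<comment> \<open>The condition is imposed on a whole neighbourhood, so that it passes to nearby
    points by itself.\<close>
  define D where "D = (\<lambda>p f. \<forall>\<^sub>F q in nhds p. Prim f q)"
  interpret local_primitives D
  proof
    fix p :: 'm
    obtain c where c: "c \<in> A" "p \<in> fst c" using chart_exists[OF A] by blast
    obtain r where r: "r > 0" "ball (snd c p) r \<subseteq> snd c ` fst c"
      using chart_ball_exists[OF A c(1) open_UNIV c(2)] by auto
    note smB = smooth_on_subset[OF smooth[OF c(1)] r(2)]
    let ?a = "\<lambda>b x. \<alpha> c (chart_inv c x) b"
    have da: "(?a b has_derivative frechet_derivative (?a b) (at x)) (at x)"
      if "x \<in> ball (snd c p) r" for x b
      using smooth_on_has_derivative[OF smB that] by (simp add: o_def)
    have "\<exists>f. \<forall>x\<in>ball (snd c p) r. (f has_derivative (\<lambda>v. \<Sum>b\<in>Basis. ?a b x * (v \<bullet> b))) (at x)"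
    proof (rule poincare_convex[where A' = "\<lambda>b b' x. frechet_derivative (?a b) (at x) b'"])
      fix b x assume x: "x \<in> ball (snd c p) r"
      have "frechet_derivative (?a b) (at x) v = (\<Sum>b'\<in>Basis. frechet_derivative (?a b) (at x) b' * (v \<bullet> b'))" for v
        by (rule linear_eq_sum_Basis[OF has_derivative_linear[OF da[OF x, of b]]])
      then show "(?a b has_derivative (\<lambda>v. \<Sum>b'\<in>Basis. frechet_derivative (?a b) (at x) b' * (v \<bullet> b'))) (at x)"
        by (intro has_derivative_eq_rhs[OF da[OF x, of b]] ext)
    next
      fix b b' :: "real^2"
      show "continuous_on (ball (snd c p) r) (\<lambda>x. frechet_derivative (?a b) (at x) b')"
        using smooth_on_continuous_on[OF smooth_on_frechet_derivative[OF smB]] by (simp add: o_def)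
    next
      fix b b' x :: "real^2" assume x: "x \<in> ball (snd c p) r"
      then obtain q where q: "q \<in> fst c" "x = snd c q" using r(2) by blast
      show "frechet_derivative (?a b) (at x) b' = frechet_derivative (?a b') (at x) b"
        using closed[OF c(1) q(1)] by (simp add: cdiff_def o_def q(2))
    qed auto
    then obtain f where f: "\<And>x. x \<in> ball (snd c p) r \<Longrightarrow> (f has_derivative (\<lambda>v. \<Sum>b\<in>Basis. ?a b x * (v \<bullet> b))) (at x)"
      by blast
    have "Prim (f \<circ> snd c) (chart_inv c x)" if x: "x \<in> ball (snd c p) r" for x
    proof -
      obtain q where q: "q \<in> fst c" "x = snd c q" using r(2) x by blast
      have qx: "chart_inv c x = q" using chart_inv_snd[OF A c(1) q(1)] q(2) by simp
      have "(\<Sum>b\<in>Basis. ?a b x * (v \<bullet> b)) = \<alpha> c q v" for v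
        using linear_eq_sum_Basis[OF lin[OF c(1) q(1)], of v] qx by simp
      then have "(f has_derivative \<alpha> c q) (at x)" by (intro has_derivative_eq_rhs[OF f[OF x]] ext)
      moreover have "\<forall>\<^sub>F y in nhds x. f y = ((f \<circ> snd c) \<circ> chart_inv c) y"
      proof -
        have "\<forall>\<^sub>F y in nhds x. y \<in> ball (snd c p) r" by (rule eventually_nhds_in_open) (use x in auto)
        then show ?thesis
          by eventually_elim (use r(2) snd_chart_inv[OF A c(1)] in auto)
      qed
      ultimately have "((f \<circ> snd c) \<circ> chart_inv c has_derivative \<alpha> c q) (at x)"
        using has_derivative_cong_nhds by blast
      then show ?thesis using Prim_chart[OF c(1) q(1)] qx q(2) by simp
    qed
    then have "\<forall>\<^sub>F x in nhds (snd c p). Prim (f \<circ> snd c) (chart_inv c x)"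
      using r(1) unfolding eventually_nhds by (intro exI[of _ "ball (snd c p) r"]) auto
    then have "D p (f \<circ> snd c)"
      unfolding D_def eventually_nhds_chart[OF A c] .
    then show "\<exists>f. D p f" by blast
  next
    fix p f assume "D p f"
    then show "\<forall>\<^sub>F q in nhds p. D q f" unfolding D_def by (simp add: eventually_eventually)
  next
    fix p f g assume f: "D p f" and g: "D p g"
    obtain c where c: "c \<in> A" "p \<in> fst c" using chart_exists[OF A] by blast
    have "\<forall>\<^sub>F q in nhds p. Prim f q \<and> Prim g q \<and> q \<in> fst c"
      using f g eventually_nhds_in_open[OF open_chart_domain[OF A c(1)] c(2)]
      unfolding D_def by eventually_elim auto
    moreover have "\<forall>\<^sub>F x in nhds (snd c p). x \<in> snd c ` fst c"
      by (rule eventually_nhds_in_open[OF open_chart_range[OF A c(1)]]) (use c in auto)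
    ultimately have "\<forall>\<^sub>F x in nhds (snd c p). x \<in> snd c ` fst c \<and>
        Prim f (chart_inv c x) \<and> Prim g (chart_inv c x) \<and> chart_inv c x \<in> fst c"
      unfolding eventually_nhds_chart[OF A c] by eventually_elim auto
    then obtain r where r: "r > 0" "\<And>x. x \<in> ball (snd c p) r \<Longrightarrow> x \<in> snd c ` fst c \<and>
        Prim f (chart_inv c x) \<and> Prim g (chart_inv c x) \<and> chart_inv c x \<in> fst c"
      unfolding eventually_nhds_metric by (auto simp: dist_commute)
    have "((\<lambda>x. (f \<circ> chart_inv c) x - (g \<circ> chart_inv c) x) has_derivative (\<lambda>h. 0)) (at x)" if x: "x \<in> ball (snd c p) r" for x
    proof -
      have "snd c (chart_inv c x) = x" using snd_chart_inv[OF A c(1)] r(2)[OF x] by blast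
      then have "(f \<circ> chart_inv c has_derivative \<alpha> c (chart_inv c x)) (at x)"
        "(g \<circ> chart_inv c has_derivative \<alpha> c (chart_inv c x)) (at x)"
        using r(2)[OF x] c(1) unfolding Prim_def by (metis, metis)
      from has_derivative_diff[OF this] show ?thesis by simp
    qed
    then have z: "((\<lambda>x. (f \<circ> chart_inv c) x - (g \<circ> chart_inv c) x) has_derivative (\<lambda>h. 0)) (at x within ball (snd c p) r)"
      if "x \<in> ball (snd c p) r" for x using that has_derivative_at_withinI by blast
    have "f (chart_inv c x) - g (chart_inv c x) = f p - g p" if "x \<in> ball (snd c p) r" for x
      using has_derivative_zero_unique[OF convex_ball z that, of "snd c p"] r(1) chart_inv_snd[OF A c] by simp
    moreover have "\<forall>\<^sub>F x in nhds (snd c p). x \<in> ball (snd c p) r"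
      by (rule eventually_nhds_in_open) (use r(1) in auto)
    ultimately show "\<forall>\<^sub>F q in nhds p. f q - g q = f p - g p"
      unfolding eventually_nhds_chart[OF A c] by (auto elim: eventually_mono)
  qed
  \<comment> \<open>Coordinate balls make the surface locally path-connected.\<close>
  have lpc: "\<exists>V. open V \<and> p \<in> V \<and> V \<subseteq> U \<and> path_connected V" if U: "open U" "p \<in> U" for p :: 'm and U
  proof -
    obtain c where c: "c \<in> A" "p \<in> fst c" using chart_exists[OF A] by blast
    obtain r where r: "r > 0" "ball (snd c p) r \<subseteq> snd c ` (fst c \<inter> U)"
      using chart_ball_exists[OF A c(1) U(1) c(2) U(2)] by auto
    let ?V = "chart_inv c ` ball (snd c p) r"
    have inv: "chart_inv c x \<in> fst c \<inter> U \<and> snd c (chart_inv c x) = x" if "x \<in> ball (snd c p) r" for x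
      using r(2) that chart_inv_snd[OF A c(1)] by force
    have "path_connected ?V"
      by (intro path_connected_continuous_image convex_imp_path_connected convex_ball
          continuous_on_subset[OF continuous_on_chart_inv[OF A c(1)]]) (use r(2) in auto)
    moreover have "?V = fst c \<inter> (snd c -` ball (snd c p) r)"
    proof (intro equalityI subsetI)
      fix q assume "q \<in> ?V"
      then obtain x where "x \<in> ball (snd c p) r" "q = chart_inv c x" by blast
      with inv[of x] show "q \<in> fst c \<inter> (snd c -` ball (snd c p) r)" by simp
    next
      fix q assume "q \<in> fst c \<inter> (snd c -` ball (snd c p) r)"
      then show "q \<in> ?V" using chart_inv_snd[OF A c(1), of q] by (intro image_eqI[of _ _ "snd c q"]) auto
    qed
    moreover have "continuous_on (fst c) (snd c)" using A c(1) unfolding smooth_atlas_def homeomorphism_def by blast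
    then have "open (fst c \<inter> (snd c -` ball (snd c p) r))"
      by (rule continuous_open_preimage[OF _ open_chart_domain[OF A c(1)] open_ball])
    moreover have "?V \<subseteq> U" using inv by auto
    moreover have "p \<in> ?V" using r(1) chart_inv_snd[OF A c] by (metis centre_in_ball image_eqI)
    ultimately show ?thesis by metis
  qed
  obtain G where G: "\<And>p f. D p f \<Longrightarrow> \<forall>\<^sub>F q in nhds p. G q - f q = G p - f p"
    using global_primitive[OF sc lpc] by metis
  have "(G \<circ> chart_inv c has_derivative \<alpha> c p) (at (snd c p))" if c: "c \<in> A" "p \<in> fst c" for c p
  proof -
    obtain f where f: "D p f" using primitive_exists by blast
    have "Prim f p" using f unfolding D_def by (rule eventually_nhds_x_imp_x)
    then have "(f \<circ> chart_inv c has_derivative \<alpha> c p) (at (snd c p))"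
      using c unfolding Prim_def by blast
    \<comment> \<open>Near \<open>p\<close> the function \<open>G\<close> is \<open>f\<close>
      shifted by the constant \<open>G p - f p\<close>.\<close>
    from has_derivative_add[OF this has_derivative_const[of "G p - f p"]]
    have "((\<lambda>x. (f \<circ> chart_inv c) x + (G p - f p)) has_derivative \<alpha> c p) (at (snd c p))" by simp
    moreover have "\<forall>\<^sub>F x in nhds (snd c p). (f \<circ> chart_inv c) x + (G p - f p) = (G \<circ> chart_inv c) x"
      using G[OF f] unfolding eventually_nhds_chart[OF A c] by eventually_elim simp
    ultimately show ?thesis by (rule has_derivative_cong_nhds[rotated])
  qed
  then show ?thesis by blast
qed

section \<open>The Levi-Civita connection in an orthonormal frame\<close>

lemma bilinear_expand:
  fixes B :: "'a::euclidean_space \<Rightarrow> 'a \<Rightarrow> real"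
  assumes "bilinear B"
  shows "B w u = (\<Sum>a\<in>Basis. \<Sum>b\<in>Basis. (w \<bullet> a) * (u \<bullet> b) * B a b)"
proof -
  have l: "linear (\<lambda>w. B w u)" "linear (B a)" for u a
    using assms by (auto simp: bilinear_def)
  have "B w u = (\<Sum>a\<in>Basis. B a u * (w \<bullet> a))"
    by (rule linear_eq_sum_Basis[OF l(1)])
  also have "\<dots> = (\<Sum>a\<in>Basis. (\<Sum>b\<in>Basis. B a b * (u \<bullet> b)) * (w \<bullet> a))"
    by (subst linear_eq_sum_Basis[OF l(2), of _ u]) (rule refl)
  finally show ?thesis by (simp add: sum_distrib_left sum_distrib_right ac_simps)
qed

text \<open>Differentiability of \<open>g\<close> is given only for constant arguments; expansion in
  a basis extends it to moving ones. Bilinearity of the derivative follows by feeding constant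
  fields into the same computation and comparing the two derivatives.\<close>

lemma has_derivative_bilinear_field:
  fixes g :: "'a::euclidean_space \<Rightarrow> 'a \<Rightarrow> 'a \<Rightarrow> real"
  assumes x: "open \<Omega>" "x \<in> \<Omega>" and bil: "\<And>y. y \<in> \<Omega> \<Longrightarrow> bilinear (g y)"
    and Dg: "\<And>w u. ((\<lambda>y. g y w u) has_derivative Dg w u) (at x)"
    and w: "(w has_derivative w') (at x)" and u: "(u has_derivative u') (at x)"
  shows "((\<lambda>y. g y (w y) (u y)) has_derivative
    (\<lambda>v. Dg (w x) (u x) v + g x (w' v) (u x) + g x (w x) (u' v))) (at x)"
    and "bilinear (\<lambda>w u. Dg w u v)"
proof -
  have D: "((\<lambda>y. g y (w y) (u y)) has_derivative
      (\<lambda>v. (\<Sum>a\<in>Basis. \<Sum>b\<in>Basis. (w x \<bullet> a) * (u x \<bullet> b) * Dg a b v)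
        + g x (w' v) (u x) + g x (w x) (u' v))) (at x)"
    if w: "(w has_derivative w') (at x)" and u: "(u has_derivative u') (at x)" for w w' u u'
  proof (rule has_derivative_transform_within_open[OF _ x])
    note [derivative_intros] = Dg w u
    show "((\<lambda>y. \<Sum>a\<in>Basis. \<Sum>b\<in>Basis. (w y \<bullet> a) * (u y \<bullet> b) * g y a b) has_derivative
      (\<lambda>v. (\<Sum>a\<in>Basis. \<Sum>b\<in>Basis. (w x \<bullet> a) * (u x \<bullet> b) * Dg a b v)
        + g x (w' v) (u x) + g x (w x) (u' v))) (at x)"
      unfolding bilinear_expand[OF bil[OF x(2)], of "w' _"] bilinear_expand[OF bil[OF x(2)], of "w x" "u' _"]
      by (auto intro!: derivative_eq_intros simp: sum.distrib algebra_simps)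
    show "(\<Sum>a\<in>Basis. \<Sum>b\<in>Basis. (w y \<bullet> a) * (u y \<bullet> b) * g y a b) = g y (w y) (u y)" if "y \<in> \<Omega>" for y
      using bilinear_expand[OF bil[OF that], of "w y" "u y"] by simp
  qed
  have E: "Dg w u v = (\<Sum>a\<in>Basis. \<Sum>b\<in>Basis. (w \<bullet> a) * (u \<bullet> b) * Dg a b v)" for w u v
  proof -
    have "Dg w u = (\<lambda>v. (\<Sum>a\<in>Basis. \<Sum>b\<in>Basis. (w \<bullet> a) * (u \<bullet> b) * Dg a b v) + g x 0 u + g x w 0)"
      by (rule has_derivative_unique[OF Dg D]) (auto intro!: derivative_eq_intros)
    then show ?thesis
      using bilinear_lzero[OF bil[OF x(2)]] bilinear_rzero[OF bil[OF x(2)]] by simp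
  qed
  show "((\<lambda>y. g y (w y) (u y)) has_derivative
    (\<lambda>v. Dg (w x) (u x) v + g x (w' v) (u x) + g x (w x) (u' v))) (at x)"
    using D[OF w u] E[of "w x" "u x"] by simp
  have "bilinear (\<lambda>w u. \<Sum>a\<in>Basis. \<Sum>b\<in>Basis. (w \<bullet> a) * (u \<bullet> b) * Dg a b v)"
    unfolding bilinear_def
    by (intro conjI allI linearI)
      (simp_all add: inner_add_left algebra_simps sum.distrib sum_distrib_left)
  moreover have "(\<lambda>w u. Dg w u v) = (\<lambda>w u. \<Sum>a\<in>Basis. \<Sum>b\<in>Basis. (w \<bullet> a) * (u \<bullet> b) * Dg a b v)"
    by (intro ext E)
  ultimately show "bilinear (\<lambda>w u. Dg w u v)" by (rule ssubst[rotated])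
qed

text \<open>If \<open>e2\<close> were a multiple of \<open>e3\<close>, the factor would have square
  -1. So the pair is a basis of the plane, and the coefficients are read off, with a sign for the
  vector of square -1.\<close>

lemma orthonormal_expand:
  fixes g :: "real^2 \<Rightarrow> real^2 \<Rightarrow> real"
  assumes "bilinear g" "\<And>v w. g v w = g w v" "g e2 e2 = -1" "g e3 e3 = 1" "g e2 e3 = 0"
  shows "v = - g v e2 *\<^sub>R e2 + g v e3 *\<^sub>R e3"
proof -
  note bl = bilinear_ladd[OF assms(1)] bilinear_lmul[OF assms(1)]
  have ne: "e2 \<noteq> e3" using assms(3,4) by auto
  have "independent {e2, e3}"
  proof (rule independent_insertI)
    show "independent {e3}"
      using assms(4) bilinear_lzero[OF assms(1)] by (auto simp: independent_insert)
    show "e2 \<notin> span {e3}"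
    proof
      assume "e2 \<in> span {e3}"
      then obtain k where "e2 = k *\<^sub>R e3" by (auto simp: span_singleton)
      then have "g e2 e2 = k * (k * g e3 e3)" by (simp add: bl bilinear_rmul[OF assms(1)])
      then have "k * k = -1" using assms(3,4) by simp
      then show False using zero_le_square[of k] by simp
    qed
  qed
  then have "dim {e2, e3} = 2" using ne by (simp add: dim_eq_card_independent)
  then have "span {e2, e3} = UNIV" by (simp flip: dim_eq_full)
  then have "v \<in> span {e2, e3}" by simp
  then obtain a where "v - a *\<^sub>R e2 \<in> span {e3}" unfolding span_breakdown_eq ..
  then obtain b where "v - a *\<^sub>R e2 = b *\<^sub>R e3" by (auto simp: span_singleton)
  then have v: "v = a *\<^sub>R e2 + b *\<^sub>R e3" by (simp add: diff_eq_eq add.commute)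
  have ab: "g v e2 = - a" "g v e3 = b"
    using assms(3,4,5) assms(2)[of e3 e2] by (simp_all add: v bl)
  show ?thesis unfolding ab minus_minus by (rule v)
qed

section \<open>Connection form and coframe of an adapted frame\<close>

lemmas surface_atlas = lorentzian_spin_surface_def[THEN iffD1, THEN conjunct1]
lemmas surface_metric = lorentzian_spin_surface_def[THEN iffD1, THEN conjunct2, THEN conjunct1]
lemmas surface_cover = lorentzian_spin_surface_def[THEN iffD1, THEN conjunct2, THEN conjunct2, THEN conjunct1]
lemmas surface_frames = lorentzian_spin_surface_def[THEN iffD1, THEN conjunct2, THEN conjunct2,
  THEN conjunct2, THEN conjunct1, THEN spec]
lemmas surface_transitions = lorentzian_spin_surface_def[THEN iffD1, THEN conjunct2, THEN conjunct2,
  THEN conjunct2, THEN conjunct2, THEN conjunct1, THEN spec, THEN spec]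
lemmas metric_fibres = lorentzian_metric_def[THEN iffD1, THEN conjunct1, THEN bspec, THEN bspec]
lemmas metric_smoothness = lorentzian_metric_def[THEN iffD1, THEN conjunct2, THEN conjunct1, THEN bspec,
  THEN spec, THEN spec]
lemmas metric_change = lorentzian_metric_def[THEN iffD1, THEN conjunct2, THEN conjunct2, THEN bspec,
  THEN bspec, THEN bspec, THEN spec, THEN spec]

locale spin_frame =
  fixes M :: "('m::topological_space, 'i) spin_surface" and c :: "'m chart" and i :: 'i and p :: 'm
  assumes surface: "lorentzian_spin_surface M" and chart: "c \<in> atlas M"
    and point: "p \<in> fst c" "p \<in> fdom M i"
begin

abbreviation g where "g \<equiv> metric M c p"
abbreviation e2 where "e2 \<equiv> frame2 M i c p"
abbreviation e3 where "e3 \<equiv> frame3 M i c p"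
abbreviation \<theta>2 where "\<theta>2 w q \<equiv> metric M c q w (frame2 M i c q)"
abbreviation \<theta>3 where "\<theta>3 w q \<equiv> metric M c q w (frame3 M i c q)"
abbreviation \<Gamma> where "\<Gamma> \<equiv> christoffel M c p"
abbreviation Dg where "Dg w u \<equiv> cdiff c (\<lambda>q. metric M c q w u) p"

text \<open>The connection form of the frame. Since the infinitesimal isometries of a Lorentzian
  plane form a line, this one form determines the covariant derivatives of both frame vectors, and
  half of it appears in \<open>spin_deriv\<close>.\<close>

definition \<omega> :: "real^2 \<Rightarrow> real" where
  "\<omega> v = metric M c p (levi_civita M c (frame2 M i) p v) (frame3 M i c p)"

lemma atlas_smooth: "smooth_atlas (atlas M)"
  by (rule surface_atlas[OF surface])

lemma metric_bilinear: "q \<in> fst c \<Longrightarrow> bilinear (metric M c q)"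
  and metric_symmetric: "q \<in> fst c \<Longrightarrow> metric M c q v w = metric M c q w v"
  using metric_fibres[OF surface_metric[OF surface] chart] by blast+

lemma metric_smooth: "smooth_on (snd c ` fst c) ((\<lambda>q. metric M c q v w) \<circ> chart_inv c)"
  by (rule metric_smoothness[OF surface_metric[OF surface] chart])

lemma open_fdom: "open (fdom M i)"
  using surface_frames[OF surface, of i] by blast

lemma open_region: "open (snd c ` (fst c \<inter> fdom M i))"
  by (rule open_chart_image[OF atlas_smooth chart open_fdom])

lemma frame_smooth:
  "smooth_on (snd c ` (fst c \<inter> fdom M i)) (frame2 M i c \<circ> chart_inv c)"
  "smooth_on (snd c ` (fst c \<inter> fdom M i)) (frame3 M i c \<circ> chart_inv c)"
  using surface_frames[OF surface, of i] chart unfolding vector_field_def by blast+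

lemma frame_orthonormal:
  assumes "q \<in> fst c" "q \<in> fdom M i"
  shows "metric M c q (frame2 M i c q) (frame2 M i c q) = -1"
    "metric M c q (frame3 M i c q) (frame3 M i c q) = 1"
    "metric M c q (frame2 M i c q) (frame3 M i c q) = 0"
    "metric M c q (frame3 M i c q) (frame2 M i c q) = 0"
proof -
  show "metric M c q (frame2 M i c q) (frame2 M i c q) = -1"
    "metric M c q (frame3 M i c q) (frame3 M i c q) = 1"
    and *: "metric M c q (frame2 M i c q) (frame3 M i c q) = 0"
    using surface_frames[OF surface, of i] chart assms by blast+
  from * show "metric M c q (frame3 M i c q) (frame2 M i c q) = 0"
    using metric_symmetric[OF assms(1)] by simp
qed

lemma frame_expand:
  "q \<in> fst c \<Longrightarrow> q \<in> fdom M i \<Longrightarrow> v = - \<theta>2 v q *\<^sub>R frame2 M i c q + \<theta>3 v q *\<^sub>R frame3 M i c q"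
  by (rule orthonormal_expand[OF metric_bilinear metric_symmetric]) (simp_all add: frame_orthonormal)

lemma chart_inv_point: "chart_inv c (snd c p) = p"
  by (rule chart_inv_snd[OF atlas_smooth chart point(1)])

lemma metric_nondegenerate:
  assumes "\<And>u. g v u = g w u"
  shows "v = w"
proof -
  have "v = - g v e2 *\<^sub>R e2 + g v e3 *\<^sub>R e3" by (rule frame_expand[OF point])
  also have "\<dots> = - g w e2 *\<^sub>R e2 + g w e3 *\<^sub>R e3" by (simp add: assms)
  also have "\<dots> = w" by (rule frame_expand[OF point, symmetric])
  finally show ?thesis .
qed

lemma metric_linear: "linear (\<lambda>v. g v w)" "linear (g v)"
  using metric_bilinear[OF point(1)] by (auto simp: bilinear_def)

lemma metric_has_derivative: "((\<lambda>q. metric M c q w u) \<circ> chart_inv c has_derivative Dg w u) (at (snd c p))"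
  by (rule smooth_on_cdiff[OF metric_smooth point(1)])

lemma frame_has_derivative:
  "(frame2 M i c \<circ> chart_inv c has_derivative cdiff c (frame2 M i c) p) (at (snd c p))"
  "(frame3 M i c \<circ> chart_inv c has_derivative cdiff c (frame3 M i c) p) (at (snd c p))"
  using point by (auto intro!: smooth_on_cdiff[OF frame_smooth(1)] smooth_on_cdiff[OF frame_smooth(2)])

lemma metric_field_has_derivative:
  assumes w: "(w \<circ> chart_inv c has_derivative w') (at (snd c p))"
    and u: "(u \<circ> chart_inv c has_derivative u') (at (snd c p))"
  shows "((\<lambda>q. metric M c q (w q) (u q)) \<circ> chart_inv c has_derivative
    (\<lambda>v. Dg (w p) (u p) v + g (w' v) (u p) + g (w p) (u' v))) (at (snd c p))"
proof -
  have "bilinear (metric M c (chart_inv c y))" if "y \<in> snd c ` fst c" for y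
    using that metric_bilinear chart_inv_snd[OF atlas_smooth chart] by auto
  from has_derivative_bilinear_field(1)[OF open_chart_range[OF atlas_smooth chart] _ this
      metric_has_derivative[unfolded o_def] w u]
  show ?thesis using point(1) by (simp add: chart_inv_point o_def)
qed

lemma Dg_bilinear: "bilinear (\<lambda>w u. Dg w u v)"
proof -
  have "bilinear (metric M c (chart_inv c y))" if "y \<in> snd c ` fst c" for y
    using that metric_bilinear chart_inv_snd[OF atlas_smooth chart] by auto
  from has_derivative_bilinear_field(2)[OF open_chart_range[OF atlas_smooth chart] _ this
      metric_has_derivative[unfolded o_def] has_derivative_const has_derivative_const]
  show ?thesis using point(1) by blast
qed

lemma Dg_linear: "linear (Dg w u)"
  by (rule has_derivative_linear[OF metric_has_derivative])

lemma Dg_symmetric: "Dg w u = Dg u w"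
proof -
  have "\<forall>\<^sub>F q in nhds p. q \<in> fst c"
    by (rule eventually_nhds_in_open[OF open_chart_domain[OF atlas_smooth chart] point(1)])
  then have "\<forall>\<^sub>F q in nhds p. metric M c q w u = metric M c q u w"
    by eventually_elim (rule metric_symmetric)
  then have "\<forall>\<^sub>F x in nhds (snd c p). ((\<lambda>q. metric M c q w u) \<circ> chart_inv c) x = ((\<lambda>q. metric M c q u w) \<circ> chart_inv c) x"
    unfolding eventually_nhds_chart[OF atlas_smooth chart point(1)] by simp
  from has_derivative_cong_nhds[OF this metric_has_derivative] show ?thesis
    using has_derivative_unique metric_has_derivative by blast
qed

text \<open>This justifies the \<open>THE\<close> in \<open>christoffel\<close>: the right-hand side
  is linear in \<open>u\<close>, so the nondegenerate metric represents it by exactly one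
  vector.\<close>

lemma christoffel_koszul: "2 * g (\<Gamma> v w) u = Dg w u v + Dg v u w - Dg v w u"
proof -
  define K where "K = (\<lambda>u. Dg w u v + Dg v u w - Dg v w u)"
  have "linear K"
    unfolding K_def using Dg_bilinear Dg_linear
    by (intro linear_compose_add linear_compose_sub) (auto simp: bilinear_def)
  \<comment> \<open>The first sign comes from \<open>g e2 e2 = -1\<close>, the halves from the
    factor 2 in the Koszul formula.\<close>
  define z where "z = (- K e2 / 2) *\<^sub>R e2 + (K e3 / 2) *\<^sub>R e3"
  have z: "2 * g z u = K u" for u
  proof -
    have "K u = K (- g u e2 *\<^sub>R e2 + g u e3 *\<^sub>R e3)" by (rule arg_cong[OF frame_expand[OF point]])
    also have "\<dots> = - g u e2 * K e2 + g u e3 * K e3"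
      by (simp add: linear_add[OF \<open>linear K\<close>] linear_diff[OF \<open>linear K\<close>] linear_scale[OF \<open>linear K\<close>] linear_neg[OF \<open>linear K\<close>])
    also have "\<dots> = 2 * g z u"
      by (simp add: z_def linear_add[OF metric_linear(1)] linear_diff[OF metric_linear(1)]
          linear_scale[OF metric_linear(1)] linear_neg[OF metric_linear(1)] metric_symmetric[OF point(1), of u])
    finally show ?thesis by simp
  qed
  have "\<exists>!z. \<forall>u. 2 * g z u = K u"
  proof (rule ex1I[of _ z])
    fix z' assume "\<forall>u. 2 * g z' u = K u"
    then have "2 * g z' u = 2 * g z u" for u using z by simp
    then show "z' = z" by (intro metric_nondegenerate) simp
  qed (use z in blast)
  then have "\<forall>u. 2 * g (THE z. \<forall>u. 2 * g z u = K u) u = K u" by (rule theI')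
  then show ?thesis unfolding K_def christoffel_def by blast
qed

lemma christoffel_symmetric: "\<Gamma> v w = \<Gamma> w v"
proof (rule metric_nondegenerate)
  fix u
  have "2 * g (\<Gamma> v w) u = 2 * g (\<Gamma> w v) u"
    unfolding christoffel_koszul by (simp add: Dg_symmetric[of v w])
  then show "g (\<Gamma> v w) u = g (\<Gamma> w v) u" by simp
qed

text \<open>Add two Koszul formulas with \<open>w\<close> and \<open>u\<close> exchanged: only the
  derivative along \<open>v\<close> survives.\<close>

lemma christoffel_metric: "g (\<Gamma> v w) u + g w (\<Gamma> v u) = Dg w u v"
  using christoffel_koszul[of v w u] christoffel_koszul[of v u w] metric_symmetric[OF point(1), of w]
  by (simp add: Dg_symmetric[of w u])

lemma linear_\<omega>: "linear \<omega>"
proof -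
  have "linear (\<lambda>v. g (cdiff c (frame2 M i c) p v) e3 + (1 / 2) *\<^sub>R (Dg e2 e3 v + Dg v e3 e2 - Dg v e2 e3))"
    using linear_compose[OF has_derivative_linear[OF frame_has_derivative(1)] metric_linear(1)[of e3]]
      Dg_linear Dg_bilinear
    by (intro linear_compose_add linear_compose_sub linear_compose_scale_right) (auto simp: bilinear_def o_def)
  moreover have "(\<lambda>v. g (cdiff c (frame2 M i c) p v) e3 + (1 / 2) *\<^sub>R (Dg e2 e3 v + Dg v e3 e2 - Dg v e2 e3)) v = \<omega> v" for v
    using christoffel_koszul[of v e2 e3] by (simp add: \<omega>_def levi_civita_def linear_add[OF metric_linear(1)])
  then have "(\<lambda>v. g (cdiff c (frame2 M i c) p v) e3 + (1 / 2) *\<^sub>R (Dg e2 e3 v + Dg v e3 e2 - Dg v e2 e3)) = \<omega>"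
    by (rule ext)
  ultimately show ?thesis by simp
qed

lemma levi_civita_metric:
  assumes w: "(w c \<circ> chart_inv c has_derivative cdiff c (w c) p) (at (snd c p))"
    and u: "(u c \<circ> chart_inv c has_derivative cdiff c (u c) p) (at (snd c p))"
  shows "cdiff c (\<lambda>q. metric M c q (w c q) (u c q)) p v
    = g (levi_civita M c w p v) (u c p) + g (w c p) (levi_civita M c u p v)"
  using christoffel_metric[of v "w c p" "u c p"]
  by (simp add: cdiff_eq[OF metric_field_has_derivative[OF w u]] levi_civita_def
      linear_add[OF metric_linear(1)] linear_add[OF metric_linear(2)])

lemma cdiff_locally_constant:
  assumes "\<And>q. q \<in> fst c \<Longrightarrow> q \<in> fdom M i \<Longrightarrow> f q = k"
  shows "cdiff c f p v = 0"
proof (rule cdiff_eq)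
  have "\<forall>\<^sub>F q in nhds p. q \<in> fst c \<and> q \<in> fdom M i"
    using eventually_nhds_in_open[OF open_chart_domain[OF atlas_smooth chart] point(1)]
      eventually_nhds_in_open[OF open_fdom point(2)] by eventually_elim blast
  then have "\<forall>\<^sub>F q in nhds p. k = f q" by eventually_elim (simp add: assms)
  then have "\<forall>\<^sub>F x in nhds (snd c p). k = (f \<circ> chart_inv c) x"
    unfolding eventually_nhds_chart[OF atlas_smooth chart point(1)] by simp
  from has_derivative_cong_nhds[OF this has_derivative_const]
  show "(f \<circ> chart_inv c has_derivative (\<lambda>v. 0)) (at (snd c p))" .
qed

text \<open>Differentiating the orthonormality relations leaves one free coefficient. It enters both
  equations with the same sign because the signature is (1,1): the generator of boosts is symmetric
  in the frame.\<close>

lemma levi_civita_frame: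
  "levi_civita M c (frame2 M i) p v = \<omega> v *\<^sub>R e3"
  "levi_civita M c (frame3 M i) p v = \<omega> v *\<^sub>R e2"
proof -
  let ?n2 = "levi_civita M c (frame2 M i) p v" and ?n3 = "levi_civita M c (frame3 M i) p v"
  note sym = metric_symmetric[OF point(1)]
  have 22: "g ?n2 e2 = 0"
    using levi_civita_metric[of "frame2 M i" "frame2 M i" v, OF frame_has_derivative(1) frame_has_derivative(1)]
      cdiff_locally_constant[of "\<lambda>q. metric M c q (frame2 M i c q) (frame2 M i c q)", OF frame_orthonormal(1)]
      sym[of e2 ?n2] by simp
  have 33: "g ?n3 e3 = 0"
    using levi_civita_metric[of "frame3 M i" "frame3 M i" v, OF frame_has_derivative(2) frame_has_derivative(2)]
      cdiff_locally_constant[of "\<lambda>q. metric M c q (frame3 M i c q) (frame3 M i c q)", OF frame_orthonormal(2)]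
      sym[of e3 ?n3] by simp
  have 32: "g ?n3 e2 = - \<omega> v"
    using levi_civita_metric[of "frame3 M i" "frame2 M i" v, OF frame_has_derivative(2) frame_has_derivative(1)]
      cdiff_locally_constant[of "\<lambda>q. metric M c q (frame3 M i c q) (frame2 M i c q)", OF frame_orthonormal(4)]
      sym[of e3 ?n2] by (simp add: \<omega>_def)
  have "?n2 = - g ?n2 e2 *\<^sub>R e2 + g ?n2 e3 *\<^sub>R e3" by (rule frame_expand[OF point])
  then show "?n2 = \<omega> v *\<^sub>R e3" unfolding 22 \<omega>_def[symmetric] by simp
  have "?n3 = - g ?n3 e2 *\<^sub>R e2 + g ?n3 e3 *\<^sub>R e3" by (rule frame_expand[OF point])
  then show "?n3 = \<omega> v *\<^sub>R e2" unfolding 33 32 by simp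
qed

text \<open>The covariant derivative of the constant coordinate vector \<open>w\<close> along
  \<open>v\<close> is \<open>\<Gamma> v w\<close>; the rest is metric compatibility with
  \<open>levi_civita_frame\<close> inserted.\<close>

lemma coframe_has_derivative:
  "((\<theta>2 w) \<circ> chart_inv c has_derivative (\<lambda>v. g (\<Gamma> v w) e2 + \<omega> v * g w e3)) (at (snd c p))"
  "((\<theta>3 w) \<circ> chart_inv c has_derivative (\<lambda>v. g (\<Gamma> v w) e3 + \<omega> v * g w e2)) (at (snd c p))"
proof -
  have w: "((\<lambda>q. w) \<circ> chart_inv c has_derivative (\<lambda>v. 0)) (at (snd c p))" by (simp add: o_def)
  have l: "g (k *\<^sub>R x + y) z = k * g x z + g y z" "g z (k *\<^sub>R x) = k * g z x" "g z (x + y) = g z x + g z y" for k x y z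
    by (simp_all add: linear_add[OF metric_linear(1)] linear_scale[OF metric_linear(1)]
        linear_add[OF metric_linear(2)] linear_scale[OF metric_linear(2)])
  have "Dg w e2 v + g 0 e2 + g w (cdiff c (frame2 M i c) p v) = g (\<Gamma> v w) e2 + \<omega> v * g w e3" for v
    using christoffel_metric[of v w e2] levi_civita_frame(1)[of v] l(2)[of w "\<omega> v" e3] l(3)[of w "cdiff c (frame2 M i c) p v" "\<Gamma> v e2"]
    by (simp add: levi_civita_def linear_0[OF metric_linear(1)])
  then show "((\<theta>2 w) \<circ> chart_inv c has_derivative (\<lambda>v. g (\<Gamma> v w) e2 + \<omega> v * g w e3)) (at (snd c p))"
    using metric_field_has_derivative[OF w frame_has_derivative(1)] by simp
  have "Dg w e3 v + g 0 e3 + g w (cdiff c (frame3 M i c) p v) = g (\<Gamma> v w) e3 + \<omega> v * g w e2" for v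
    using christoffel_metric[of v w e3] levi_civita_frame(2)[of v] l(2)[of w "\<omega> v" e2] l(3)[of w "cdiff c (frame3 M i c) p v" "\<Gamma> v e3"]
    by (simp add: levi_civita_def linear_0[OF metric_linear(1)])
  then show "((\<theta>3 w) \<circ> chart_inv c has_derivative (\<lambda>v. g (\<Gamma> v w) e3 + \<omega> v * g w e2)) (at (snd c p))"
    using metric_field_has_derivative[OF w frame_has_derivative(2)] by simp
qed

end

section \<open>Quaternionic identities\<close>

lemma qscal_commute: "qscal a * x = x * qscal (a :: 'a::comm_ring_1)"
  by (simp add: quat_eq_iff qscal_def mult.commute)

lemma qconj_simps [simp]:
  fixes x y :: "'a::comm_ring_1 quat"
  shows "qconj (x + y) = qconj x + qconj y" "qconj (x - y) = qconj x - qconj y"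
    "qconj (- x) = - qconj x" "qconj (x * y) = qconj y * qconj x" "qconj (qconj x) = x"
  by (simp_all add: quat_eq_iff qconj_def algebra_simps)

lemma bounded_linear_qconj: "bounded_linear (qconj :: 'a::{ring_1, real_normed_vector} quat \<Rightarrow> 'a quat)"
  by (rule bounded_linear_intro[where K = 1])
    (simp_all add: quat_eq_iff qconj_def norm_quat_def)

lemma bounded_linear_qhat: "bounded_linear qhat"
  by (rule bounded_linear_intro[where K = 1])
    (simp_all add: quat_eq_iff qhat_def lhat_def lorentz_eq_iff norm_quat_def norm_lorentz_def)

lemma qhat_mult: "qhat (x * y) = qhat x * qhat y"
  by (simp add: quat_eq_iff qhat_def lhat_def lorentz_eq_iff algebra_simps)

lemma qconj_mult_self: "qconj z * z = qscal (Hform z z)" "z * qconj z = qscal (Hform z z)"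
  by (simp_all add: quat_eq_iff qconj_def Hform_def qscal_def algebra_simps)

lemma Hform_eq_qc0: "Hform x y = qc0 (qconj x * y)"
  by (simp add: quat_eq_iff qconj_def Hform_def)

lemma qc0_mult_commute: "qc0 (x * y) = qc0 (y * (x :: 'a::comm_ring_1 quat))"
  by (simp add: algebra_simps)

text \<open>\<open>Hform x y\<close> is the scalar part of \<open>qconj x * y\<close>, and scalar
  parts are invariant under cyclic exchange, so each \<open>z\<close> meets a \<open>qconj z\<close>
  and cancels.\<close>

lemma Hform_conjugate:
  assumes "Hform z z = 1"
  shows "Hform (qconj z * x * z) (qconj z * y * z) = Hform x y"
proof -
  have z: "z * qconj z = 1" using qconj_mult_self(2)[of z] assms by (simp add: qscal_def one_quat_def zero_lorentz_def)
  have "Hform (qconj z * x * z) (qconj z * y * z) = qc0 (qconj z * qconj x * (z * qconj z) * y * z)"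
    by (simp add: Hform_eq_qc0 mult.assoc)
  also have "\<dots> = qc0 (qconj z * (qconj x * y * z))" by (simp add: z mult.assoc)
  also have "\<dots> = qc0 (qconj x * y * (z * qconj z))" by (subst qc0_mult_commute) (simp only: mult.assoc)
  finally show ?thesis by (simp add: z Hform_eq_qc0)
qed

section \<open>Clifford multiplication on odd spinors\<close>

lemma clif_qe0: "clif qe0 z = - qhat z"
  by (simp add: clif_def qe0_def vec22_def quat_eq_iff qscal_def lorentz_eq_iff sigma_def imag_def)

lemma sigma_imag_square: "qscal (sigma * imag) * (qscal (sigma * imag) * x) = - x"
  by (simp add: quat_eq_iff lorentz_eq_iff qscal_def sigma_def imag_def)

lemma clif_odd: "qhat z = - z \<Longrightarrow> clif x z = - (qscal (sigma * imag) * (x * z))"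
  by (simp add: clif_def mult.assoc)

lemma pairing_clif_odd:
  assumes "qhat z = - z"
  shows "pairing (clif x z) z = qconj z * x * z"
proof -
  have "pairing (clif x z) z = - (qscal (sigma * imag) * (qconj z * qscal (sigma * imag)) * (x * z))"
    by (simp add: pairing_def clif_odd[OF assms] mult.assoc)
  also have "\<dots> = qconj z * (x * z)"
    by (simp add: qscal_commute[of _ "qconj z", symmetric] mult.assoc sigma_imag_square)
  finally show ?thesis by (simp add: mult.assoc)
qed

text \<open>The coordinates of \<open>\<phi>\<^sup>+ + e\<^sub>0 \<cdot> \<phi>\<^sup>+\<close>. The
  word odd refers to the involution \<open>qhat\<close>, which negates the values.\<close>

definition odd_part :: "hac \<Rightarrow> hac" where
  "odd_part z = plus_part z + clif qe0 (plus_part z)"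

lemma odd_part_components:
  "odd_part z = Quat (Lorentz 0 (lre (qc0 z) + lsig (qc0 z))) (Lorentz 0 (lre (qc1 z) + lsig (qc1 z)))
     (Lorentz 0 (lre (qc2 z) + lsig (qc2 z))) (Lorentz 0 (lre (qc3 z) + lsig (qc3 z)))"
  by (simp add: odd_part_def clif_qe0 plus_part_def qhat_def lhat_def quat_eq_iff lorentz_eq_iff qscal_def
      sigma_def scaleR_conv_of_real[where 'a=complex] field_simps)

lemma qhat_odd_part: "qhat (odd_part z) = - odd_part z"
  by (simp add: odd_part_components qhat_def lhat_def quat_eq_iff lorentz_eq_iff)

lemma bounded_linear_odd_part: "bounded_linear odd_part"
proof (rule bounded_linear_intro[where K = 1])
  fix x :: hac
  show "norm (odd_part x) \<le> norm x * 1"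
    unfolding odd_part_components norm_quat_def norm_lorentz_def
    by (simp add: add_mono norm_triangle_ineq)
qed (simp_all add: odd_part_components quat_eq_iff lorentz_eq_iff algebra_simps)

text \<open>A factor fixed by \<open>qhat\<close> contains no \<sigma>, and \<open>odd_part\<close>
  is linear over such factors. Transition elements and the action of
  \<open>e\<^sub>2 \<cdot> e\<^sub>3\<close> are of this kind.\<close>

lemma odd_part_mult: "qhat s = s \<Longrightarrow> odd_part (s * z) = s * odd_part z"
  by (simp add: odd_part_components qhat_def lhat_def quat_eq_iff lorentz_eq_iff algebra_simps)

text \<open>Since the square of \<sigma> is 1, the new value is the old one evaluated at \<sigma> =
  1, that is \<open>lre + lsig\<close> of \<open>Hform z z\<close>.\<close>

lemma Hform_odd_part: "Hform z z = 1 \<Longrightarrow> Hform (odd_part z) (odd_part z) = 1"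
  by (simp add: odd_part_components Hform_def lorentz_eq_iff algebra_simps)

lemma odd_part_H0: "z \<in> H0 \<Longrightarrow> odd_part z \<in> H0"
proof -
  assume "z \<in> H0"
  then obtain p0 p1 p2 p3 where z: "z = Quat (lcomplex p0) (imag * lcomplex p1) (lcomplex p2) (imag * lcomplex p3)"
    unfolding H0_def by blast
  have "odd_part z = Quat (lcomplex (Lorentz 0 (lre p0 + lsig p0))) (imag * lcomplex (Lorentz 0 (lre p1 + lsig p1)))
      (lcomplex (Lorentz 0 (lre p2 + lsig p2))) (imag * lcomplex (Lorentz 0 (lre p3 + lsig p3)))"
    by (simp add: odd_part_components z lcomplex_def imag_def lorentz_eq_iff algebra_simps)
  then show ?thesis unfolding H0_def by blast
qed

lemma odd_part_clif_e2_e3: "odd_part (clif qe2 (clif qe3 z)) = clif qe2 (clif qe3 (odd_part z))"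
  unfolding clif_e2_e3
  by (rule odd_part_mult) (simp add: qscal_def imag_def qI_def qhat_def lhat_def quat_eq_iff lorentz_eq_iff)

lemma dirac_odd_part:
  assumes "- clif qe2 y2 + clif qe3 y3 = clif qe1 z"
  shows "- clif qe2 (odd_part y2) + clif qe3 (odd_part y3) = clif qe1 (odd_part z)"
proof -
  \<comment> \<open>\<open>L\<close> evaluates at \<sigma> = -1. Because \<open>clif\<close> applies
    the hat, this evaluation of \<open>clif x u\<close> sees only the value of \<open>u\<close> at
    \<sigma> = 1, which is what \<open>odd_part\<close> retains. It matters here that
    \<open>qe1\<close>, \<open>qe2\<close>, \<open>qe3\<close> contain no \<sigma>.\<close>
  define L :: "hac \<Rightarrow> hac" where "L = (\<lambda>u. Quat (Lorentz (lre (qc0 u) - lsig (qc0 u)) 0) (Lorentz (lre (qc1 u) - lsig (qc1 u)) 0)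
    (Lorentz (lre (qc2 u) - lsig (qc2 u)) 0) (Lorentz (lre (qc3 u) - lsig (qc3 u)) 0))"
  have L: "L (clif qe1 u) = clif qe1 (odd_part u)" "L (clif qe2 u) = clif qe2 (odd_part u)"
    "L (clif qe3 u) = clif qe3 (odd_part u)" for u
    by (simp_all add: L_def odd_part_components clif_def qe1_def qe2_def qe3_def vec22_def qscal_def
        sigma_def imag_def qhat_def lhat_def quat_eq_iff lorentz_eq_iff algebra_simps)
  have "L (- clif qe2 y2 + clif qe3 y3) = - L (clif qe2 y2) + L (clif qe3 y3)"
    by (simp add: L_def quat_eq_iff lorentz_eq_iff)
  then show ?thesis using assms by (simp add: L)
qed

text \<open>The derivative of \<open>qconj z * x * z\<close> for fixed \<open>x\<close> when
  \<open>z\<close> moves with velocity \<open>y\<close>.\<close>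

definition frame_deriv :: "hac \<Rightarrow> hac \<Rightarrow> hac \<Rightarrow> hac" where
  "frame_deriv z x y = qconj y * x * z + qconj z * x * y"

lemma frame_deriv_linear:
  "frame_deriv z x (y + y') = frame_deriv z x y + frame_deriv z x y'"
  "frame_deriv z x (r *\<^sub>R y) = r *\<^sub>R frame_deriv z x y"
  by (simp_all add: frame_deriv_def algebra_simps linear_scale[OF bounded_linear.linear[OF bounded_linear_qconj]])

lemma frame_deriv_diff: "frame_deriv z x (y - y') = frame_deriv z x y - frame_deriv z x y'"
  by (simp add: frame_deriv_def algebra_simps)

lemma qe_products:
  "qe1 * qe2 = qscal imag * qe3" "qe1 * qe3 = qscal imag * qe2" "qe1 * qe1 = -1"
  "qconj qe1 = - qe1" "qconj qe2 = - qe2" "qconj qe3 = - qe3"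
  by (simp_all add: qe1_def qe2_def qe3_def vec22_def qscal_def imag_def sigma_def qconj_def
      quat_eq_iff lorentz_eq_iff)

lemma lorentz_two_sel: "lre (2 :: 'a::ring_1 lorentz) = 2" "lsig (2 :: 'a lorentz) = 0"
  by (simp_all only: one_add_one[symmetric] lorentz_add_sel lorentz_mult_sel add_0_right)

text \<open>\<open>e\<^sub>2 \<cdot> e\<^sub>3\<close> acts as left multiplication by
  \<open>i I\<close>, which \<open>qconj\<close> negates, so the derivative is a conjugated
  commutator. The factor 2 compensates the 1/2 in the spin connection.\<close>

lemma frame_deriv_rotation:
  "frame_deriv z qe2 (clif qe2 (clif qe3 z)) = 2 *\<^sub>R (qconj z * qe3 * z)"
  "frame_deriv z qe3 (clif qe2 (clif qe3 z)) = 2 *\<^sub>R (qconj z * qe2 * z)"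
proof -
  let ?R = "qscal imag * qI"
  have R: "qconj ?R = - ?R"
    by (simp add: qscal_def imag_def qI_def qconj_def quat_eq_iff lorentz_eq_iff)
  have "frame_deriv z x (S * z) = qconj z * (x * S - S * x) * z" if "qconj S = - S" for x S
    by (simp add: frame_deriv_def that algebra_simps)
  note * = this[OF R]
  have "qe2 * ?R - ?R * qe2 = 2 *\<^sub>R qe3" "qe3 * ?R - ?R * qe3 = 2 *\<^sub>R qe2"
    by (simp_all add: qe2_def qe3_def vec22_def qI_def qscal_def imag_def sigma_def
      quat_eq_iff lorentz_eq_iff lorentz_two_sel scaleR_conv_of_real[where 'a=complex])
  then show "frame_deriv z qe2 (clif qe2 (clif qe3 z)) = 2 *\<^sub>R (qconj z * qe3 * z)"
    "frame_deriv z qe3 (clif qe2 (clif qe3 z)) = 2 *\<^sub>R (qconj z * qe2 * z)"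
    unfolding clif_e2_e3 * by simp_all
qed

text \<open>Pointwise algebra: \<open>z\<close> stands for the spinor, \<open>y2\<close> and
  \<open>y3\<close> for its covariant derivatives along \<open>e\<^sub>2\<close> and
  \<open>e\<^sub>3\<close>.\<close>

context
  fixes z y2 y3 :: hac
  assumes odd: "qhat z = - z" "qhat y2 = - y2" "qhat y3 = - y3"
    and dirac: "- clif qe2 y2 + clif qe3 y3 = clif qe1 z"
begin

lemma odd_dirac: "qe2 * y2 - qe3 * y3 = - (qe1 * z)"
proof -
  let ?s = "qscal (sigma * imag)"
  have "?s * (qe2 * y2 - qe3 * y3) = ?s * (- (qe1 * z))"
    using dirac by (simp add: clif_odd odd algebra_simps)
  then have "?s * (?s * (qe2 * y2 - qe3 * y3)) = ?s * (?s * (- (qe1 * z)))" by simp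
  then show ?thesis unfolding sigma_imag_square neg_equal_iff_equal .
qed

text \<open>Left multiplication by \<open>qe1\<close> exchanges \<open>qe2\<close> and
  \<open>qe3\<close> up to the scalar \<open>i\<close>, which turns the Dirac equation into a
  relation between the mixed terms.\<close>

lemma odd_dirac': "qe3 * y2 = qe2 * y3 - qscal imag * z"
proof -
  have "qe1 * (qe2 * y2 - qe3 * y3) = - (qe1 * qe1 * z)" unfolding odd_dirac by (simp add: mult.assoc)
  then have "qscal imag * (qe3 * y2 - qe2 * y3) = z"
    by (simp add: right_diff_distrib qe_products flip: mult.assoc)
  then have "qscal imag * (qscal imag * (qe3 * y2 - qe2 * y3)) = qscal imag * z" by simp
  moreover have "qscal imag * (qscal imag * x) = - x" for x :: hac
    by (simp add: quat_eq_iff lorentz_eq_iff qscal_def imag_def)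
  ultimately show ?thesis by (simp add: algebra_simps)
qed

text \<open>The correction \<open>i z\<close> from \<open>odd_dirac'\<close> contributes
  \<open>qconj z * i * z\<close> twice with opposite signs, because \<open>qconj\<close> fixes the
  scalar \<open>i\<close>.\<close>

lemma frame_deriv_closed: "frame_deriv z qe3 y2 = frame_deriv z qe2 y3"
proof -
  have "qconj y2 * qe3 = - qconj (qe3 * y2)" "qconj y3 * qe2 = - qconj (qe2 * y3)"
    by (simp_all add: qe_products)
  moreover have "qconj (qscal imag * z) = qconj z * qscal imag"
    by (simp add: qscal_def qconj_def quat_eq_iff)
  ultimately have "frame_deriv z qe3 y2 = - (qconj (qe2 * y3) - qconj z * qscal imag) * z
      + qconj z * (qe2 * y3 - qscal imag * z)"
    unfolding frame_deriv_def odd_dirac' mult.assoc by (simp add: odd_dirac' del: qconj_simps(4) flip: mult.assoc)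
  then show ?thesis
    by (simp add: frame_deriv_def qe_products algebra_simps)
qed

text \<open>The trace is \<open>qconj d * z - qconj z * d\<close> for
  \<open>d = qe2 * y2 - qe3 * y3\<close>. As \<open>d\<close> equals \<open>- (qe1 * z)\<close> and
  \<open>qconj\<close> negates \<open>qe1\<close>, both terms are the rotated
  \<open>qe1\<close>.\<close>

lemma frame_deriv_trace: "- frame_deriv z qe2 y2 + frame_deriv z qe3 y3 = 2 *\<^sub>R (qconj z * qe1 * z)"
proof -
  have "- frame_deriv z qe2 y2 + frame_deriv z qe3 y3
      = qconj (qe2 * y2 - qe3 * y3) * z - qconj z * (qe2 * y2 - qe3 * y3)"
    by (simp add: frame_deriv_def qe_products algebra_simps)
  also have "\<dots> = 2 *\<^sub>R (qconj z * qe1 * z)"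
    unfolding odd_dirac by (simp add: qe_products scaleR_2 mult.assoc)
  finally show ?thesis .
qed

end

section \<open>Rotations of \<open>R21\<close> and the structure group\<close>

lemma R21_eq: "R21 = {vec22 0 x1 x2 x3 | x1 x2 x3. True}"
proof -
  have "vec22 x0 x1 x2 x3 \<in> R21 \<longleftrightarrow> x0 = 0" for x0 x1 x2 x3
    by (auto simp: R21_def R22_def qe0_def Hform_vec22 lorentz_eq_iff)
  note * = this
  have "R21 \<subseteq> R22" by (auto simp: R21_def)
  show ?thesis
  proof (intro equalityI subsetI)
    fix x assume x: "x \<in> R21"
    then obtain x0 x1 x2 x3 where "x = vec22 x0 x1 x2 x3" using \<open>R21 \<subseteq> R22\<close> unfolding R22_def by blast
    moreover from this have "x0 = 0" using x * by simp
    ultimately show "x \<in> {vec22 0 x1 x2 x3 | x1 x2 x3. True}" by blast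
  qed (use * in blast)
qed

text \<open>Oddness makes \<open>z\<close> equal to \<sigma> times a quaternion free of \<sigma>;
  the two factors \<sigma> cancel, and what remains is a rotation of vectors without scalar
  part.\<close>

lemma R21_conjugate:
  assumes "z \<in> H0" "qhat z = - z" "x \<in> R21"
  shows "qconj z * x * z \<in> R21"
proof -
  obtain p0 p1 p2 p3 where z: "z = Quat (lcomplex p0) (imag * lcomplex p1) (lcomplex p2) (imag * lcomplex p3)"
    using assms(1) unfolding H0_def by blast
  obtain x1 x2 x3 where x: "x = vec22 0 x1 x2 x3" using assms(3) unfolding R21_eq by blast
  define r0 r1 r2 r3 where r: "r0 = lsig p0" "r1 = lsig p1" "r2 = lsig p2" "r3 = lsig p3"
  have p: "lre p0 = 0" "lre p1 = 0" "lre p2 = 0" "lre p3 = 0"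
    using assms(2) by (auto simp: z qhat_def lhat_def quat_eq_iff lorentz_eq_iff lcomplex_def imag_def eq_neg_iff_add_eq_0
        simp flip: of_real_add)
  \<comment> \<open>The expansion \<open>(s^2 - v.v) x + 2 (v.x) v - 2 s (v \<times> x)\<close> of
    conjugation by \<open>s + v\<close>, with \<open>s = r0\<close> and
    \<open>v = (i r1, r2, i r3)\<close>; the factors \<open>i\<close> in \<open>v\<close> and
    \<open>x\<close> produce the signs.\<close>
  have "qconj z * x * z = vec22 0
    ((r0^2 + r1^2 - r2^2 + r3^2) * x1 - 2 * (r1*x1+r2*x2+r3*x3) * r1 - 2 * r0 * (r2*x3+r3*x2))
    ((r0^2 + r1^2 - r2^2 + r3^2) * x2 + 2 * (r1*x1+r2*x2+r3*x3) * r2 - 2 * r0 * (r3*x1-r1*x3))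
    ((r0^2 + r1^2 - r2^2 + r3^2) * x3 - 2 * (r1*x1+r2*x2+r3*x3) * r3 + 2 * r0 * (r1*x2+r2*x1))"
    by (simp add: z x vec22_def qconj_def lcomplex_def p r[symmetric] imag_def sigma_def quat_eq_iff lorentz_eq_iff
        complex_eq_iff algebra_simps power2_eq_square)
  then show ?thesis unfolding R21_eq by blast
qed

text \<open>Elements of \<open>spin_group\<close> are combinations of 1 and \<open>I\<close> without
  \<sigma>, so they commute with \<open>qe1\<close>; this makes the normal built from
  \<open>qe1\<close> independent of the frame.\<close>

lemma spin_group_facts:
  assumes "s \<in> spin_group"
  shows "qhat s = s" "qconj s * s = 1" "s * qe1 * qconj s = qe1"
proof -
  obtain a where "s = Quat (of_real (cosh a)) (imag * of_real (sinh a)) 0 0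
      \<or> s = - Quat (of_real (cosh a)) (imag * of_real (sinh a)) 0 0"
    using assms unfolding spin_group_def Let_def by blast
  moreover have "Quat (of_real (cosh a)) (imag * of_real (sinh a)) 0 0
      = Quat (of_real (1 * cosh a)) (imag * of_real (1 * sinh a)) 0 0"
    "- Quat (of_real (cosh a)) (imag * of_real (sinh a)) 0 0
      = Quat (of_real (- 1 * cosh a)) (imag * of_real (- 1 * sinh a)) 0 0"
    by (simp_all add: quat_eq_iff)
  moreover have "1 * 1 = (1::real)" "- 1 * - 1 = (1::real)" by simp_all
  \<comment> \<open>The sign \<open>e\<close> treats both components of the group at once.\<close>
  ultimately obtain e :: real where
    s: "s = Quat (of_real (e * cosh a)) (imag * of_real (e * sinh a)) 0 0" and e: "e * e = 1"
    by metis
  have "(e * cosh a) * (e * cosh a) - (e * sinh a) * (e * sinh a) = e * e * ((cosh a)^2 - (sinh a)^2)"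
    by (simp add: algebra_simps power2_eq_square)
  also have "\<dots> = 1" using e by (simp add: cosh_square_eq)
  finally have 1: "(e * cosh a) * (e * cosh a) - (e * sinh a) * (e * sinh a) = 1" .
  show "qhat s = s"
    by (simp add: s qhat_def lhat_def quat_eq_iff lorentz_eq_iff imag_def)
  have "Hform s s = of_real ((e * cosh a) * (e * cosh a) - (e * sinh a) * (e * sinh a))"
    by (simp add: s Hform_def lorentz_eq_iff imag_def complex_eq_iff)
  then have H: "Hform s s = 1" unfolding 1 by simp
  then show *: "qconj s * s = 1" by (simp add: qconj_mult_self qscal_def one_quat_def zero_lorentz_def)
  have "s * qe1 = qe1 * s"
    by (simp add: s qe1_def vec22_def quat_eq_iff lorentz_eq_iff sigma_def imag_def)
  moreover have "s * qconj s = 1" using H by (simp add: qconj_mult_self qscal_def one_quat_def zero_lorentz_def)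
  ultimately show "s * qe1 * qconj s = qe1" by (simp add: mult.assoc)
qed

section \<open>Odd spinor fields\<close>

lemma spinor_field_smooth:
  "spinor_field M \<phi> \<Longrightarrow> c \<in> atlas M \<Longrightarrow> smooth_on (snd c ` (fst c \<inter> fdom M i)) (\<phi> i \<circ> chart_inv c)"
  unfolding spinor_field_def smooth_fun_def by blast

context spin_frame
begin

lemma spinor_has_derivative:
  assumes "spinor_field M \<phi>"
  shows "(\<phi> i \<circ> chart_inv c has_derivative cdiff c (\<phi> i) p) (at (snd c p))"
  by (rule smooth_on_cdiff[OF spinor_field_smooth[OF assms chart]]) (use point in blast)

lemma spin_deriv_odd_part:
  assumes "spinor_field M \<phi>"
  shows "spin_deriv M c (\<lambda>i p. odd_part (\<phi> i p)) i p v = odd_part (spin_deriv M c \<phi> i p v)"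
proof -
  have "((\<lambda>p. odd_part (\<phi> i p)) \<circ> chart_inv c has_derivative (\<lambda>v. odd_part (cdiff c (\<phi> i) p v))) (at (snd c p))"
    using bounded_linear.has_derivative[OF bounded_linear_odd_part spinor_has_derivative[OF assms]]
    by (simp add: o_def)
  from cdiff_eq[OF this]
  have "cdiff c (\<lambda>p. odd_part (\<phi> i p)) p v = odd_part (cdiff c (\<phi> i) p v)" .
  then show ?thesis
    unfolding spin_deriv_def
    by (simp add: odd_part_clif_e2_e3 linear_diff[OF bounded_linear.linear[OF bounded_linear_odd_part]]
        linear_scale[OF bounded_linear.linear[OF bounded_linear_odd_part]])
qed

end

lemma spin_frameI:
  "lorentzian_spin_surface M \<Longrightarrow> c \<in> atlas M \<Longrightarrow> p \<in> fst c \<Longrightarrow> p \<in> fdom M i \<Longrightarrow> spin_frame M c i p"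
  by unfold_locales

lemma spinor_field_odd_part:
  assumes M: "lorentzian_spin_surface M" and \<phi>: "spinor_field M \<phi>"
  shows "spinor_field M (\<lambda>i p. odd_part (\<phi> i p))"
  unfolding spinor_field_def smooth_fun_def
proof (intro conjI allI ballI)
  fix i c assume c: "c \<in> atlas M"
  have "open (snd c ` (fst c \<inter> fdom M i))"
    using surface_frames[OF M, of i] by (intro open_chart_image[OF surface_atlas[OF M] c]) blast
  from smooth_on_bounded_linear[OF bounded_linear_odd_part this spinor_field_smooth[OF \<phi> c]]
  show "smooth_on (snd c ` (fst c \<inter> fdom M i)) ((\<lambda>p. odd_part (\<phi> i p)) \<circ> chart_inv c)"
    by (simp add: o_def)
next
  fix i p assume "p \<in> fdom M i"
  then show "odd_part (\<phi> i p) \<in> H0"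
    using \<phi> odd_part_H0 unfolding spinor_field_def by blast
next
  fix i j p assume p: "p \<in> fdom M i \<inter> fdom M j"
  then have "transition M j i p \<in> spin_group" using surface_transitions[OF M] by blast
  moreover have "\<phi> j p = transition M j i p * \<phi> i p" using \<phi> p unfolding spinor_field_def by blast
  ultimately show "odd_part (\<phi> j p) = transition M j i p * odd_part (\<phi> i p)"
    by (simp add: odd_part_mult[OF spin_group_facts(1)])
qed

lemma dirac_eq_odd_part:
  assumes M: "lorentzian_spin_surface M" and \<phi>: "spinor_field M \<phi>"
    and D: "dirac_eq M \<phi> (\<lambda>i p. clif qe1 (\<phi> i p))"
  shows "dirac_eq M (\<lambda>i p. odd_part (\<phi> i p)) (\<lambda>i p. clif qe1 (odd_part (\<phi> i p)))"
  unfolding dirac_eq_def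
proof (intro ballI allI)
  fix c i p assume c: "c \<in> atlas M" and p: "p \<in> fst c \<inter> fdom M i"
  then interpret spin_frame M c i p by (intro spin_frameI[OF M]) auto
  have "dirac M c \<phi> i p = clif qe1 (\<phi> i p)" using D c p unfolding dirac_eq_def by blast
  then show "dirac M c (\<lambda>i p. odd_part (\<phi> i p)) i p = clif qe1 (odd_part (\<phi> i p))"
    unfolding dirac_def spin_deriv_odd_part[OF \<phi>] by (rule dirac_odd_part)
qed

section \<open>Real coordinates and projection to \<open>R21\<close>\<close>

definition component1 :: "hac \<Rightarrow> real" where "component1 x = Re (lre (qc1 x))"
definition component2 :: "hac \<Rightarrow> real" where "component2 x = Im (lre (qc2 x))"
definition component3 :: "hac \<Rightarrow> real" where "component3 x = Re (lre (qc3 x))"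

lemma bounded_linear_components:
  "bounded_linear component1" "bounded_linear component2" "bounded_linear component3"
proof -
  have *: "\<bar>Re a\<bar> \<le> norm a" "\<bar>Im a\<bar> \<le> norm a" for a
    by (rule abs_Re_le_cmod abs_Im_le_cmod)+
  have n: "norm (lre (qc1 x)) \<le> norm x" "norm (lre (qc2 x)) \<le> norm x" "norm (lre (qc3 x)) \<le> norm x" for x :: hac
    by (simp_all add: norm_quat_def norm_lorentz_def)
  show "bounded_linear component1"
    by (rule bounded_linear_intro[where K = 1]) (simp_all add: component1_def order_trans[OF *(1) n(1)])
  show "bounded_linear component2"
    by (rule bounded_linear_intro[where K = 1]) (simp_all add: component2_def order_trans[OF *(2) n(2)])
  show "bounded_linear component3"
    by (rule bounded_linear_intro[where K = 1]) (simp_all add: component3_def order_trans[OF *(1) n(3)])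
qed

text \<open>With it, membership in \<open>R21\<close> becomes the bounded linear equation
  \<open>proj21 x = x\<close>, which survives differentiation.\<close>

definition proj21 :: "hac \<Rightarrow> hac" where
  "proj21 x = component1 x *\<^sub>R qe1 + component2 x *\<^sub>R qe2 + component3 x *\<^sub>R qe3"

lemma bounded_linear_proj21: "bounded_linear proj21"
  unfolding proj21_def
  by (intro bounded_linear_add bounded_linear_scaleR_const bounded_linear_components)

lemma vec22_eq: "vec22 x0 x1 x2 x3 = x0 *\<^sub>R qe0 + x1 *\<^sub>R qe1 + x2 *\<^sub>R qe2 + x3 *\<^sub>R qe3"
  by (simp add: qe0_def qe1_def qe2_def qe3_def vec22_def quat_eq_iff lorentz_eq_iff sigma_def imag_def
      scaleR_conv_of_real[where 'a=complex])

lemma components_vec22: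
  "component1 (vec22 x0 x1 x2 x3) = x1" "component2 (vec22 x0 x1 x2 x3) = x2"
  "component3 (vec22 x0 x1 x2 x3) = x3"
  by (simp_all add: component1_def component2_def component3_def vec22_def imag_def)

lemma R21_iff_proj21: "x \<in> R21 \<longleftrightarrow> proj21 x = x"
proof
  show "x \<in> R21 \<Longrightarrow> proj21 x = x"
    unfolding R21_eq by (auto simp: proj21_def components_vec22) (simp add: vec22_eq)
  assume "proj21 x = x"
  then have "x = vec22 0 (component1 x) (component2 x) (component3 x)"
    by (simp add: vec22_eq proj21_def)
  then show "x \<in> R21" unfolding R21_eq by blast
qed

lemma R21_diff: "x \<in> R21 \<Longrightarrow> y \<in> R21 \<Longrightarrow> x - y \<in> R21"
  unfolding R21_iff_proj21 by (simp add: linear_diff[OF bounded_linear.linear[OF bounded_linear_proj21]])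

definition component0 :: "hac \<Rightarrow> real" where "component0 x = Im (lsig (qc0 x))"

lemma bounded_linear_component0: "bounded_linear component0"
proof (rule bounded_linear_intro[where K = 1])
  fix x :: hac
  have "\<bar>Im (lsig (qc0 x))\<bar> \<le> cmod (lsig (qc0 x))" by (rule abs_Im_le_cmod)
  also have "\<dots> \<le> norm x" by (simp add: norm_quat_def norm_lorentz_def)
  finally show "norm (component0 x) \<le> norm x * 1" by (simp add: component0_def)
qed (simp_all add: component0_def)

lemma component0_vec22: "component0 (vec22 x0 x1 x2 x3) = x0"
  by (simp add: component0_def vec22_def sigma_def imag_def)

lemma vec22_diff: "vec22 a b d e - vec22 a' b' d' e' = vec22 (a - a') (b - b') (d - d') (e - e')"
  by (simp add: vec22_eq algebra_simps)

lemma R22_diff: "x \<in> R22 \<Longrightarrow> y \<in> R22 \<Longrightarrow> x - y \<in> R22"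
  unfolding R22_def by (clarsimp simp: vec22_diff) blast

lemma R21_iff_component0: "x \<in> R21 \<longleftrightarrow> x \<in> R22 \<and> component0 x = 0"
  unfolding R21_eq R22_def by (auto simp: component0_vec22) (metis component0_vec22)

lemma qe_in_R21: "qe1 \<in> R21" "qe2 \<in> R21" "qe3 \<in> R21"
  unfolding R21_eq qe1_def qe2_def qe3_def by blast+

lemma tcoord_vec22: "tcoord M i c p v = vec22 0 0 (- metric M c p v (frame2 M i c p)) (metric M c p v (frame3 M i c p))"
  by (simp add: tcoord_def vec22_eq)

lemma tcoord_R21: "tcoord M i c p v \<in> R21"
  unfolding tcoord_vec22 R21_eq by blast

lemma qconj_H0: "z \<in> H0 \<Longrightarrow> qconj z \<in> H0"
proof -
  have "- lcomplex p = lcomplex (- p)" for p by (simp add: lcomplex_def lorentz_eq_iff)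
  then have "qconj (Quat (lcomplex p0) (imag * lcomplex p1) (lcomplex p2) (imag * lcomplex p3))
    = Quat (lcomplex p0) (imag * lcomplex (- p1)) (lcomplex (- p2)) (imag * lcomplex (- p3))" for p0 p1 p2 p3
    by (simp add: qconj_def flip: mult_minus_right)
  then show "z \<in> H0 \<Longrightarrow> qconj z \<in> H0" unfolding H0_def by blast
qed

section \<open>The one-form of an odd spinor in a single frame\<close>

lemma Hform_bilinear:
  "Hform (x + x') y = Hform x y + Hform x' y" "Hform (x - x') y = Hform x y - Hform x' y"
  "Hform (r *\<^sub>R x) y = of_real r * Hform x y" "Hform x y = Hform y x"
  by (simp_all add: Hform_def lorentz_eq_iff algebra_simps scaleR_conv_of_real[where 'a=complex])

text \<open>Oddness is assumed on the whole frame domain because it gets differentiated, whereas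
  norm and Dirac equation enter at the point \<open>p\<close>. Below, \<open>E qe2\<close> and
  \<open>E qe3\<close> are the images of the tangent frame, \<open>E qe1\<close> is the normal, and
  \<open>y\<close> is the covariant derivative of the spinor.\<close>

locale odd_spinor_frame = spin_frame M c i p
  for M :: "('m::topological_space, 'i) spin_surface" and c i p +
  fixes \<psi> :: "('m, 'i) spinor"
  assumes field: "spinor_field M \<psi>"
    and odd: "\<And>q. q \<in> fdom M i \<Longrightarrow> qhat (\<psi> i q) = - \<psi> i q"
    and unit: "Hform (\<psi> i p) (\<psi> i p) = 1"
    and dirac: "dirac M c \<psi> i p = clif qe1 (\<psi> i p)"
begin

abbreviation E where "E x q \<equiv> qconj (\<psi> i q) * x * \<psi> i q"
abbreviation \<xi> where "\<xi> w q \<equiv> pairing (clif (tcoord M i c q w) (\<psi> i q)) (\<psi> i q)"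
abbreviation y where "y v \<equiv> spin_deriv M c \<psi> i p v"

lemma in_H0: "\<psi> i p \<in> H0"
  using field point unfolding spinor_field_def by blast

lemma \<xi>_conj: "q \<in> fdom M i \<Longrightarrow> \<xi> w q = E (tcoord M i c q w) q"
  by (rule pairing_clif_odd[OF odd])

lemma \<xi>_expand: "q \<in> fdom M i \<Longrightarrow> \<xi> w q = - \<theta>2 w q *\<^sub>R E qe2 q + \<theta>3 w q *\<^sub>R E qe3 q"
  by (subst \<xi>_conj) (simp_all add: tcoord_def algebra_simps)

lemma E_has_derivative:
  "(E x \<circ> chart_inv c has_derivative (\<lambda>v. frame_deriv (\<psi> i p) x (cdiff c (\<psi> i) p v))) (at (snd c p))"
proof -
  note d = spinor_has_derivative[OF field]
  have "((\<lambda>x. qconj ((\<psi> i \<circ> chart_inv c) x)) has_derivative (\<lambda>v. qconj (cdiff c (\<psi> i) p v))) (at (snd c p))"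
    by (rule bounded_linear.has_derivative[OF bounded_linear_qconj d])
  from has_derivative_mult[OF has_derivative_mult[OF this has_derivative_const[of x]] d]
  show ?thesis
    by (simp add: o_def chart_inv_point frame_deriv_def add.commute)
qed

lemma cdiff_spinor: "cdiff c (\<psi> i) p v = y v + (\<omega> v / 2) *\<^sub>R clif qe2 (clif qe3 (\<psi> i p))"
  by (simp add: spin_deriv_def \<omega>_def)

lemma E2_has_derivative:
  "(E qe2 \<circ> chart_inv c has_derivative (\<lambda>v. frame_deriv (\<psi> i p) qe2 (y v) + \<omega> v *\<^sub>R E qe3 p)) (at (snd c p))"
  using E_has_derivative[of qe2] by (simp add: cdiff_spinor frame_deriv_linear frame_deriv_rotation)

lemma E3_has_derivative:
  "(E qe3 \<circ> chart_inv c has_derivative (\<lambda>v. frame_deriv (\<psi> i p) qe3 (y v) + \<omega> v *\<^sub>R E qe2 p)) (at (snd c p))"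
  using E_has_derivative[of qe3] by (simp add: cdiff_spinor frame_deriv_linear frame_deriv_rotation)

lemma eventually_region: "\<forall>\<^sub>F q in nhds p. q \<in> fst c \<and> q \<in> fdom M i"
  using eventually_nhds_in_open[OF open_chart_domain[OF atlas_smooth chart] point(1)]
    eventually_nhds_in_open[OF open_fdom point(2)] by eventually_elim blast

text \<open>The covariant derivative of \<open>\<xi>\<close>: the terms in \<open>\<omega>\<close> coming from the coframe and from the spinor
  cancel.\<close>

definition hessian :: "real^2 \<Rightarrow> real^2 \<Rightarrow> hac" where
  "hessian v w = - g w e2 *\<^sub>R frame_deriv (\<psi> i p) qe2 (y v) + g w e3 *\<^sub>R frame_deriv (\<psi> i p) qe3 (y v)"

lemma \<xi>_has_derivative:
  "(\<xi> w \<circ> chart_inv c has_derivative (\<lambda>v. \<xi> (\<Gamma> v w) p + hessian v w)) (at (snd c p))"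
proof -
  have d: "((\<lambda>x. - (\<theta>2 w \<circ> chart_inv c) x *\<^sub>R (E qe2 \<circ> chart_inv c) x
      + (\<theta>3 w \<circ> chart_inv c) x *\<^sub>R (E qe3 \<circ> chart_inv c) x) has_derivative
    (\<lambda>v. (- g w e2 *\<^sub>R (frame_deriv (\<psi> i p) qe2 (y v) + \<omega> v *\<^sub>R E qe3 p)
        + - (g (\<Gamma> v w) e2 + \<omega> v * g w e3) *\<^sub>R E qe2 p)
      + (g w e3 *\<^sub>R (frame_deriv (\<psi> i p) qe3 (y v) + \<omega> v *\<^sub>R E qe2 p)
        + (g (\<Gamma> v w) e3 + \<omega> v * g w e2) *\<^sub>R E qe3 p))) (at (snd c p))"
    using has_derivative_add[OF
        has_derivative_scaleR[OF has_derivative_minus[OF coframe_has_derivative(1)] E2_has_derivative]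
        has_derivative_scaleR[OF coframe_has_derivative(2) E3_has_derivative]]
    by (simp add: chart_inv_point)
  have "\<forall>\<^sub>F q in nhds p. - \<theta>2 w q *\<^sub>R E qe2 q + \<theta>3 w q *\<^sub>R E qe3 q = \<xi> w q"
    using eventually_region by eventually_elim (simp add: \<xi>_expand)
  then have "\<forall>\<^sub>F x in nhds (snd c p). - (\<theta>2 w \<circ> chart_inv c) x *\<^sub>R (E qe2 \<circ> chart_inv c) x
      + (\<theta>3 w \<circ> chart_inv c) x *\<^sub>R (E qe3 \<circ> chart_inv c) x = (\<xi> w \<circ> chart_inv c) x"
    unfolding eventually_nhds_chart[OF atlas_smooth chart point(1)] by simp
  from has_derivative_cong_nhds[OF this d] show ?thesis
    by (rule has_derivative_eq_rhs)
      (simp add: fun_eq_iff \<xi>_expand[OF point(2)] hessian_def algebra_simps)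
qed

text \<open>Oddness is a constant linear condition, so it passes to the derivative; the connection
  term respects it since \<open>i I\<close> is fixed by \<open>qhat\<close>.\<close>

lemma spinor_deriv_odd: "qhat (y v) = - y v"
proof -
  have "((\<lambda>x. qhat ((\<psi> i \<circ> chart_inv c) x)) has_derivative (\<lambda>v. qhat (cdiff c (\<psi> i) p v))) (at (snd c p))"
    by (rule bounded_linear.has_derivative[OF bounded_linear_qhat spinor_has_derivative[OF field]])
  moreover have "\<forall>\<^sub>F q in nhds p. qhat (\<psi> i q) = - \<psi> i q"
    using eventually_region by eventually_elim (simp add: odd)
  then have "\<forall>\<^sub>F x in nhds (snd c p). qhat ((\<psi> i \<circ> chart_inv c) x) = - (\<psi> i \<circ> chart_inv c) x"
    unfolding eventually_nhds_chart[OF atlas_smooth chart point(1)] by simp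
  ultimately have "((\<lambda>x. - (\<psi> i \<circ> chart_inv c) x) has_derivative (\<lambda>v. qhat (cdiff c (\<psi> i) p v))) (at (snd c p))"
    by (rule has_derivative_cong_nhds[rotated])
  from has_derivative_unique[OF this has_derivative_minus[OF spinor_has_derivative[OF field]]]
  have "qhat (cdiff c (\<psi> i) p v) = - cdiff c (\<psi> i) p v" by (rule fun_cong)
  moreover have "qhat (clif qe2 (clif qe3 (\<psi> i p))) = - clif qe2 (clif qe3 (\<psi> i p))"
    unfolding clif_e2_e3 qhat_mult odd[OF point(2)]
    by (simp add: qscal_def imag_def qI_def qhat_def lhat_def quat_eq_iff lorentz_eq_iff)
  ultimately show ?thesis
    unfolding spin_deriv_def
    by (simp add: linear_diff[OF bounded_linear.linear[OF bounded_linear_qhat]]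
        linear_scale[OF bounded_linear.linear[OF bounded_linear_qhat]])
qed

lemma dirac_frame: "- clif qe2 (y e2) + clif qe3 (y e3) = clif qe1 (\<psi> i p)"
  using dirac unfolding dirac_def .

lemma spinor_deriv_expand: "y v = - g v e2 *\<^sub>R y e2 + g v e3 *\<^sub>R y e3"
proof -
  have l: "linear y"
    unfolding spin_deriv_def \<omega>_def[symmetric]
    using has_derivative_linear[OF spinor_has_derivative[OF field]] linear_\<omega>
    by (intro linear_compose_sub) (auto intro!: linearI simp: linear_add linear_scale algebra_simps add_divide_distrib)
  have "y v = y (- g v e2 *\<^sub>R e2 + g v e3 *\<^sub>R e3)" by (rule arg_cong[OF frame_expand[OF point]])
  also have "\<dots> = - g v e2 *\<^sub>R y e2 + g v e3 *\<^sub>R y e3"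
    by (simp only: linear_add[OF l] linear_scale[OF l])
  finally show ?thesis .
qed

lemma hessian_symmetric: "hessian v w = hessian w v"
proof -
  note c = frame_deriv_closed[OF odd[OF point(2)] spinor_deriv_odd spinor_deriv_odd dirac_frame]
  \<comment> \<open>Expanding \<open>y v\<close> in the frame gives four terms; closedness merges
    the two mixed ones, and the result is visibly symmetric in \<open>v\<close> and
    \<open>w\<close>.\<close>
  have "hessian v w = (g w e2 * g v e2) *\<^sub>R frame_deriv (\<psi> i p) qe2 (y e2)
    - (g w e2 * g v e3 + g w e3 * g v e2) *\<^sub>R frame_deriv (\<psi> i p) qe2 (y e3)
    + (g w e3 * g v e3) *\<^sub>R frame_deriv (\<psi> i p) qe3 (y e3)" for v w
    unfolding hessian_def
    by (subst (1 2) spinor_deriv_expand) (simp add: frame_deriv_linear frame_deriv_diff c algebra_simps)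
  from this[of v w] this[of w v] show ?thesis by (simp add: ac_simps)
qed

lemma hessian_trace: "- hessian e2 e2 + hessian e3 e3 = 2 *\<^sub>R E qe1 p"
  using frame_deriv_trace[OF odd[OF point(2)] spinor_deriv_odd spinor_deriv_odd dirac_frame]
  by (simp add: hessian_def frame_orthonormal[OF point])

lemma E_R21: "x \<in> R21 \<Longrightarrow> E x p \<in> R21"
  by (rule R21_conjugate[OF in_H0 odd[OF point(2)]])

lemma \<xi>_R21:
  assumes "q \<in> fdom M i"
  shows "\<xi> w q \<in> R21"
proof -
  have "\<psi> i q \<in> H0" using field assms unfolding spinor_field_def by blast
  then show ?thesis
    unfolding \<xi>_conj[OF assms] by (rule R21_conjugate[OF _ odd[OF assms] tcoord_R21])
qed

lemma linear_\<xi>: "linear (\<lambda>v. \<xi> v p)"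
  unfolding \<xi>_expand[OF point(2)]
  by (rule linearI) (simp_all add: linear_add[OF metric_linear(1)] linear_scale[OF metric_linear(1)] algebra_simps)

lemma \<xi>_metric: "Hform (\<xi> v p) (\<xi> w p) = of_real (g v w)"
proof -
  have "g v w = g (- g v e2 *\<^sub>R e2 + g v e3 *\<^sub>R e3) w"
    by (rule arg_cong[where f = "\<lambda>v. g v w", OF frame_expand[OF point]])
  also have "\<dots> = - g v e2 * g w e2 + g v e3 * g w e3"
    by (simp only: linear_add[OF metric_linear(1)] linear_scale[OF metric_linear(1)]
        metric_symmetric[OF point(1), of e2 w] metric_symmetric[OF point(1), of e3 w] real_scaleR_def)
  finally show ?thesis
    unfolding \<xi>_conj[OF point(2)] unfolding Hform_conjugate[OF unit] tcoord_vec22 Hform_vec22 by simp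
qed

lemma normal_unit: "Hform (E qe1 p) (E qe1 p) = 1"
  unfolding Hform_conjugate[OF unit] qe1_def Hform_vec22 by simp

lemma normal_tangent: "Hform (E qe1 p) (\<xi> v p) = 0"
  unfolding \<xi>_conj[OF point(2)] unfolding Hform_conjugate[OF unit] qe1_def tcoord_vec22 Hform_vec22 by simp

lemma \<xi>_frame: "\<xi> e2 p = E qe2 p" "\<xi> e3 p = E qe3 p"
  unfolding \<xi>_expand[OF point(2)] by (simp_all add: frame_orthonormal[OF point])

lemma \<xi>_inj: "\<xi> v p = \<xi> w p \<Longrightarrow> v = w"
proof (rule metric_nondegenerate)
  fix u assume "\<xi> v p = \<xi> w p"
  then have "of_real (g v u) = (of_real (g w u) :: complex lorentz)" by (simp flip: \<xi>_metric)
  then show "g v u = g w u" by (simp only: of_real_eq_iff)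
qed

text \<open>The inverse rotation is conjugation by \<open>qconj\<close> of the spinor, which is
  again odd and in \<open>H0\<close>, so the coordinates of \<open>x\<close> in the moving frame are
  those of a rotated vector in \<open>R21\<close>.\<close>

lemma R21_decomposition:
  assumes "x \<in> R21"
  shows "\<exists>a u. x = a *\<^sub>R E qe1 p + \<xi> u p"
proof -
  have z: "qconj (\<psi> i p) * \<psi> i p = 1" "\<psi> i p * qconj (\<psi> i p) = 1"
    using unit by (simp_all add: qconj_mult_self qscal_def one_quat_def zero_lorentz_def)
  have "qhat (qconj (\<psi> i p)) = qconj (qhat (\<psi> i p))"
    by (simp add: qhat_def qconj_def lhat_def quat_eq_iff lorentz_eq_iff)
  then have "qhat (qconj (\<psi> i p)) = - qconj (\<psi> i p)" by (simp add: odd[OF point(2)])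
  from R21_conjugate[OF qconj_H0[OF in_H0] this assms]
  obtain a b d where "\<psi> i p * x * qconj (\<psi> i p) = vec22 0 a b d" unfolding R21_eq by auto
  then have "qconj (\<psi> i p) * (\<psi> i p * x * qconj (\<psi> i p)) * \<psi> i p = E (vec22 0 a b d) p" by simp
  moreover have "qconj (\<psi> i p) * (\<psi> i p * x * qconj (\<psi> i p)) * \<psi> i p
      = (qconj (\<psi> i p) * \<psi> i p) * x * (qconj (\<psi> i p) * \<psi> i p)"
    by (simp only: mult.assoc)
  ultimately have "x = E (vec22 0 a b d) p" by (simp add: z)
  also have "\<dots> = a *\<^sub>R E qe1 p + \<xi> (b *\<^sub>R e2 + d *\<^sub>R e3) p"
    by (simp add: vec22_eq linear_add[OF linear_\<xi>] linear_scale[OF linear_\<xi>] \<xi>_frame algebra_simps)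
  finally show ?thesis by blast
qed

text \<open>\<open>\<xi> w\<close> takes values in the fixed space of a bounded linear map, and so
  does its derivative.\<close>

lemma \<xi>_deriv_R21: "\<xi> (\<Gamma> v w) p + hessian v w \<in> R21"
proof -
  have "((\<lambda>x. proj21 ((\<xi> w \<circ> chart_inv c) x)) has_derivative (\<lambda>v. proj21 (\<xi> (\<Gamma> v w) p + hessian v w))) (at (snd c p))"
    by (rule bounded_linear.has_derivative[OF bounded_linear_proj21 \<xi>_has_derivative])
  moreover have "\<forall>\<^sub>F q in nhds p. proj21 (\<xi> w q) = \<xi> w q"
    using eventually_region by eventually_elim (simp add: \<xi>_R21 flip: R21_iff_proj21)
  then have "\<forall>\<^sub>F x in nhds (snd c p). proj21 ((\<xi> w \<circ> chart_inv c) x) = (\<xi> w \<circ> chart_inv c) x"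
    unfolding eventually_nhds_chart[OF atlas_smooth chart point(1)] by simp
  ultimately have "(\<xi> w \<circ> chart_inv c has_derivative (\<lambda>v. proj21 (\<xi> (\<Gamma> v w) p + hessian v w))) (at (snd c p))"
    by (rule has_derivative_cong_nhds[rotated])
  from has_derivative_unique[OF this \<xi>_has_derivative]
  show ?thesis unfolding R21_iff_proj21 by (rule fun_cong)
qed

lemma hessian_R21: "hessian v w \<in> R21"
  using R21_diff[OF \<xi>_deriv_R21[of v w] \<xi>_R21[OF point(2), of "\<Gamma> v w"]] by simp

lemma E_smooth: "smooth_on (snd c ` (fst c \<inter> fdom M i)) (E x \<circ> chart_inv c)"
proof -
  note s = spinor_field_smooth[OF field chart, of i]
  have "smooth_on (snd c ` (fst c \<inter> fdom M i)) (\<lambda>t. qconj ((\<psi> i \<circ> chart_inv c) t) * x * (\<psi> i \<circ> chart_inv c) t)"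
    by (intro smooth_on_bilinear[OF bounded_bilinear_mult open_region]
        smooth_on_bounded_linear[OF bounded_linear_qconj open_region] smooth_on_const s)
  then show ?thesis by (simp add: o_def)
qed

lemma metric_field_smooth:
  assumes "smooth_on (snd c ` (fst c \<inter> fdom M i)) (u \<circ> chart_inv c)"
  shows "smooth_on (snd c ` (fst c \<inter> fdom M i)) ((\<lambda>q. metric M c q w (u q)) \<circ> chart_inv c)"
proof (rule smooth_on_cong[OF open_region])
  show "smooth_on (snd c ` (fst c \<inter> fdom M i))
      (\<lambda>t. \<Sum>b\<in>Basis. ((\<lambda>q. metric M c q w b) \<circ> chart_inv c) t * ((u \<circ> chart_inv c) t \<bullet> b))"
    by (intro smooth_on_sum smooth_on_bilinear[OF bounded_bilinear_mult] open_region
        smooth_on_subset[OF metric_smooth] smooth_on_bounded_linear[OF bounded_linear_inner_left] assms) auto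
  fix x assume "x \<in> snd c ` (fst c \<inter> fdom M i)"
  then have "chart_inv c x \<in> fst c" using chart_inv_snd[OF atlas_smooth chart] by auto
  then have "linear (metric M c (chart_inv c x) w)" using metric_bilinear by (auto simp: bilinear_def)
  from linear_eq_sum_Basis[OF this, of "u (chart_inv c x)"]
  show "(\<Sum>b\<in>Basis. ((\<lambda>q. metric M c q w b) \<circ> chart_inv c) x * ((u \<circ> chart_inv c) x \<bullet> b))
      = ((\<lambda>q. metric M c q w (u q)) \<circ> chart_inv c) x" by simp
qed

lemma \<xi>_smooth: "smooth_on (snd c ` (fst c \<inter> fdom M i)) (\<xi> w \<circ> chart_inv c)"
proof (rule smooth_on_cong[OF open_region])
  show "smooth_on (snd c ` (fst c \<inter> fdom M i)) (\<lambda>t. (- 1) *\<^sub>R ((\<theta>2 w \<circ> chart_inv c) t *\<^sub>R (E qe2 \<circ> chart_inv c) t)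
      + (\<theta>3 w \<circ> chart_inv c) t *\<^sub>R (E qe3 \<circ> chart_inv c) t)"
    by (intro smooth_on_add open_region smooth_on_bounded_linear[OF bounded_linear_scaleR_right]
        smooth_on_bilinear[OF bounded_bilinear_scaleR] E_smooth metric_field_smooth frame_smooth)
  fix x assume "x \<in> snd c ` (fst c \<inter> fdom M i)"
  then have "chart_inv c x \<in> fdom M i" using chart_inv_snd[OF atlas_smooth chart] by auto
  from \<xi>_expand[OF this, of w]
  show "(- 1) *\<^sub>R ((\<theta>2 w \<circ> chart_inv c) x *\<^sub>R (E qe2 \<circ> chart_inv c) x)
      + (\<theta>3 w \<circ> chart_inv c) x *\<^sub>R (E qe3 \<circ> chart_inv c) x = (\<xi> w \<circ> chart_inv c) x" by simp
qed

text \<open>The Christoffel term in the derivative of \<open>\<xi>\<close> is tangent, so the second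
  fundamental form is the normal part of \<open>hessian\<close>, whose trace is known.\<close>

lemma mean_curvature_primitive:
  assumes F: "\<And>q. q \<in> fst c \<Longrightarrow> q \<in> fdom M i \<Longrightarrow> (F \<circ> chart_inv c has_derivative (\<lambda>v. \<xi> v q)) (at (snd c q))"
  shows "mean_curvature_vector M c i F p = E qe1 p"
proof -
  have cF: "cdiff c F p v = \<xi> v p" for v by (rule cdiff_eq[OF F[OF point]])
  have "cdiff c (\<lambda>q. cdiff c F q w) p v = \<xi> (\<Gamma> v w) p + hessian v w" for v w
  proof (rule cdiff_eq)
    have "\<forall>\<^sub>F q in nhds p. \<xi> w q = cdiff c F q w"
      using eventually_region by eventually_elim (simp add: cdiff_eq[OF F])
    then have "\<forall>\<^sub>F x in nhds (snd c p). (\<xi> w \<circ> chart_inv c) x = ((\<lambda>q. cdiff c F q w) \<circ> chart_inv c) x"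
      unfolding eventually_nhds_chart[OF atlas_smooth chart point(1)] by simp
    from has_derivative_cong_nhds[OF this \<xi>_has_derivative]
    show "((\<lambda>q. cdiff c F q w) \<circ> chart_inv c has_derivative (\<lambda>v. \<xi> (\<Gamma> v w) p + hessian v w)) (at (snd c p))" .
  qed
  \<comment> \<open>For uniqueness: the difference of two candidates is tangent and orthogonal to
    all tangent vectors, hence zero by nondegeneracy.\<close>
  moreover have normal: "normal_part c F p (a *\<^sub>R E qe1 p + \<xi> u p) = a *\<^sub>R E qe1 p" for a u
    unfolding normal_part_def cF
  proof (rule the_equality)
    show "(\<forall>v. Hform (a *\<^sub>R E qe1 p) (\<xi> v p) = 0) \<and> (\<exists>v. a *\<^sub>R E qe1 p + \<xi> u p = a *\<^sub>R E qe1 p + \<xi> v p)"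
      by (auto simp: Hform_bilinear(3) normal_tangent)
    fix n assume n: "(\<forall>v. Hform n (\<xi> v p) = 0) \<and> (\<exists>v. a *\<^sub>R E qe1 p + \<xi> u p = n + \<xi> v p)"
    then obtain v where v: "a *\<^sub>R E qe1 p + \<xi> u p = n + \<xi> v p" by blast
    then have d: "\<xi> (u - v) p = n - a *\<^sub>R E qe1 p" by (simp add: linear_diff[OF linear_\<xi>] algebra_simps)
    have "Hform (\<xi> (u - v) p) (\<xi> t p) = 0" for t
      unfolding d Hform_bilinear(2,3) using n normal_tangent by simp
    then have "g (u - v) t = g 0 t" for t
      unfolding \<xi>_metric by (simp add: linear_0[OF metric_linear(1)])
    then have "u - v = 0" by (rule metric_nondegenerate)
    then show "n = a *\<^sub>R E qe1 p" using v by simp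
  qed
  moreover obtain a2 u2 a3 u3 where h: "hessian e2 e2 = a2 *\<^sub>R E qe1 p + \<xi> u2 p"
    "hessian e3 e3 = a3 *\<^sub>R E qe1 p + \<xi> u3 p"
    using R21_decomposition[OF hessian_R21[of e2 e2]] R21_decomposition[OF hessian_R21[of e3 e3]] by blast
  ultimately have s: "second_form c F p e2 e2 = a2 *\<^sub>R E qe1 p" "second_form c F p e3 e3 = a3 *\<^sub>R E qe1 p"
    using normal[of a2 "\<Gamma> e2 e2 + u2"] normal[of a3 "\<Gamma> e3 e3 + u3"]
    by (simp_all add: second_form_def linear_add[OF linear_\<xi>] ac_simps)
  \<comment> \<open>Pairing the trace identity with the unit normal removes the tangential parts and
    leaves \<open>a3 - a2 = 2\<close>; the factor 1/2 in the mean curvature vector turns this into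
    1.\<close>
  have "(a3 - a2) *\<^sub>R E qe1 p + (\<xi> u3 p - \<xi> u2 p) = 2 *\<^sub>R E qe1 p"
    using hessian_trace unfolding h by (simp add: algebra_simps)
  then have "Hform ((a3 - a2) *\<^sub>R E qe1 p + (\<xi> u3 p - \<xi> u2 p)) (E qe1 p) = Hform (2 *\<^sub>R E qe1 p) (E qe1 p)"
    by simp
  then have "of_real (a3 - a2) = (of_real 2 :: complex lorentz)"
    unfolding Hform_bilinear(1-3) normal_unit Hform_bilinear(4)[of "\<xi> _ p"] normal_tangent by simp
  then have "a3 - a2 = 2" by (simp only: of_real_eq_iff)
  have "mean_curvature_vector M c i F p = ((a3 - a2) / 2) *\<^sub>R E qe1 p"
    unfolding mean_curvature_vector_def s by (simp add: algebra_simps diff_divide_distrib)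
  then show ?thesis using \<open>a3 - a2 = 2\<close> by simp
qed

end

section \<open>The induced immersion\<close>

locale odd_spinor =
  fixes M :: "('m::topological_space, 'i) spin_surface" and \<psi> :: "('m, 'i) spinor"
  assumes surface: "lorentzian_spin_surface M" and field: "spinor_field M \<psi>"
    and odd: "\<And>i q. q \<in> fdom M i \<Longrightarrow> qhat (\<psi> i q) = - \<psi> i q"
    and unit: "unit_spinor M \<psi>"
    and dirac: "dirac_eq M \<psi> (\<lambda>i p. clif qe1 (\<psi> i p))"
begin

lemma frame: "c \<in> atlas M \<Longrightarrow> p \<in> fst c \<Longrightarrow> p \<in> fdom M i \<Longrightarrow> odd_spinor_frame M c i p \<psi>"
  using surface field odd unit dirac
  by unfold_locales (auto simp: unit_spinor_def dirac_eq_def)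

text \<open>An arbitrary choice of frame at each point, with no regularity in \<open>p\<close>. It
  serves to define global objects, whose independence of the frame is shown through
  \<open>conjugate_change\<close>.\<close>

definition frame_index :: "'m \<Rightarrow> 'i" where "frame_index p = (SOME i. p \<in> fdom M i)"

lemma frame_index: "p \<in> fdom M (frame_index p)"
proof -
  have "\<exists>i. p \<in> fdom M i" using surface_cover[OF surface] by blast
  then show ?thesis unfolding frame_index_def by (rule someI_ex)
qed

text \<open>The transition element is fixed by \<open>qhat\<close> and inverted by
  \<open>qconj\<close>, so its occurrences in the vector cancel those in the spinors.\<close>

lemma conjugate_change:
  assumes p: "p \<in> fdom M i" "p \<in> fdom M j"
    and x: "x' = transition M j i p * x * qconj (qhat (transition M j i p))"
  shows "pairing (clif x' (\<psi> j p)) (\<psi> j p) = pairing (clif x (\<psi> i p)) (\<psi> i p)"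
proof -
  let ?s = "transition M j i p"
  have s: "qhat ?s = ?s" "qconj ?s * ?s = 1"
    using surface_transitions[OF surface] p spin_group_facts by blast+
  have \<psi>: "\<psi> j p = ?s * \<psi> i p" using field p unfolding spinor_field_def by blast
  have "qconj (\<psi> j p) * x' * \<psi> j p = qconj (\<psi> i p) * (qconj ?s * ?s) * x * (qconj ?s * ?s) * \<psi> i p"
    by (simp only: \<psi> x s(1) qconj_simps(4) mult.assoc)
  then show ?thesis
    by (simp add: s(2) pairing_clif_odd[OF odd[OF p(1)]] pairing_clif_odd[OF odd[OF p(2)]])
qed

definition \<Xi> :: "'m chart \<Rightarrow> 'm \<Rightarrow> real^2 \<Rightarrow> hac" where
  "\<Xi> c p v = pairing (clif (tcoord M (frame_index p) c p v) (\<psi> (frame_index p) p)) (\<psi> (frame_index p) p)"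

definition normal :: "'m \<Rightarrow> hac" where
  "normal p = pairing (clif qe1 (\<psi> (frame_index p) p)) (\<psi> (frame_index p) p)"

lemma \<Xi>_eq:
  assumes "c \<in> atlas M" "p \<in> fst c" "p \<in> fdom M i"
  shows "\<Xi> c p v = pairing (clif (tcoord M i c p v) (\<psi> i p)) (\<psi> i p)"
  unfolding \<Xi>_def
  by (rule conjugate_change[OF assms(3) frame_index])
    (use surface_transitions[OF surface] assms frame_index in blast)

lemma normal_eq:
  assumes "p \<in> fdom M i"
  shows "normal p = pairing (clif qe1 (\<psi> i p)) (\<psi> i p)"
proof -
  have "transition M (frame_index p) i p \<in> spin_group"
    using surface_transitions[OF surface] assms frame_index by blast
  then show ?thesis
    unfolding normal_def
    by (intro conjugate_change[OF assms frame_index]) (simp add: spin_group_facts(1,3))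
qed

lemma \<Xi>_has_derivative:
  assumes c: "c \<in> atlas M" "p \<in> fst c"
  shows "((\<lambda>q. \<Xi> c q w) \<circ> chart_inv c has_derivative
    (\<lambda>v. \<Xi> c p (christoffel M c p v w) + odd_spinor_frame.hessian M c (frame_index p) p \<psi> v w)) (at (snd c p))"
proof -
  interpret odd_spinor_frame M c "frame_index p" p \<psi> by (rule frame[OF c frame_index])
  \<comment> \<open>\<open>frame_index\<close> may jump between nearby points, so the frame chosen
    at \<open>p\<close> is kept around \<open>p\<close>.\<close>
  have "\<forall>\<^sub>F q in nhds p. \<xi> w q = \<Xi> c q w"
    using eventually_region by eventually_elim (rule \<Xi>_eq[OF c(1), symmetric], simp_all)
  then have "\<forall>\<^sub>F x in nhds (snd c p). (\<xi> w \<circ> chart_inv c) x = ((\<lambda>q. \<Xi> c q w) \<circ> chart_inv c) x"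
    unfolding eventually_nhds_chart[OF atlas_smooth chart point(1)] by simp
  from has_derivative_cong_nhds[OF this \<xi>_has_derivative] show ?thesis
    unfolding \<Xi>_eq[OF c frame_index] .
qed

lemma \<Xi>_closed:
  assumes c: "c \<in> atlas M" "p \<in> fst c"
  shows "cdiff c (\<lambda>q. \<Xi> c q v) p w = cdiff c (\<lambda>q. \<Xi> c q w) p v"
proof -
  interpret odd_spinor_frame M c "frame_index p" p \<psi> by (rule frame[OF c frame_index])
  show ?thesis
    unfolding cdiff_eq[OF \<Xi>_has_derivative[OF c]]
    by (simp add: christoffel_symmetric[of v w] hessian_symmetric[of v w])
qed

lemma \<Xi>_linear: "c \<in> atlas M \<Longrightarrow> p \<in> fst c \<Longrightarrow> linear (\<Xi> c p)"
  using odd_spinor_frame.linear_\<xi>[OF frame[OF _ _ frame_index]] unfolding \<Xi>_def .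

lemma \<Xi>_R21: "c \<in> atlas M \<Longrightarrow> p \<in> fst c \<Longrightarrow> \<Xi> c p v \<in> R21"
  using odd_spinor_frame.\<xi>_R21[OF frame[OF _ _ frame_index] frame_index] unfolding \<Xi>_def .

lemma smooth_on_frames:
  assumes c: "c \<in> atlas M"
    and f: "\<And>i. smooth_on (snd c ` (fst c \<inter> fdom M i)) (f \<circ> chart_inv c)"
  shows "smooth_on (snd c ` fst c) (f \<circ> chart_inv c)"
proof (rule smooth_on_local)
  fix x assume "x \<in> snd c ` fst c"
  then obtain p where p: "p \<in> fst c" "x = snd c p" by blast
  interpret odd_spinor_frame M c "frame_index p" p \<psi> by (rule frame[OF c p(1) frame_index])
  show "\<exists>T. open T \<and> x \<in> T \<and> smooth_on T (f \<circ> chart_inv c)"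
    using open_region f[of "frame_index p"] point p(2) by blast
qed

lemma smooth_on_frame_cong:
  assumes c: "c \<in> atlas M" and s: "smooth_on (snd c ` (fst c \<inter> fdom M i)) (f \<circ> chart_inv c)"
    and e: "\<And>q. q \<in> fst c \<Longrightarrow> q \<in> fdom M i \<Longrightarrow> f q = h q"
  shows "smooth_on (snd c ` (fst c \<inter> fdom M i)) (h \<circ> chart_inv c)"
proof (rule smooth_on_cong[OF _ _ s])
  show "open (snd c ` (fst c \<inter> fdom M i))"
    using surface_frames[OF surface, of i] by (intro open_chart_image[OF surface_atlas[OF surface] c]) blast
  show "(f \<circ> chart_inv c) x = (h \<circ> chart_inv c) x" if "x \<in> snd c ` (fst c \<inter> fdom M i)" for x
    using that e chart_inv_snd[OF surface_atlas[OF surface] c] by auto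
qed

lemma \<Xi>_smooth:
  assumes c: "c \<in> atlas M"
  shows "smooth_on (snd c ` fst c) ((\<lambda>q. \<Xi> c q v) \<circ> chart_inv c)"
proof (rule smooth_on_frames[OF c])
  fix i
  show "smooth_on (snd c ` (fst c \<inter> fdom M i)) ((\<lambda>q. \<Xi> c q v) \<circ> chart_inv c)"
  proof (cases "fst c \<inter> fdom M i = {}")
    case False
    then obtain p where "p \<in> fst c" "p \<in> fdom M i" by blast
    then interpret odd_spinor_frame M c i p \<psi> by (rule frame[OF c])
    show ?thesis by (rule smooth_on_frame_cong[OF c \<xi>_smooth \<Xi>_eq[OF c, symmetric]])
  qed (simp add: smooth_on_empty)
qed

lemma normal_smooth: "smooth_fun (atlas M) UNIV normal"
  unfolding smooth_fun_def Int_UNIV_right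
proof
  fix c assume c: "c \<in> atlas M"
  show "smooth_on (snd c ` fst c) (normal \<circ> chart_inv c)"
  proof (rule smooth_on_frames[OF c])
    fix i
    show "smooth_on (snd c ` (fst c \<inter> fdom M i)) (normal \<circ> chart_inv c)"
    proof (cases "fst c \<inter> fdom M i = {}")
      case False
      then obtain p where "p \<in> fst c" "p \<in> fdom M i" by blast
      then interpret odd_spinor_frame M c i p \<psi> by (rule frame[OF c])
      show ?thesis
        by (rule smooth_on_frame_cong[OF c E_smooth[of qe1]]) (simp add: normal_eq pairing_clif_odd odd)
    qed (simp add: smooth_on_empty)
  qed
qed

lemma \<Xi>_change:
  assumes c: "c \<in> atlas M" "p \<in> fst c" and d: "d \<in> atlas M" "p \<in> fst d"
  shows "\<Xi> d p (cdiff c (snd d) p v) = \<Xi> c p v"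
proof -
  let ?i = "frame_index p"
  have "frame2 M ?i d p = cdiff c (snd d) p (frame2 M ?i c p)" "frame3 M ?i d p = cdiff c (snd d) p (frame3 M ?i c p)"
    using surface_frames[OF surface, of ?i] c d frame_index unfolding vector_field_def by blast+
  then have "tcoord M ?i d p (cdiff c (snd d) p v) = tcoord M ?i c p v"
    unfolding tcoord_def
    using metric_change[OF surface_metric[OF surface] c(1) d(1), of p v] c d by simp
  then show ?thesis unfolding \<Xi>_def by simp
qed

text \<open>The integration theorem concerns real-valued forms, so the vector-valued
  \<open>\<Xi>\<close> is integrated one linear coordinate \<open>L\<close> at a time.\<close>

lemma component_primitive:
  assumes sc: "simply_connected (UNIV :: 'm set)" and L: "bounded_linear L"
  shows "\<exists>G. \<forall>c\<in>atlas M. \<forall>p\<in>fst c. (G \<circ> chart_inv c has_derivative (\<lambda>v. (L (\<Xi> c p v) :: real))) (at (snd c p))"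
proof (rule closed_one_form_exact[OF surface_atlas[OF surface] sc])
  fix c p assume c: "c \<in> atlas M" "p \<in> fst c"
  show "linear (\<lambda>v. L (\<Xi> c p v))"
    using linear_compose[OF \<Xi>_linear[OF c] bounded_linear.linear[OF L]] by (simp add: o_def)
  have d: "cdiff c (\<lambda>q. L (\<Xi> c q v)) p w = L (cdiff c (\<lambda>q. \<Xi> c q v) p w)" for v w
    using bounded_linear.has_derivative[OF L \<Xi>_has_derivative[OF c, of v]]
    by (simp add: cdiff_eq[OF \<Xi>_has_derivative[OF c, of v]] cdiff_eq o_def)
  show "cdiff c (\<lambda>q. L (\<Xi> c q v)) p w = cdiff c (\<lambda>q. L (\<Xi> c q w)) p v" for v w
    unfolding d \<Xi>_closed[OF c, of v w] ..
  show "L (\<Xi> d p (cdiff c (snd d) p v)) = L (\<Xi> c p v)" if "d \<in> atlas M" "p \<in> fst d" for d v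
    using \<Xi>_change[OF c that] by simp
next
  fix c v assume c: "c \<in> atlas M"
  show "smooth_on (snd c ` fst c) ((\<lambda>p. L (\<Xi> c p v)) \<circ> chart_inv c)"
    using smooth_on_bounded_linear[OF L open_chart_range[OF surface_atlas[OF surface] c] \<Xi>_smooth[OF c]]
    by (simp add: o_def)
qed

lemma smooth_primitive:
  assumes "\<And>c p. c \<in> atlas M \<Longrightarrow> p \<in> fst c \<Longrightarrow> (G \<circ> chart_inv c has_derivative \<Xi> c p) (at (snd c p))"
  shows "smooth_fun (atlas M) UNIV G"
  unfolding smooth_fun_def Int_UNIV_right
proof
  fix c assume c: "c \<in> atlas M"
  note A = surface_atlas[OF surface]
  show "smooth_on (snd c ` fst c) (G \<circ> chart_inv c)"
  proof (rule smooth_on_primitive[OF open_chart_range[OF A c]])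
    show "(G \<circ> chart_inv c has_derivative \<Xi> c (chart_inv c x)) (at x)" if "x \<in> snd c ` fst c" for x
      using that assms[OF c] chart_inv_snd[OF A c] by auto
    show "smooth_on (snd c ` fst c) (\<lambda>x. \<Xi> c (chart_inv c x) v)" for v
      using \<Xi>_smooth[OF c, of v] by (simp add: o_def)
  qed
qed

theorem induced_exists:
  assumes sc: "simply_connected (UNIV :: 'm set)"
  shows "\<exists>G. induced_by M \<psi> G"
proof -
  obtain G1 G2 G3 where G:
    "\<And>c p. c \<in> atlas M \<Longrightarrow> p \<in> fst c \<Longrightarrow> (G1 \<circ> chart_inv c has_derivative (\<lambda>v. component1 (\<Xi> c p v))) (at (snd c p))"
    "\<And>c p. c \<in> atlas M \<Longrightarrow> p \<in> fst c \<Longrightarrow> (G2 \<circ> chart_inv c has_derivative (\<lambda>v. component2 (\<Xi> c p v))) (at (snd c p))"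
    "\<And>c p. c \<in> atlas M \<Longrightarrow> p \<in> fst c \<Longrightarrow> (G3 \<circ> chart_inv c has_derivative (\<lambda>v. component3 (\<Xi> c p v))) (at (snd c p))"
    using component_primitive[OF sc bounded_linear_components(1)]
      component_primitive[OF sc bounded_linear_components(2)]
      component_primitive[OF sc bounded_linear_components(3)] by metis
  \<comment> \<open>The \<open>e\<^sub>0\<close> coordinate can be 0 because \<open>\<Xi>\<close>
    takes values in \<open>R21\<close>.\<close>
  define G where "G = (\<lambda>p. vec22 0 (G1 p) (G2 p) (G3 p))"
  have d: "(G \<circ> chart_inv c has_derivative \<Xi> c p) (at (snd c p))" if c: "c \<in> atlas M" "p \<in> fst c" for c p
  proof -
    have "((\<lambda>x. (G1 \<circ> chart_inv c) x *\<^sub>R qe1 + (G2 \<circ> chart_inv c) x *\<^sub>R qe2 + (G3 \<circ> chart_inv c) x *\<^sub>R qe3)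
      has_derivative (\<lambda>v. proj21 (\<Xi> c p v))) (at (snd c p))"
      unfolding proj21_def
      by (intro has_derivative_add has_derivative_scaleR_left G c)
    then show ?thesis
      using \<Xi>_R21[OF c] unfolding R21_iff_proj21 by (simp add: G_def vec22_eq o_def)
  qed
  have "G p \<in> R22" for p unfolding G_def R22_def by blast
  moreover have "cdiff c G p v = pairing (clif (tcoord M i c p v) (\<psi> i p)) (\<psi> i p)"
    if "c \<in> atlas M" "p \<in> fst c" "p \<in> fdom M i" for c i p v
    using cdiff_eq[OF d] \<Xi>_eq that by simp
  ultimately have "induced_by M \<psi> G"
    unfolding induced_by_def using smooth_primitive[OF d] by blast
  then show ?thesis by blast
qed

text \<open>A primitive is determined only up to translation and may lie in an affine hyperplane
  parallel to \<open>R21\<close>; subtracting its value at one point moves it into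
  \<open>R21\<close>.\<close>

theorem induced_cmc:
  assumes sc: "simply_connected (UNIV :: 'm set)" and G: "induced_by M \<psi> G"
  shows "cmc_immersion_R21 M (\<lambda>p. G p - G p0) normal 1"
proof -
  note A = surface_atlas[OF surface]
  let ?F = "\<lambda>p. G p - G p0"
  have dG: "(G \<circ> chart_inv c has_derivative \<Xi> c p) (at (snd c p))" if c: "c \<in> atlas M" "p \<in> fst c" for c p
  proof -
    have "smooth_on (snd c ` fst c) (G \<circ> chart_inv c)"
      using G c unfolding induced_by_def smooth_fun_def by simp
    from smooth_on_cdiff[OF this c(2)]
    have "(G \<circ> chart_inv c has_derivative cdiff c G p) (at (snd c p))" .
    moreover have "cdiff c G p = \<Xi> c p"
      using G c frame_index[of p] unfolding induced_by_def \<Xi>_def fun_eq_iff by blast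
    ultimately show ?thesis by simp
  qed
  have dF: "(?F \<circ> chart_inv c has_derivative \<Xi> c p) (at (snd c p))" if c: "c \<in> atlas M" "p \<in> fst c" for c p
    using has_derivative_diff[OF dG[OF c] has_derivative_const[of "G p0"]] by (simp add: o_def)
  note cF = cdiff_eq[OF dF]
  have F22: "?F p \<in> R22" for p
    using G R22_diff unfolding induced_by_def by blast
  \<comment> \<open>The differential has no \<open>e\<^sub>0\<close> component, so this coordinate
    keeps the value 0 that it has at \<open>p0\<close>.\<close>
  have "component0 (?F p) = component0 (?F p0)" for p
  proof (rule zero_differential_imp_constant[OF A sc])
    fix c p assume c: "c \<in> atlas M" "p \<in> fst c"
    have "((\<lambda>x. component0 ((?F \<circ> chart_inv c) x)) has_derivative (\<lambda>v. component0 (\<Xi> c p v))) (at (snd c p))"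
      by (rule bounded_linear.has_derivative[OF bounded_linear_component0 dF[OF c]])
    then show "((\<lambda>p. component0 (?F p)) \<circ> chart_inv c has_derivative (\<lambda>v. 0)) (at (snd c p))"
      using \<Xi>_R21[OF c] by (simp add: R21_iff_component0 o_def)
  qed
  then have F21: "?F p \<in> R21" for p
    using F22 linear_0[OF bounded_linear.linear[OF bounded_linear_component0]] by (simp add: R21_iff_component0)
  have local: "inj (\<Xi> c p)" "Hform (\<Xi> c p v) (\<Xi> c p w) = of_real (metric M c p v w)"
    "Hform (normal p) (\<Xi> c p v) = 0" if c: "c \<in> atlas M" "p \<in> fst c" for c p v w
  proof -
    interpret odd_spinor_frame M c "frame_index p" p \<psi> by (rule frame[OF c frame_index])
    show "inj (\<Xi> c p)" using \<xi>_inj unfolding \<Xi>_def by (rule injI)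
    show "Hform (\<Xi> c p v) (\<Xi> c p w) = of_real (metric M c p v w)"
      unfolding \<Xi>_def by (rule \<xi>_metric)
    show "Hform (normal p) (\<Xi> c p v) = 0"
      unfolding \<Xi>_def normal_def pairing_clif_odd[OF odd[OF frame_index], of qe1] by (rule normal_tangent)
  qed
  have normal: "normal p \<in> R21" "Hform (normal p) (normal p) = 1" for p
  proof -
    obtain c where c: "c \<in> atlas M" "p \<in> fst c" using chart_exists[OF A] by blast
    interpret odd_spinor_frame M c "frame_index p" p \<psi> by (rule frame[OF c frame_index])
    show "normal p \<in> R21" "Hform (normal p) (normal p) = 1"
      unfolding normal_def pairing_clif_odd[OF odd[OF frame_index]]
      using E_R21[OF qe_in_R21(1)] normal_unit by blast+
  qed
  have mean: "mean_curvature_vector M c i ?F p = normal p"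
    if c: "c \<in> atlas M" "p \<in> fst c" "p \<in> fdom M i" for c i p
  proof -
    interpret odd_spinor_frame M c i p \<psi> by (rule frame[OF c])
    have "(?F \<circ> chart_inv c has_derivative (\<lambda>v. \<xi> v q)) (at (snd c q))" if "q \<in> fst c" "q \<in> fdom M i" for q
    proof -
      have "\<Xi> c q = (\<lambda>v. \<xi> v q)" by (intro ext \<Xi>_eq c(1) that)
      with dF[OF c(1) that(1)] show ?thesis by simp
    qed
    from mean_curvature_primitive[OF this]
    show ?thesis unfolding normal_eq[OF c(3)] pairing_clif_odd[OF odd[OF c(3)]] .
  qed
  have "isometric_immersion M ?F"
    unfolding isometric_immersion_def
    using smooth_primitive[OF dF] F22 local(1,2) by (simp add: cF inj_def)
  moreover have "unit_normal_R21 M ?F normal"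
    unfolding unit_normal_R21_def using normal_smooth normal local(3) by (simp add: cF)
  ultimately show ?thesis
    unfolding cmc_immersion_R21_def using F21 mean by simp
qed

end

theorem mainTheorem7:
  fixes M :: "('m::{t2_space, second_countable_topology}, 'i) spin_surface"
    and \<phi> \<phi>t :: "('m, 'i) spinor"
    and F :: "'m \<Rightarrow> hac"
  assumes "lorentzian_spin_surface M"
    and "simply_connected (UNIV :: 'm set)"
    and "minimal_immersion_S12 M F"
    and "spinor_field M \<phi>"
    and "represented_in_S12 M \<phi> F"
    and "dirac_eq M \<phi> (\<lambda>i p. clif qe1 (\<phi> i p))"
    and "unit_spinor M \<phi>"
    and \<phi>t_def: "\<phi>t = (\<lambda>i p. plus_part (\<phi> i p) + clif qe0 (plus_part (\<phi> i p)))"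
  shows "spinor_field M \<phi>t \<and>
    dirac_eq M \<phi>t (\<lambda>i p. clif qe1 (\<phi>t i p)) \<and>
    unit_spinor M \<phi>t \<and>
    spinor_eq M (\<lambda>i p. clif qe0 (\<phi>t i p)) \<phi>t \<and>
    (\<exists>G. induced_by M \<phi>t G) \<and>
    (\<forall>G. induced_by M \<phi>t G \<longrightarrow>
       (\<exists>a\<in>R22. \<exists>N.
          (\<forall>i. \<forall>p\<in>fdom M i. N p = pairing (clif qe1 (\<phi>t i p)) (\<phi>t i p)) \<and>
          cmc_immersion_R21 M (\<lambda>p. G p - a) N 1))"
proof -
  have \<phi>t: "\<phi>t = (\<lambda>i p. odd_part (\<phi> i p))" unfolding \<phi>t_def odd_part_def ..
  interpret odd_spinor M \<phi>t
  proof
    show "lorentzian_spin_surface M" by fact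
    show "spinor_field M \<phi>t" unfolding \<phi>t by (rule spinor_field_odd_part) fact+
    show "qhat (\<phi>t i q) = - \<phi>t i q" for i q unfolding \<phi>t by (rule qhat_odd_part)
    show "unit_spinor M \<phi>t"
      using \<open>unit_spinor M \<phi>\<close> unfolding \<phi>t unit_spinor_def by (simp add: Hform_odd_part)
    show "dirac_eq M \<phi>t (\<lambda>i p. clif qe1 (\<phi>t i p))"
      unfolding \<phi>t by (rule dirac_eq_odd_part) fact+
  qed
  have "spinor_eq M (\<lambda>i p. clif qe0 (\<phi>t i p)) \<phi>t"
    unfolding spinor_eq_def by (simp add: clif_qe0 odd)
  moreover have "\<exists>a\<in>R22. \<exists>N. (\<forall>i. \<forall>p\<in>fdom M i. N p = pairing (clif qe1 (\<phi>t i p)) (\<phi>t i p)) \<and>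
      cmc_immersion_R21 M (\<lambda>p. G p - a) N 1" if "induced_by M \<phi>t G" for G
  \<comment> \<open>Here \<open>undefined\<close> is just an arbitrary point of the surface, serving
    as origin of the translation.\<close>
  proof (intro bexI[of _ "G undefined"] exI[of _ normal] conjI ballI allI)
    show "normal p = pairing (clif qe1 (\<phi>t i p)) (\<phi>t i p)" if "p \<in> fdom M i" for i p
      by (rule normal_eq[OF that])
    show "cmc_immersion_R21 M (\<lambda>p. G p - G undefined) normal 1"
      by (rule induced_cmc[OF \<open>simply_connected (UNIV :: 'm set)\<close> that])
    show "G undefined \<in> R22" using that unfolding induced_by_def by blast
  qed
  ultimately show ?thesis
    using field dirac unit induced_exists[OF \<open>simply_connected (UNIV :: 'm set)\<close>] by blast
qed

end
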